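(* Let $F$ be a field, let $D$ be a subring of $F$, let $Z$ be a subspace of the Zariski-Riemann space of $F/D$ with $F \in Z$, and let $A = \bigcap_{V \in Z} V$; regard $Z$ as a locally ringed space over $\mathrm{Spec}(A)$. Then $A$ is a Prüfer domain with torsion Picard group and quotient field $F$ if and only if for each $A$-morphism $\phi : Z \rightarrow \mathbb{P}^1_A$ there is a homogeneous polynomial $f \in A[T_0,T_1]$ of positive degree such that the image of $\phi$ is contained in $(\mathbb{P}^1_A)_f$.
   Context: A subring $V$ of $F$ is a valuation ring of $F$ if for each nonzero $x \in F$, $x \in V$ or $x^{-1} \in V$ (so $F$ itself is one). $D$ need not have quotient field $F$. The Zariski-Riemann space $\mathfrak{X}$ of $F/D$ is the set of all valuation rings of $F$ containing $D$, with the topology whose basic open sets are $\{V \in \mathfrak{X} : t_1,\ldots,t_n \in V\}$, $t_1,\ldots,t_n \in F$; $Z$ is any subset of $\mathfrak{X}$ containing $F$, with the subspace topology. $Z$ is a locally ringed space with structure sheaf $\mathcal{O}_Z(U) = \bigcap_{V \in U} V$ for nonempty open $U \subseteq Z$ and $\mathcal{O}_Z(\emptyset) = 0$; restriction maps off the empty set are inclusions, and the stalk at $V \in Z$ is $V$. The structure morphism $Z \to \mathrm{Spec}(A)$ sends $V$ to its center in $A$ (the contraction to $A$ of the maximal ideal of $V$), and is given on sections by inclusions inside $F$. All morphisms are morphisms of locally ringed spaces. An $A$-morphism is a morphism commuting with the given morphisms to $\mathrm{Spec}(A)$. $\mathbb{P}^1_A = \mathrm{Proj}(A[T_0,T_1])$,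 and $(\mathbb{P}^1_A)_f$ is the open set of homogeneous primes in $\mathrm{Proj}(A[T_0,T_1])$ not containing $f$. $A$ is a Prüfer domain with quotient field $F$ if for every prime ideal $P$ of $A$ the localization $A_P$ is a valuation ring of $F$. *)

theory Defs
  imports
    "HOL-Analysis.Abstract_Topology"
    "HOL-Algebra.Ideal_Product"
    "HOL-Algebra.Subrings"
    "HOL-Algebra.UnivPoly"
begin

section \<open>Local rings and localization\<close>

text \<open>Only meaningful for a local ring, where the description is unique.\<close>
definition max_ideal :: "('a, 'm) ring_scheme \<Rightarrow> 'a set" where
  "max_ideal R = (THE M. maximalideal M R)"

definition local_hom ::
  "('a, 'm) ring_scheme \<Rightarrow> ('b, 'n) ring_scheme \<Rightarrow> ('a \<Rightarrow> 'b) \<Rightarrow> bool" where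
  "local_hom R S h \<longleftrightarrow> h \<in> ring_hom R S \<and> h ` max_ideal R \<subseteq> max_ideal S"

text \<open>The fraction \<open>a / s\<close> in the localization of \<open>R\<close> at the multiplicative set \<open>S\<close>, as an
  equivalence class of pairs.\<close>
definition fraction :: "('a, 'm) ring_scheme \<Rightarrow> 'a set \<Rightarrow> 'a \<Rightarrow> 'a \<Rightarrow> ('a \<times> 'a) set" where
  "fraction R S a s =
    {(b, t). b \<in> carrier R \<and> t \<in> S \<and>
      (\<exists>u\<in>S. u \<otimes>\<^bsub>R\<^esub> (t \<otimes>\<^bsub>R\<^esub> a) = u \<otimes>\<^bsub>R\<^esub> (s \<otimes>\<^bsub>R\<^esub> b))}"

text \<open>In sums and products of classes the unions range over all choices of representatives; every
  choice gives the same class.\<close>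
definition localization :: "('a, 'm) ring_scheme \<Rightarrow> 'a set \<Rightarrow> ('a \<times> 'a) set ring" where
  "localization R S =
    \<lparr> carrier = {fraction R S a s | a s. a \<in> carrier R \<and> s \<in> S},
      mult = (\<lambda>X Y. \<Union>(a, s)\<in>X. \<Union>(b, t)\<in>Y. fraction R S (a \<otimes>\<^bsub>R\<^esub> b) (s \<otimes>\<^bsub>R\<^esub> t)),
      one = fraction R S \<one>\<^bsub>R\<^esub> \<one>\<^bsub>R\<^esub>,
      zero = fraction R S \<zero>\<^bsub>R\<^esub> \<one>\<^bsub>R\<^esub>,
      add = (\<lambda>X Y. \<Union>(a, s)\<in>X. \<Union>(b, t)\<in>Y.
               fraction R S (a \<otimes>\<^bsub>R\<^esub> t \<oplus>\<^bsub>R\<^esub> b \<otimes>\<^bsub>R\<^esub> s) (s \<otimes>\<^bsub>R\<^esub> t)) \<rparr>"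

definition local_ring_at :: "('a, 'm) ring_scheme \<Rightarrow> 'a set \<Rightarrow> ('a \<times> 'a) set ring" where
  "local_ring_at R P = localization R (carrier R - P)"


section \<open>Ringed spaces and their morphisms\<close>

text \<open>Points have type \<open>'p\<close>, sections have type \<open>'r\<close>. Only open sets are meaningful as arguments
  of \<open>sections\<close> and \<open>restr\<close>; \<open>restr U W\<close> is the restriction from \<open>U\<close> to \<open>W\<close>.\<close>
record ('p, 'r) ringed_space =
  space_top :: "'p topology"
  sections :: "'p set \<Rightarrow> 'r ring"
  restr :: "'p set \<Rightarrow> 'p set \<Rightarrow> 'r \<Rightarrow> 'r"

definition germ :: "('p, 'r) ringed_space \<Rightarrow> 'p \<Rightarrow> 'p set \<Rightarrow> 'r \<Rightarrow> ('p set \<times> 'r) set" where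
  "germ X x U s =
    {(V, t). openin (space_top X) V \<and> x \<in> V \<and> t \<in> carrier (sections X V) \<and>
      (\<exists>W. openin (space_top X) W \<and> x \<in> W \<and> W \<subseteq> U \<inter> V \<and> restr X U W s = restr X V W t)}"

definition stalk :: "('p, 'r) ringed_space \<Rightarrow> 'p \<Rightarrow> ('p set \<times> 'r) set ring" where
  "stalk X x =
    \<lparr> carrier = {germ X x U s | U s.
        openin (space_top X) U \<and> x \<in> U \<and> s \<in> carrier (sections X U)},
      mult = (\<lambda>G H. \<Union>(U, s)\<in>G. \<Union>(V, t)\<in>H. germ X x (U \<inter> V)
        (restr X U (U \<inter> V) s \<otimes>\<^bsub>sections X (U \<inter> V)\<^esub> restr X V (U \<inter> V) t)),
      one = germ X x (topspace (space_top X)) \<one>\<^bsub>sections X (topspace (space_top X))\<^esub>,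
      zero = germ X x (topspace (space_top X)) \<zero>\<^bsub>sections X (topspace (space_top X))\<^esub>,
      add = (\<lambda>G H. \<Union>(U, s)\<in>G. \<Union>(V, t)\<in>H. germ X x (U \<inter> V)
        (restr X U (U \<inter> V) s \<oplus>\<^bsub>sections X (U \<inter> V)\<^esub> restr X V (U \<inter> V) t)) \<rparr>"

text \<open>A map \<open>X \<rightarrow> Y\<close>: the map on points, and for each open \<open>V\<close> of \<open>Y\<close> the map
  \<open>pull V\<close> from sections over \<open>V\<close> to sections over the preimage of \<open>V\<close>.\<close>
record ('p, 'r, 'q, 's) ringed_map =
  pt :: "'p \<Rightarrow> 'q"
  pull :: "'q set \<Rightarrow> 's \<Rightarrow> 'r"

definition preim ::
  "('p, 'r) ringed_space \<Rightarrow> ('p, 'r, 'q, 's) ringed_map \<Rightarrow> 'q set \<Rightarrow> 'p set" where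
  "preim X f V = {x \<in> topspace (space_top X). pt f x \<in> V}"

definition stalk_map ::
  "('p, 'r) ringed_space \<Rightarrow> ('p, 'r, 'q, 's) ringed_map \<Rightarrow> 'p
    \<Rightarrow> ('q set \<times> 's) set \<Rightarrow> ('p set \<times> 'r) set" where
  "stalk_map X f x G = (\<Union>(V, t)\<in>G. germ X x (preim X f V) (pull f V t))"

text \<open>Meant for \<open>X\<close> and \<open>Y\<close> that are known to be locally ringed spaces; this is not part of the
  predicate.\<close>
definition lrs_morphism ::
  "('p, 'r) ringed_space \<Rightarrow> ('q, 's) ringed_space \<Rightarrow> ('p, 'r, 'q, 's) ringed_map \<Rightarrow> bool" where
  "lrs_morphism X Y f \<longleftrightarrow>
    continuous_map (space_top X) (space_top Y) (pt f) \<and>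
    (\<forall>V. openin (space_top Y) V \<longrightarrow>
      pull f V \<in> ring_hom (sections Y V) (sections X (preim X f V))) \<and>
    (\<forall>V W. openin (space_top Y) V \<longrightarrow> openin (space_top Y) W \<longrightarrow> W \<subseteq> V \<longrightarrow>
      (\<forall>t\<in>carrier (sections Y V).
        restr X (preim X f V) (preim X f W) (pull f V t) = pull f W (restr Y V W t))) \<and>
    (\<forall>x\<in>topspace (space_top X). local_hom (stalk Y (pt f x)) (stalk X x) (stalk_map X f x))"

text \<open>\<open>p = q \<circ> f\<close> for \<open>f : X \<rightarrow> Y\<close>, \<open>p : X \<rightarrow> B\<close>, \<open>q : Y \<rightarrow> B\<close>, as equality of maps of ringed
  spaces; only points of \<open>X\<close>, open subsets of \<open>B\<close> and actual sections are compared.\<close>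
definition commutes_over ::
  "('p, 'r) ringed_space \<Rightarrow> ('q, 's) ringed_space \<Rightarrow> ('b, 't) ringed_space
    \<Rightarrow> ('p, 'r, 'b, 't) ringed_map \<Rightarrow> ('q, 's, 'b, 't) ringed_map
    \<Rightarrow> ('p, 'r, 'q, 's) ringed_map \<Rightarrow> bool" where
  "commutes_over X Y B p q f \<longleftrightarrow>
    (\<forall>x\<in>topspace (space_top X). pt p x = pt q (pt f x)) \<and>
    (\<forall>W. openin (space_top B) W \<longrightarrow>
      (\<forall>s\<in>carrier (sections B W). pull p W s = pull f (preim Y q W) (pull q W s)))"


section \<open>Spec and Proj\<close>

text \<open>The ring structure on a set \<open>C\<close> of functions on \<open>U\<close> with values in the rings \<open>L P\<close>.\<close>
definition pointwise_ring ::
  "'p set \<Rightarrow> ('p \<Rightarrow> ('b, 'm) ring_scheme) \<Rightarrow> ('p \<Rightarrow> 'b) set \<Rightarrow> ('p \<Rightarrow> 'b) ring" where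
  "pointwise_ring U L C =
    \<lparr> carrier = C,
      mult = (\<lambda>s t. \<lambda>P\<in>U. s P \<otimes>\<^bsub>L P\<^esub> t P),
      one = (\<lambda>P\<in>U. \<one>\<^bsub>L P\<^esub>),
      zero = (\<lambda>P\<in>U. \<zero>\<^bsub>L P\<^esub>),
      add = (\<lambda>s t. \<lambda>P\<in>U. s P \<oplus>\<^bsub>L P\<^esub> t P) \<rparr>"

definition spec_top :: "('a, 'm) ring_scheme \<Rightarrow> 'a set topology" where
  "spec_top R = topology_generated_by {{P. primeideal P R \<and> f \<notin> P} | f. f \<in> carrier R}"

definition spec_sections ::
  "('a, 'm) ring_scheme \<Rightarrow> 'a set set \<Rightarrow> ('a set \<Rightarrow> ('a \<times> 'a) set) ring" where
  "spec_sections R U = pointwise_ring U (local_ring_at R)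
    {s \<in> (\<Pi>\<^sub>E P\<in>U. carrier (local_ring_at R P)).
      \<forall>P\<in>U. \<exists>V. openin (spec_top R) V \<and> P \<in> V \<and> V \<subseteq> U \<and>
        (\<exists>a\<in>carrier R. \<exists>f\<in>carrier R.
          \<forall>Q\<in>V. f \<notin> Q \<and> s Q = fraction R (carrier R - Q) a f)}"

definition Spec ::
  "('a, 'm) ring_scheme \<Rightarrow> ('a set, 'a set \<Rightarrow> ('a \<times> 'a) set) ringed_space" where
  "Spec R = \<lparr> space_top = spec_top R, sections = spec_sections R, restr = (\<lambda>U W s. restrict s W) \<rparr>"

text \<open>A graded ring is a ring \<open>S\<close> with a family \<open>gr\<close>, where \<open>gr d\<close> is the set of homogeneous
  elements of degree \<open>d\<close> (including zero).\<close>
definition homogeneous_ideal :: "('s, 'm) ring_scheme \<Rightarrow> (nat \<Rightarrow> 's set) \<Rightarrow> 's set \<Rightarrow> bool" where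
  "homogeneous_ideal S gr I \<longleftrightarrow> ideal I S \<and> I = Idl\<^bsub>S\<^esub> (I \<inter> (\<Union>d. gr d))"

definition proj_points :: "('s, 'm) ring_scheme \<Rightarrow> (nat \<Rightarrow> 's set) \<Rightarrow> 's set set" where
  "proj_points S gr =
    {P. primeideal P S \<and> homogeneous_ideal S gr P \<and> \<not> (\<Union>d\<in>{0<..}. gr d) \<subseteq> P}"

definition proj_top :: "('s, 'm) ring_scheme \<Rightarrow> (nat \<Rightarrow> 's set) \<Rightarrow> 's set topology" where
  "proj_top S gr = subtopology (spec_top S) (proj_points S gr)"

definition homogeneous_outside :: "(nat \<Rightarrow> 's set) \<Rightarrow> 's set \<Rightarrow> 's set" where
  "homogeneous_outside gr P = (\<Union>d. gr d) - P"

text \<open>The degree zero part of the localization at the homogeneous elements outside \<open>P\<close>.\<close>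
definition homogeneous_local_ring_at ::
  "('s, 'm) ring_scheme \<Rightarrow> (nat \<Rightarrow> 's set) \<Rightarrow> 's set \<Rightarrow> ('s \<times> 's) set ring" where
  "homogeneous_local_ring_at S gr P =
    localization S (homogeneous_outside gr P)
      \<lparr> carrier := {fraction S (homogeneous_outside gr P) a f | a f d.
                    a \<in> gr d \<and> f \<in> gr d \<and> f \<notin> P} \<rparr>"

definition proj_sections ::
  "('s, 'm) ring_scheme \<Rightarrow> (nat \<Rightarrow> 's set) \<Rightarrow> 's set set \<Rightarrow> ('s set \<Rightarrow> ('s \<times> 's) set) ring" where
  "proj_sections S gr U = pointwise_ring U (homogeneous_local_ring_at S gr)
    {s \<in> (\<Pi>\<^sub>E P\<in>U. carrier (homogeneous_local_ring_at S gr P)).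
      \<forall>P\<in>U. \<exists>V. openin (proj_top S gr) V \<and> P \<in> V \<and> V \<subseteq> U \<and>
        (\<exists>d. \<exists>a\<in>gr d. \<exists>f\<in>gr d.
          \<forall>Q\<in>V. f \<notin> Q \<and> s Q = fraction S (homogeneous_outside gr Q) a f)}"

definition Proj ::
  "('s, 'm) ring_scheme \<Rightarrow> (nat \<Rightarrow> 's set) \<Rightarrow> ('s set, 's set \<Rightarrow> ('s \<times> 's) set) ringed_space" where
  "Proj S gr =
    \<lparr> space_top = proj_top S gr, sections = proj_sections S gr, restr = (\<lambda>U W s. restrict s W) \<rparr>"

text \<open>The structure map \<open>Proj S \<rightarrow> Spec R\<close> induced by a ring homomorphism \<open>c\<close> from \<open>R\<close> into the
  degree zero part of \<open>S\<close>. On sections it is \<open>a / b \<mapsto> c a / c b\<close> at each point.\<close>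
definition proj_to_spec ::
  "('a, 'm) ring_scheme \<Rightarrow> ('s, 'n) ring_scheme \<Rightarrow> (nat \<Rightarrow> 's set) \<Rightarrow> ('a \<Rightarrow> 's)
    \<Rightarrow> ('s set, 's set \<Rightarrow> ('s \<times> 's) set, 'a set, 'a set \<Rightarrow> ('a \<times> 'a) set) ringed_map" where
  "proj_to_spec R S gr c =
    (let \<pi> = (\<lambda>P. {a \<in> carrier R. c a \<in> P}) in
      \<lparr> pt = \<pi>,
        pull = (\<lambda>W s. \<lambda>P\<in>{P \<in> proj_points S gr. \<pi> P \<in> W}.
          \<Union>(a, b)\<in>s (\<pi> P). fraction S (homogeneous_outside gr P) (c a) (c b)) \<rparr>)"


section \<open>The projective line\<close>

text \<open>\<open>R[T\<^sub>0, T\<^sub>1]\<close> is taken to be \<open>(R[T\<^sub>1])[T\<^sub>0]\<close>, so the coefficient of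
  \<open>T\<^sub>0\<^sup>i T\<^sub>1\<^sup>j\<close> in \<open>f\<close> is \<open>coeff (coeff f i) j\<close>.\<close>
type_synonym 'a poly2 = "nat \<Rightarrow> nat \<Rightarrow> 'a"

abbreviation poly2_ring :: "('a, 'm) ring_scheme \<Rightarrow> (nat \<Rightarrow> 'a, 'a poly2) up_ring" where
  "poly2_ring R \<equiv> UP (UP R)"

definition poly2_homogeneous :: "('a, 'm) ring_scheme \<Rightarrow> nat \<Rightarrow> 'a poly2 set" where
  "poly2_homogeneous R d =
    {f \<in> carrier (poly2_ring R).
      \<forall>i j. coeff (UP R) (coeff (poly2_ring R) f i) j \<noteq> \<zero>\<^bsub>R\<^esub> \<longrightarrow> i + j = d}"

definition poly2_const :: "('a, 'm) ring_scheme \<Rightarrow> 'a \<Rightarrow> 'a poly2" where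
  "poly2_const R a = monom (poly2_ring R) (monom (UP R) a 0) 0"

definition P1 ::
  "('a, 'm) ring_scheme \<Rightarrow> ('a poly2 set, 'a poly2 set \<Rightarrow> ('a poly2 \<times> 'a poly2) set) ringed_space"
  where "P1 R = Proj (poly2_ring R) (poly2_homogeneous R)"

definition P1_to_spec ::
  "('a, 'm) ring_scheme \<Rightarrow> ('a poly2 set, 'a poly2 set \<Rightarrow> ('a poly2 \<times> 'a poly2) set,
    'a set, 'a set \<Rightarrow> ('a \<times> 'a) set) ringed_map" where
  "P1_to_spec R = proj_to_spec R (poly2_ring R) (poly2_homogeneous R) (poly2_const R)"

definition P1_nonvanishing :: "('a, 'm) ring_scheme \<Rightarrow> 'a poly2 \<Rightarrow> 'a poly2 set set" where
  "P1_nonvanishing R f = {P \<in> proj_points (poly2_ring R) (poly2_homogeneous R). f \<notin> P}"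


section \<open>The Zariski-Riemann space\<close>

text \<open>Subrings of the field \<open>F\<close> are represented by their carrier sets.\<close>
definition valuation_ring :: "'a set \<Rightarrow> ('a, 'm) ring_scheme \<Rightarrow> bool" where
  "valuation_ring V F \<longleftrightarrow>
    subring V F \<and> (\<forall>x\<in>carrier F - {\<zero>\<^bsub>F\<^esub>}. x \<in> V \<or> inv\<^bsub>F\<^esub> x \<in> V)"

definition zariski_riemann :: "('a, 'm) ring_scheme \<Rightarrow> 'a set \<Rightarrow> 'a set set" where
  "zariski_riemann F D = {V. valuation_ring V F \<and> D \<subseteq> V}"

definition zariski_riemann_top :: "('a, 'm) ring_scheme \<Rightarrow> 'a set \<Rightarrow> 'a set topology" where
  "zariski_riemann_top F D =
    topology_generated_by
      {{V \<in> zariski_riemann F D. T \<subseteq> V} | T. finite T \<and> T \<subseteq> carrier F}"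

definition zr_sections :: "'a ring \<Rightarrow> 'a set set \<Rightarrow> 'a ring" where
  "zr_sections F U =
    (if U = {} then F\<lparr>carrier := {\<zero>\<^bsub>F\<^esub>}, one := \<zero>\<^bsub>F\<^esub>\<rparr> else F\<lparr>carrier := \<Inter>U\<rparr>)"

definition zr_space :: "'a ring \<Rightarrow> 'a set \<Rightarrow> 'a set set \<Rightarrow> ('a set, 'a) ringed_space" where
  "zr_space F D Z =
    \<lparr> space_top = subtopology (zariski_riemann_top F D) Z,
      sections = zr_sections F,
      restr = (\<lambda>U W s. if W = {} then \<zero>\<^bsub>F\<^esub> else s) \<rparr>"

definition center :: "('a, 'm) ring_scheme \<Rightarrow> 'a set \<Rightarrow> 'a set \<Rightarrow> 'a set" where
  "center F A V = max_ideal (F\<lparr>carrier := V\<rparr>) \<inter> A"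

text \<open>On sections, a section of \<open>Spec A\<close> over a nonempty open set \<open>W\<close> is sent to the element \<open>x\<close>
  of \<open>F\<close> that it represents, i.e. to the \<open>x\<close> with \<open>x = a / b\<close> in \<open>F\<close> whenever \<open>a / b\<close> represents
  its value at a point of \<open>W\<close>. Since \<open>A\<close> is a domain, \<open>W\<close> is irreducible and \<open>x\<close> is unique. If
  \<open>F \<in> Z\<close>, the preimage of \<open>W\<close> is empty only when \<open>W\<close> is, since \<open>F\<close> is centered on the zero ideal.\<close>
definition zr_to_spec ::
  "'a ring \<Rightarrow> 'a set \<Rightarrow> ('a set, 'a, 'a set, 'a set \<Rightarrow> ('a \<times> 'a) set) ringed_map" where
  "zr_to_spec F A =
    \<lparr> pt = center F A,
      pull = (\<lambda>W s. if W = {} then \<zero>\<^bsub>F\<^esub>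
        else THE x. x \<in> carrier F \<and> (\<forall>P\<in>W. \<forall>(a, b)\<in>s P. x \<otimes>\<^bsub>F\<^esub> b = a)) \<rparr>"

definition zr_P1_morphism ::
  "'a ring \<Rightarrow> 'a set \<Rightarrow> 'a set set \<Rightarrow> 'a set
    \<Rightarrow> ('a set, 'a, 'a poly2 set, 'a poly2 set \<Rightarrow> ('a poly2 \<times> 'a poly2) set) ringed_map
    \<Rightarrow> bool" where
  "zr_P1_morphism F D Z A \<phi> \<longleftrightarrow>
    (let R = F\<lparr>carrier := A\<rparr> in
      lrs_morphism (zr_space F D Z) (P1 R) \<phi> \<and>
      commutes_over (zr_space F D Z) (P1 R) (Spec R) (zr_to_spec F A) (P1_to_spec R) \<phi>)"


section \<open>Pruefer domains and the Picard group\<close>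

text \<open>The localization of a subring \<open>A\<close> of \<open>F\<close> at a prime ideal, inside \<open>F\<close>.\<close>
definition localization_in :: "('a, 'm) ring_scheme \<Rightarrow> 'a set \<Rightarrow> 'a set \<Rightarrow> 'a set" where
  "localization_in F A P = {a \<otimes>\<^bsub>F\<^esub> inv\<^bsub>F\<^esub> b | a b. a \<in> A \<and> b \<in> A - P}"

text \<open>\<open>A\<close> is a Pruefer domain with quotient field \<open>F\<close>. The case of the zero ideal forces the
  quotient field of \<open>A\<close> to be \<open>F\<close>.\<close>
definition pruefer_domain_with_quotient_field :: "'a set \<Rightarrow> ('a, 'm) ring_scheme \<Rightarrow> bool" where
  "pruefer_domain_with_quotient_field A F \<longleftrightarrow>
    subring A F \<and>
    (\<forall>P. primeideal P (F\<lparr>carrier := A\<rparr>) \<longrightarrow> valuation_ring (localization_in F A P) F)"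

definition submodule_of_field :: "('a, 'm) ring_scheme \<Rightarrow> 'a set \<Rightarrow> 'a set \<Rightarrow> bool" where
  "submodule_of_field F A I \<longleftrightarrow>
    subgroup I (add_monoid F) \<and> (\<forall>a\<in>A. \<forall>x\<in>I. a \<otimes>\<^bsub>F\<^esub> x \<in> I)"

text \<open>The Picard group of the domain \<open>A\<close> is the group of invertible fractional ideals modulo
  principal ones. No common denominator is demanded: when
  \<open>F\<close> is the quotient field of \<open>A\<close>, invertibility makes \<open>I\<close> finitely generated, so it has one.\<close>
definition invertible_ideals :: "('a, 'm) ring_scheme \<Rightarrow> 'a set \<Rightarrow> 'a set monoid" where
  "invertible_ideals F A =
    \<lparr> carrier = {I. submodule_of_field F A I \<and> (\<exists>J. submodule_of_field F A J \<and> I \<cdot>\<^bsub>F\<^esub> J = A)},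
      mult = ideal_prod F,
      one = A \<rparr>"

definition principal_ideals :: "('a, 'm) ring_scheme \<Rightarrow> 'a set \<Rightarrow> 'a set set" where
  "principal_ideals F A = {x <#\<^bsub>F\<^esub> A | x. x \<in> carrier F - {\<zero>\<^bsub>F\<^esub>}}"

definition picard_group :: "('a, 'm) ring_scheme \<Rightarrow> 'a set \<Rightarrow> 'a set set monoid" where
  "picard_group F A = invertible_ideals F A Mod principal_ideals F A"

definition torsion_group :: "('a, 'm) monoid_scheme \<Rightarrow> bool" where
  "torsion_group G \<longleftrightarrow> (\<forall>x\<in>carrier G. \<exists>n::nat. 0 < n \<and> x [^]\<^bsub>G\<^esub> n = \<one>\<^bsub>G\<^esub>)"

end

theory Submission
  imports Defs "HOL-Algebra.Ring_Divisibility"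
begin

text \<open>An \<open>A\<close>-morphism \<open>\<phi>\<close> from \<open>Z\<close> to the projective line either maps into the locus where \<open>T\<^sub>1\<close> does
  not vanish, or is determined by the pullback \<open>u\<close> of \<open>T\<^sub>1 / T\<^sub>0\<close>, and then \<open>f / T\<^sub>0\<^sup>n\<close> pulls back to
  \<open>f(1, u)\<close>. If \<open>A\<close> is a Pruefer domain with quotient field \<open>F\<close>, the fractional ideal \<open>(1, u)\<close> is
  invertible, so \<open>(1, u)\<^sup>n = x A\<close> for some \<open>n > 0\<close> if the Picard group is torsion. Writing
  \<open>x = f(1, u)\<close> with \<open>f\<close> homogeneous of degree \<open>n\<close>, all \<open>u\<^sup>i / x\<close> with \<open>i \<le> n\<close> lie in \<open>A\<close>, and this
  keeps \<open>f\<close> out of every prime \<open>\<phi>(V)\<close>.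

  Conversely, every \<open>u\<close> in \<open>F\<close> defines a morphism that sends \<open>V\<close> to the reduction of the point \<open>(1 : u)\<close>
  modulo the maximal ideal of \<open>V\<close>. If \<open>f\<close> of degree \<open>d > 0\<close> vanishes nowhere on its image and
  \<open>x = f(1, u)\<close>, then \<open>u\<^sup>i / x\<close> lies in \<open>A\<close> for all \<open>i \<le> d\<close>, and \<open>x\<close> is an \<open>A\<close>-linear combination of these
  powers \<open>u\<^sup>i\<close>. For a prime \<open>P\<close> of \<open>A\<close>, some \<open>u\<^sup>i / x\<close> is therefore outside \<open>P\<close>, and dividing it into a
  neighbour shows that \<open>u\<close> or its inverse is in \<open>A\<^sub>P\<close>. For an invertible ideal \<open>I\<close> with generators
  \<open>g\<^sub>1, \<dots>, g\<^sub>k\<close>, using this successively with \<open>u\<close> a quotient of \<open>g\<^sub>j\<^sup>m\<close> by an element of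
  \<open>I\<^sup>m\<close> yields \<open>m > 0\<close> and \<open>x\<close> in \<open>I\<^sup>m\<close> with \<open>g\<^sub>j\<^sup>m / x\<close> in \<open>A\<close> for all \<open>j\<close>. Since \<open>A\<close> is an intersection of
  valuation rings, this forces \<open>I\<^sup>m = x A\<close>.\<close>

section \<open>Local rings and stalks\<close>

text \<open>Sections over a nonempty open subset of \<open>Z\<close> are elements of
  \<open>F\<close>, and the point \<open>F\<close> lies in every such subset. So a morphism can be
  read off at this generic point, and pullbacks from different charts can be compared inside one
  field.

  Why \<open>x = f(1, u)\<close> controls every \<open>u^i / x\<close>: over each \<open>V\<close>
  the coordinates \<open>1\<close> and \<open>u\<close> can be scaled so that both lie in
  \<open>V\<close> and one of them is \<open>1\<close>. The scaled value of \<open>f\<close> is a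
  unit of \<open>V\<close> exactly when \<open>f\<close> does not vanish at the image of
  \<open>V\<close>. So over every \<open>V\<close>, and then over their intersection
  \<open>A\<close>, each \<open>u^i\<close> with \<open>i \<le> d\<close> is a multiple of
  \<open>x\<close>. Since \<open>d > 0\<close>, every exponent in \<open>0..d\<close> has a
  neighbour there, and the quotient of neighbours is \<open>u\<close> or its inverse.

  Why the successive construction stays inside powers of \<open>I\<close>: with \<open>x\<close> in
  \<open>I^m\<close> serving the generators treated so far and a new generator \<open>g\<close>, put
  \<open>t = g^m / x\<close>. The element \<open>y\<close> found for \<open>t\<close> is a form of
  degree \<open>d\<close> in \<open>(1, t)\<close>, so \<open>x^d y\<close> is the same form in
  \<open>(x, g^m)\<close> and lies in \<open>I^(m d)\<close>.\<close>

lemma (in cring) idealI_cring: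
  assumes "I \<subseteq> carrier R" "\<zero> \<in> I" "\<And>x y. x \<in> I \<Longrightarrow> y \<in> I \<Longrightarrow> x \<oplus> y \<in> I"
    "\<And>a x. a \<in> carrier R \<Longrightarrow> x \<in> I \<Longrightarrow> a \<otimes> x \<in> I"
  shows "ideal I R"
proof (rule idealI)
  show "subgroup I (add_monoid R)"
  proof (rule group.subgroupI)
    show "group (add_monoid R)" by (rule a_group)
    show "I \<subseteq> carrier (add_monoid R)" using assms(1) by simp
    show "I \<noteq> {}" using assms(2) by blast
    fix x assume x: "x \<in> I"
    then have "x \<in> carrier R" using assms(1) by blast
    \<comment> \<open>Closure under negation is multiplication by
      \<open>\<ominus> \<one>\<close>.\<close>
    moreover have "(\<ominus> \<one>) \<otimes> x \<in> I" by (rule assms(4)[OF _ x]) simp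
    ultimately have "\<ominus> x \<in> I" by (simp add: l_minus)
    then show "inv\<^bsub>add_monoid R\<^esub> x \<in> I" by (simp add: a_inv_def)
    show "x \<otimes>\<^bsub>add_monoid R\<^esub> y \<in> I" if "y \<in> I" for y
      using assms(3)[OF x that] by simp
  qed
  fix a x assume a: "a \<in> I" and x: "x \<in> carrier R"
  show "x \<otimes> a \<in> I" by (rule assms(4)[OF x a])
  moreover have "a \<in> carrier R" using assms(1) a by blast
  ultimately show "a \<otimes> x \<in> I" using m_comm[OF _ x] by metis
qed (rule ring_axioms)

text \<open>\<open>max_ideal\<close> is a definite description over all maximal ideals. A proper
  ideal whose complement consists of units determines it, and this condition is easy to check and to
  transport.\<close>

definition local_ring_with :: "('a, 'm) ring_scheme \<Rightarrow> 'a set \<Rightarrow> bool" where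
  "local_ring_with R M \<longleftrightarrow> cring R \<and> ideal M R \<and> M \<noteq> carrier R \<and>
    (\<forall>x\<in>carrier R - M. \<exists>y\<in>carrier R. x \<otimes>\<^bsub>R\<^esub> y = \<one>\<^bsub>R\<^esub>)"

text \<open>A proper ideal contains no unit, hence lies inside \<open>M\<close>; so no other ideal
  can be maximal.\<close>

lemma max_ideal_local_ring_with:
  assumes "local_ring_with R M"
  shows "max_ideal R = M"
proof -
  interpret cring R using assms by (simp add: local_ring_with_def)
  interpret M: ideal M R using assms by (simp add: local_ring_with_def)
  have sub: "N \<subseteq> M" if N: "ideal N R" "N \<noteq> carrier R" for N
  proof
    interpret N: ideal N R by fact
    fix x assume x: "x \<in> N"
    show "x \<in> M"
    proof (rule ccontr)
      assume "x \<notin> M"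
      then obtain y where "y \<in> carrier R" "x \<otimes>\<^bsub>R\<^esub> y = \<one>\<^bsub>R\<^esub>"
        using assms x N.Icarr unfolding local_ring_with_def by blast
      then have "\<one>\<^bsub>R\<^esub> \<in> N" using N.I_r_closed[OF x] by metis
      then show False using N.one_imp_carrier N(2) by blast
    qed
  qed
  have max: "maximalideal M R"
  proof (rule maximalidealI)
    show "ideal M R" ..
    show "carrier R \<noteq> M" using assms by (auto simp: local_ring_with_def)
    show "J = M \<or> J = carrier R" if "ideal J R" "M \<subseteq> J" "J \<subseteq> carrier R" for J
      using sub that by blast
  qed
  show ?thesis unfolding max_ideal_def
  proof (rule the_equality[where P="\<lambda>M. maximalideal M R", OF max])
    fix N assume N: "maximalideal N R"
    interpret N: maximalideal N R by fact
    have "N \<subseteq> M" using sub N.I_notcarr N.ideal_axioms by blast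
    then show "N = M"
      using N.I_maximal[OF M.ideal_axioms] M.a_subset assms by (auto simp: local_ring_with_def)
  qed
qed

text \<open>Meant for stalks, which are not known to be rings beforehand: the ring axioms are
  themselves transported along \<open>h\<close>. As \<open>ring_iso\<close> does not mention the
  zero, its image is a separate hypothesis.\<close>

lemma local_ring_with_iso:
  assumes R: "local_ring_with R M" and h: "h \<in> ring_iso R S" and zero: "h \<zero>\<^bsub>R\<^esub> = \<zero>\<^bsub>S\<^esub>"
  shows "local_ring_with S (h ` M)"
proof -
  interpret R: cring R using R by (simp add: local_ring_with_def)
  interpret M: ideal M R using R by (simp add: local_ring_with_def)
  have "cring (S \<lparr>zero := h \<zero>\<^bsub>R\<^esub>\<rparr>)" using R.ring_iso_imp_img_cring[OF h] .
  then interpret S: cring S by (simp add: zero)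
  note hD = ring_iso_memE[OF h]
  interpret h: ring_hom_ring R S h
    by (rule ring_hom_ringI2) (use h in \<open>auto simp: ring_iso_def R.ring_axioms S.ring_axioms\<close>)
  have inj: "inj_on h (carrier R)" and surj: "h ` carrier R = carrier S"
    using hD(5) by (auto simp: bij_betw_def)
  have "ideal (h ` M) S"
  proof (rule S.idealI_cring)
    show "h ` M \<subseteq> carrier S" using M.a_subset surj by blast
    show "\<zero>\<^bsub>S\<^esub> \<in> h ` M" using zero M.zero_closed by (metis imageI)
    fix x a assume "a \<in> h ` M"
    then obtain b where b: "b \<in> M" "a = h b" by blast
    show "x \<oplus>\<^bsub>S\<^esub> a \<in> h ` M" if x: "x \<in> h ` M"
    proof -
      obtain c where c: "c \<in> M" "x = h c" using x by blast
      have "x \<oplus>\<^bsub>S\<^esub> a = h (c \<oplus>\<^bsub>R\<^esub> b)" using b c M.Icarr by simp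
      then show ?thesis using M.a_closed b c by blast
    qed
    show "x \<otimes>\<^bsub>S\<^esub> a \<in> h ` M" if x: "x \<in> carrier S"
    proof -
      obtain y where y: "y \<in> carrier R" "x = h y" using x surj by blast
      have "x \<otimes>\<^bsub>S\<^esub> a = h (y \<otimes>\<^bsub>R\<^esub> b)" using b y M.Icarr by simp
      then show ?thesis using M.I_l_closed b y by blast
    qed
  qed
  moreover have "h ` M \<noteq> carrier S"
  proof
    assume "h ` M = carrier S"
    then have "h ` M = h ` carrier R" by (simp add: surj)
    then have "M = carrier R" using inj_on_image_eq_iff[OF inj] M.a_subset by blast
    then show False using R by (simp add: local_ring_with_def)
  qed
  moreover have "\<exists>y\<in>carrier S. x \<otimes>\<^bsub>S\<^esub> y = \<one>\<^bsub>S\<^esub>" if x: "x \<in> carrier S - h ` M" for x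
  proof -
    obtain z where z: "z \<in> carrier R" "x = h z" using x surj by blast
    then obtain w where w: "w \<in> carrier R" "z \<otimes>\<^bsub>R\<^esub> w = \<one>\<^bsub>R\<^esub>"
      using R x unfolding local_ring_with_def by blast
    then have "x \<otimes>\<^bsub>S\<^esub> h w = \<one>\<^bsub>S\<^esub>" using z h.hom_mult[of z w] by simp
    then show ?thesis using w h.hom_closed by blast
  qed
  ultimately show ?thesis using S.is_cring by (auto simp: local_ring_with_def)
qed

text \<open>\<open>L\<close> represents the stalk of \<open>X\<close> at \<open>x\<close>, and \<open>e U s\<close> is the element given by the germ of \<open>s\<close>.\<close>
locale stalk_values =
  fixes X :: "('p, 'r) ringed_space" and x :: 'p
    and L :: "('l, 'm) ring_scheme" and e :: "'p set \<Rightarrow> 'r \<Rightarrow> 'l" and M :: "'l set"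
  assumes L: "local_ring_with L M"
    and point: "x \<in> topspace (space_top X)"
    and restr_closed: "\<And>U W s. \<lbrakk>openin (space_top X) U; openin (space_top X) W; x \<in> W; W \<subseteq> U;
      s \<in> carrier (sections X U)\<rbrakk> \<Longrightarrow> restr X U W s \<in> carrier (sections X W) \<and>
        e W (restr X U W s) = e U s"
    and value_eq: "\<And>U V s t. \<lbrakk>openin (space_top X) U; openin (space_top X) V; x \<in> U; x \<in> V;
      s \<in> carrier (sections X U); t \<in> carrier (sections X V); e U s = e V t\<rbrakk> \<Longrightarrow>
        \<exists>W. openin (space_top X) W \<and> x \<in> W \<and> W \<subseteq> U \<inter> V \<and> restr X U W s = restr X V W t"
    and value_hom: "\<And>U. openin (space_top X) U \<Longrightarrow> x \<in> U \<Longrightarrow> e U \<in> ring_hom (sections X U) L"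
    and value_zero: "\<And>U. openin (space_top X) U \<Longrightarrow> x \<in> U \<Longrightarrow>
      \<zero>\<^bsub>sections X U\<^esub> \<in> carrier (sections X U) \<and> e U \<zero>\<^bsub>sections X U\<^esub> = \<zero>\<^bsub>L\<^esub>"
    and one_closed: "\<And>U. openin (space_top X) U \<Longrightarrow> x \<in> U \<Longrightarrow>
      \<one>\<^bsub>sections X U\<^esub> \<in> carrier (sections X U)"
    and closed: "\<And>U s t. \<lbrakk>openin (space_top X) U; x \<in> U; s \<in> carrier (sections X U);
      t \<in> carrier (sections X U)\<rbrakk> \<Longrightarrow> s \<otimes>\<^bsub>sections X U\<^esub> t \<in> carrier (sections X U) \<and>
        s \<oplus>\<^bsub>sections X U\<^esub> t \<in> carrier (sections X U)"
    and surj: "\<And>l. l \<in> carrier L \<Longrightarrow>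
      \<exists>U s. openin (space_top X) U \<and> x \<in> U \<and> s \<in> carrier (sections X U) \<and> e U s = l"
begin

definition germs_with :: "'l \<Rightarrow> ('p set \<times> 'r) set" where
  "germs_with l =
    {(V, t). openin (space_top X) V \<and> x \<in> V \<and> t \<in> carrier (sections X V) \<and> e V t = l}"

text \<open>A germ is a whole fibre of the value map: equal values force agreement on a smaller
  neighbourhood by \<open>value_eq\<close>, and restriction never changes a value.\<close>

lemma germ_eq:
  assumes "openin (space_top X) U" "x \<in> U" "s \<in> carrier (sections X U)"
  shows "germ X x U s = germs_with (e U s)"
proof -
  have "(\<exists>W. openin (space_top X) W \<and> x \<in> W \<and> W \<subseteq> U \<inter> V \<and> restr X U W s = restr X V W t)
      \<longleftrightarrow> e V t = e U s"
    if "openin (space_top X) V" "x \<in> V" "t \<in> carrier (sections X V)" for V t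
    using value_eq[OF assms(1) that(1) assms(2) that(2) assms(3) that(3)]
      restr_closed[OF assms(1) _ _ _ assms(3)] restr_closed[OF that(1) _ _ _ that(3)]
    by (metis le_inf_iff)
  then show ?thesis unfolding germ_def germs_with_def by blast
qed

lemma germs_with_nonempty: "l \<in> carrier L \<Longrightarrow> germs_with l \<noteq> {}"
  using surj unfolding germs_with_def by blast

lemma germs_with_in_stalk:
  assumes "l \<in> carrier L"
  shows "germs_with l \<in> carrier (stalk X x)"
proof -
  obtain U s where "openin (space_top X) U" "x \<in> U" "s \<in> carrier (sections X U)" "e U s = l"
    using surj[OF assms] by blast
  moreover from this have "germs_with l = germ X x U s" using germ_eq by blast
  ultimately show ?thesis unfolding stalk_def by auto
qed

lemma stalk_carrier: "carrier (stalk X x) = germs_with ` carrier L"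
proof -
  have "germ X x U s \<in> germs_with ` carrier L"
    if "openin (space_top X) U" "x \<in> U" "s \<in> carrier (sections X U)" for U s
    using germ_eq[OF that] ring_hom_closed[OF value_hom[OF that(1,2)] that(3)] by blast
  then show ?thesis using germs_with_in_stalk unfolding stalk_def by auto
qed

lemma germs_with_inj: "inj_on germs_with (carrier L)"
proof
  fix l m assume "l \<in> carrier L" "m \<in> carrier L" "germs_with l = germs_with m"
  then show "l = m" using germs_with_nonempty[of l] unfolding germs_with_def by fastforce
qed

text \<open>One argument for sum and product of the stalk. All terms of the union are the same
  class, so a union over nonempty index sets collapses to it.\<close>

lemma stalk_op:
  fixes op :: "'p set \<Rightarrow> 'r \<Rightarrow> 'r \<Rightarrow> 'r"
  assumes lm: "l \<in> carrier L" "m \<in> carrier L"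
    and op: "\<And>U s t. \<lbrakk>openin (space_top X) U; x \<in> U; s \<in> carrier (sections X U);
      t \<in> carrier (sections X U)\<rbrakk> \<Longrightarrow> op U s t \<in> carrier (sections X U) \<and>
        e U (op U s t) = op' (e U s) (e U t)"
  shows "(\<Union>(U, s)\<in>germs_with l. \<Union>(V, t)\<in>germs_with m.
      germ X x (U \<inter> V) (op (U \<inter> V) (restr X U (U \<inter> V) s) (restr X V (U \<inter> V) t)))
    = germs_with (op' l m)"
proof -
  have "germ X x (U \<inter> V) (op (U \<inter> V) (restr X U (U \<inter> V) s) (restr X V (U \<inter> V) t))
      = germs_with (op' l m)" if "(U, s) \<in> germs_with l" "(V, t) \<in> germs_with m" for U s V t
  proof -
    have o: "openin (space_top X) (U \<inter> V)" "x \<in> U \<inter> V"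
      using that by (auto simp: germs_with_def)
    have s: "restr X U (U \<inter> V) s \<in> carrier (sections X (U \<inter> V))"
        "e (U \<inter> V) (restr X U (U \<inter> V) s) = l"
      using that restr_closed[OF _ o, of U s] by (auto simp: germs_with_def)
    have t: "restr X V (U \<inter> V) t \<in> carrier (sections X (U \<inter> V))"
        "e (U \<inter> V) (restr X V (U \<inter> V) t) = m"
      using that restr_closed[OF _ o, of V t] by (auto simp: germs_with_def)
    show ?thesis using op[OF o s(1) t(1)] germ_eq[OF o] s(2) t(2) by metis
  qed
  then have "(\<Union>(U, s)\<in>germs_with l. \<Union>(V, t)\<in>germs_with m.
      germ X x (U \<inter> V) (op (U \<inter> V) (restr X U (U \<inter> V) s) (restr X V (U \<inter> V) t)))
    = (\<Union>_\<in>germs_with l. \<Union>_\<in>germs_with m. germs_with (op' l m))" by force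
  then show ?thesis using lm[THEN germs_with_nonempty] by auto
qed

lemma germs_with_iso: "germs_with \<in> ring_iso L (stalk X x)"
proof (rule ring_iso_memI)
  have o: "openin (space_top X) (topspace (space_top X))" by simp
  show "germs_with \<one>\<^bsub>L\<^esub> = \<one>\<^bsub>stalk X x\<^esub>"
    using germ_eq[OF o point one_closed[OF o point]] ring_hom_one[OF value_hom[OF o point]]
    unfolding stalk_def by simp
  show "bij_betw germs_with (carrier L) (carrier (stalk X x))"
    using germs_with_inj stalk_carrier by (simp add: bij_betw_def)
  fix l m assume lm: "l \<in> carrier L" "m \<in> carrier L"
  show "germs_with (l \<otimes>\<^bsub>L\<^esub> m) = germs_with l \<otimes>\<^bsub>stalk X x\<^esub> germs_with m"
    using stalk_op[OF lm, of "\<lambda>U. (\<otimes>\<^bsub>sections X U\<^esub>)" "(\<otimes>\<^bsub>L\<^esub>)"] closed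
      ring_hom_mult[OF value_hom] unfolding stalk_def by simp
  show "germs_with (l \<oplus>\<^bsub>L\<^esub> m) = germs_with l \<oplus>\<^bsub>stalk X x\<^esub> germs_with m"
    using stalk_op[OF lm, of "\<lambda>U. (\<oplus>\<^bsub>sections X U\<^esub>)" "(\<oplus>\<^bsub>L\<^esub>)"] closed
      ring_hom_add[OF value_hom] unfolding stalk_def by simp
qed (rule germs_with_in_stalk)

lemma germs_with_zero: "germs_with \<zero>\<^bsub>L\<^esub> = \<zero>\<^bsub>stalk X x\<^esub>"
proof -
  have o: "openin (space_top X) (topspace (space_top X))" by simp
  show ?thesis using germ_eq[OF o point] value_zero[OF o point] unfolding stalk_def by auto
qed

lemma max_ideal_stalk: "max_ideal (stalk X x) = germs_with ` M"
  using max_ideal_local_ring_with[OF local_ring_with_iso[OF L germs_with_iso germs_with_zero]] .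

lemma max_ideal_subset: "M \<subseteq> carrier L"
  using L by (meson additive_subgroup.a_subset ideal.axioms(1) local_ring_with_def)

end

text \<open>After both stalks are identified with their value rings, the map on stalks becomes
  \<open>h\<close>, so locality only has to be checked for \<open>h\<close>.\<close>

lemma local_hom_stalk_mapI:
  assumes X: "stalk_values X x L e M" and Y: "stalk_values Y (pt f x) K e' N"
    and op: "\<And>V. openin (space_top Y) V \<Longrightarrow> openin (space_top X) (preim X f V)"
    and pull: "\<And>V t. openin (space_top Y) V \<Longrightarrow> t \<in> carrier (sections Y V) \<Longrightarrow>
      pull f V t \<in> carrier (sections X (preim X f V))"
    and h: "h \<in> ring_hom K L" "h ` N \<subseteq> M"
    and comp: "\<And>V t. openin (space_top Y) V \<Longrightarrow> pt f x \<in> V \<Longrightarrow> t \<in> carrier (sections Y V) \<Longrightarrow>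
      e (preim X f V) (pull f V t) = h (e' V t)"
  shows "local_hom (stalk Y (pt f x)) (stalk X x) (stalk_map X f x)"
proof -
  interpret X: stalk_values X x L e M by fact
  interpret Y: stalk_values Y "pt f x" K e' N by fact
  interpret K: cring K using Y.L by (simp add: local_ring_with_def)
  have map: "stalk_map X f x (Y.germs_with k) = X.germs_with (h k)" if k: "k \<in> carrier K" for k
  proof -
    have "germ X x (preim X f V) (pull f V t) = X.germs_with (h k)"
      if "(V, t) \<in> Y.germs_with k" for V t
    proof -
      have V: "openin (space_top Y) V" "pt f x \<in> V" "t \<in> carrier (sections Y V)" "e' V t = k"
        using that by (auto simp: Y.germs_with_def)
      have "x \<in> preim X f V" using V(2) X.point by (simp add: preim_def)
      then show ?thesis using X.germ_eq[OF op[OF V(1)] _ pull[OF V(1,3)]] comp[OF V(1-3)] V(4) by simp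
    qed
    then have "stalk_map X f x (Y.germs_with k) = (\<Union>_\<in>Y.germs_with k. X.germs_with (h k))"
      unfolding stalk_map_def by force
    then show ?thesis using Y.germs_with_nonempty[OF k] by auto
  qed
  note Xi = ring_iso_memE[OF X.germs_with_iso] and Yi = ring_iso_memE[OF Y.germs_with_iso]
  have "stalk_map X f x \<in> ring_hom (stalk Y (pt f x)) (stalk X x)"
  proof (rule ring_hom_memI)
    fix a assume "a \<in> carrier (stalk Y (pt f x))"
    then obtain k where k: "k \<in> carrier K" "a = Y.germs_with k" using Y.stalk_carrier by blast
    show "stalk_map X f x a \<in> carrier (stalk X x)"
      using map[OF k(1)] k Xi(1) ring_hom_closed[OF h(1)] by simp
  next
    fix a b assume ab: "a \<in> carrier (stalk Y (pt f x))" "b \<in> carrier (stalk Y (pt f x))"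
    obtain k where k: "k \<in> carrier K" "a = Y.germs_with k" using ab Y.stalk_carrier by blast
    obtain l where l: "l \<in> carrier K" "b = Y.germs_with l" using ab Y.stalk_carrier by blast
    show "stalk_map X f x (a \<otimes>\<^bsub>stalk Y (pt f x)\<^esub> b) = stalk_map X f x a \<otimes>\<^bsub>stalk X x\<^esub> stalk_map X f x b"
      using k l Yi(2)[OF k(1) l(1), symmetric] map ring_hom_mult[OF h(1) k(1) l(1)]
        Xi(2) ring_hom_closed[OF h(1)] by simp
    show "stalk_map X f x (a \<oplus>\<^bsub>stalk Y (pt f x)\<^esub> b) = stalk_map X f x a \<oplus>\<^bsub>stalk X x\<^esub> stalk_map X f x b"
      using k l Yi(3)[OF k(1) l(1), symmetric] map ring_hom_add[OF h(1) k(1) l(1)]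
        Xi(3) ring_hom_closed[OF h(1)] by simp
  next
    show "stalk_map X f x \<one>\<^bsub>stalk Y (pt f x)\<^esub> = \<one>\<^bsub>stalk X x\<^esub>"
      using map[OF K.one_closed] Yi(4) Xi(4) ring_hom_one[OF h(1)] by simp
  qed
  moreover have "stalk_map X f x ` max_ideal (stalk Y (pt f x)) \<subseteq> max_ideal (stalk X x)"
    unfolding X.max_ideal_stalk Y.max_ideal_stalk
    using map Y.max_ideal_subset h(2) by (auto simp: subset_iff)
  ultimately show ?thesis by (simp add: local_hom_def)
qed

text \<open>The opposite use: for a map known to be local on stalks, this extracts what locality
  says about the values of a single section.\<close>

lemma local_hom_stalk_mapD:
  assumes X: "stalk_values X x L e M" and Y: "stalk_values Y (pt f x) K e' N"
    and loc: "local_hom (stalk Y (pt f x)) (stalk X x) (stalk_map X f x)"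
    and V: "openin (space_top Y) V" "pt f x \<in> V" "t \<in> carrier (sections Y V)" "e' V t \<in> N"
    and op: "openin (space_top X) (preim X f V)"
    and pull: "pull f V t \<in> carrier (sections X (preim X f V))"
  shows "e (preim X f V) (pull f V t) \<in> M"
proof -
  interpret X: stalk_values X x L e M by fact
  interpret Y: stalk_values Y "pt f x" K e' N by fact
  have x: "x \<in> preim X f V" using V(2) X.point by (simp add: preim_def)
  have "Y.germs_with (e' V t) \<in> max_ideal (stalk Y (pt f x))" using V(4) Y.max_ideal_stalk by blast
  then have "stalk_map X f x (Y.germs_with (e' V t)) \<in> X.germs_with ` M"
    using loc X.max_ideal_stalk unfolding local_hom_def by blast
  then obtain m where m: "m \<in> M" "stalk_map X f x (Y.germs_with (e' V t)) = X.germs_with m" by blast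
  \<comment> \<open>\<open>stalk_map\<close> is a union over representatives, and
    \<open>(V, t)\<close> contributes its germ. An inclusion of a nonempty fibre in another fibre
    already forces equal values.\<close>
  have "(V, t) \<in> Y.germs_with (e' V t)" using V by (simp add: Y.germs_with_def)
  then have "X.germs_with (e (preim X f V) (pull f V t)) \<subseteq> X.germs_with m"
    unfolding m(2)[symmetric] stalk_map_def X.germ_eq[OF op x pull, symmetric] by fastforce
  moreover have "(preim X f V, pull f V t) \<in> X.germs_with (e (preim X f V) (pull f V t))"
    using op x pull by (simp add: X.germs_with_def)
  ultimately have "e (preim X f V) (pull f V t) = m" by (auto simp: X.germs_with_def)
  then show ?thesis using m(1) by simp
qed

section \<open>Homogeneous localizations and sections of Proj\<close>

locale fraction_set = "domain" S for S (structure) +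
  fixes T
  assumes T_subset: "T \<subseteq> carrier S" and T_one: "\<one> \<in> T" and T_zero: "\<zero> \<notin> T"
    and T_mult: "\<And>s t. s \<in> T \<Longrightarrow> t \<in> T \<Longrightarrow> s \<otimes> t \<in> T"
begin

lemma T_nonzero: "s \<in> T \<Longrightarrow> s \<in> carrier S \<and> s \<noteq> \<zero>"
  using T_subset T_zero by blast

text \<open>In a domain the auxiliary factor \<open>u\<close> of the definition cancels, leaving
  cross multiplication.\<close>

lemma mem_fraction:
  assumes "a \<in> carrier S" "s \<in> T"
  shows "(b, t) \<in> fraction S T a s \<longleftrightarrow> b \<in> carrier S \<and> t \<in> T \<and> t \<otimes> a = s \<otimes> b"
proof -
  have "(\<exists>u\<in>T. u \<otimes> (t \<otimes> a) = u \<otimes> (s \<otimes> b)) \<longleftrightarrow> t \<otimes> a = s \<otimes> b"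
    if "b \<in> carrier S" "t \<in> T"
    using that assms T_one T_nonzero m_lcancel by (metis m_closed)
  then show ?thesis unfolding fraction_def by blast
qed

lemma fraction_refl: "a \<in> carrier S \<Longrightarrow> s \<in> T \<Longrightarrow> (a, s) \<in> fraction S T a s"
  by (simp add: mem_fraction)

lemma fraction_eq_iff:
  assumes a: "a \<in> carrier S" "s \<in> T" and b: "b \<in> carrier S" "t \<in> T"
  shows "fraction S T a s = fraction S T b t \<longleftrightarrow> t \<otimes> a = s \<otimes> b"
proof
  assume "fraction S T a s = fraction S T b t"
  then show "t \<otimes> a = s \<otimes> b" using fraction_refl[OF b] mem_fraction[OF a] by blast
next
  assume eq: "t \<otimes> a = s \<otimes> b"
  have "r \<otimes> a = s \<otimes> c \<longleftrightarrow> r \<otimes> b = t \<otimes> c" if c: "c \<in> carrier S" "r \<in> T" for c r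
  proof -
    have C: "s \<in> carrier S" "t \<in> carrier S" "r \<in> carrier S" "s \<noteq> \<zero>" "t \<noteq> \<zero>"
      using a b c T_nonzero by auto
    have "r \<otimes> a = s \<otimes> c \<longleftrightarrow> t \<otimes> (r \<otimes> a) = t \<otimes> (s \<otimes> c)"
      using C a b c m_lcancel by simp
    also have "t \<otimes> (r \<otimes> a) = s \<otimes> (r \<otimes> b)"
      using C a b eq by (metis m_lcomm)
    also have "t \<otimes> (s \<otimes> c) = s \<otimes> (t \<otimes> c)"
      using C c by (simp add: m_lcomm)
    also have "s \<otimes> (r \<otimes> b) = s \<otimes> (t \<otimes> c) \<longleftrightarrow> r \<otimes> b = t \<otimes> c"
      using C a b c m_lcancel by simp
    finally show ?thesis .
  qed
  then show "fraction S T a s = fraction S T b t"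
    using mem_fraction[OF a] mem_fraction[OF b] by auto
qed

text \<open>The operations on classes are unions over all representatives. The work is to show that
  every choice gives the same class; then the nonempty unions collapse.\<close>

lemma localization_op:
  assumes "a \<in> carrier S" "s \<in> T" "b \<in> carrier S" "t \<in> T"
  shows "fraction S T a s \<otimes>\<^bsub>localization S T\<^esub> fraction S T b t = fraction S T (a \<otimes> b) (s \<otimes> t)"
    and "fraction S T a s \<oplus>\<^bsub>localization S T\<^esub> fraction S T b t =
      fraction S T (a \<otimes> t \<oplus> b \<otimes> s) (s \<otimes> t)"
proof -
  note C = assms T_nonzero[OF assms(2)] T_nonzero[OF assms(4)]
  have "fraction S T (a' \<otimes> b') (s' \<otimes> t') = fraction S T (a \<otimes> b) (s \<otimes> t) \<and>
      fraction S T (a' \<otimes> t' \<oplus> b' \<otimes> s') (s' \<otimes> t') = fraction S T (a \<otimes> t \<oplus> b \<otimes> s) (s \<otimes> t)"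
    if "(a', s') \<in> fraction S T a s" "(b', t') \<in> fraction S T b t" for a' s' b' t'
  proof -
    have A: "a' \<in> carrier S" "s' \<in> T" "s' \<otimes> a = s \<otimes> a'"
      using that mem_fraction[OF C(1,2)] by auto
    have B: "b' \<in> carrier S" "t' \<in> T" "t' \<otimes> b = t \<otimes> b'"
      using that mem_fraction[OF C(3,4)] by auto
    note D = A B T_nonzero[OF A(2)] T_nonzero[OF B(2)]
    have ab: "(s \<otimes> t) \<otimes> (a' \<otimes> b') = (s' \<otimes> t') \<otimes> (a \<otimes> b)"
    proof -
      have "(s \<otimes> t) \<otimes> (a' \<otimes> b') = (s \<otimes> a') \<otimes> (t \<otimes> b')" using C D by (simp add: m_ac)
      also have "\<dots> = (s' \<otimes> a) \<otimes> (t' \<otimes> b)" by (simp only: A(3) B(3))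
      finally show ?thesis using C D(1,2,4,5,7,8) by (simp add: m_ac)
    qed
    have "(s \<otimes> t) \<otimes> (a' \<otimes> t' \<oplus> b' \<otimes> s') = (s \<otimes> a') \<otimes> (t \<otimes> t') \<oplus> (t \<otimes> b') \<otimes> (s \<otimes> s')"
      using C D(1,2,4,5,7,8) by (simp add: r_distr m_ac)
    also have "\<dots> = (s' \<otimes> a) \<otimes> (t \<otimes> t') \<oplus> (t' \<otimes> b) \<otimes> (s \<otimes> s')" by (simp only: A(3) B(3))
    also have "\<dots> = (s' \<otimes> t') \<otimes> (a \<otimes> t \<oplus> b \<otimes> s)"
      using C D(1,2,4,5,7,8) by (simp add: r_distr m_ac)
    finally show ?thesis
      using ab C D(1,2,4,5,7,8) T_mult by (simp add: fraction_eq_iff)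
  qed
  note all = this
  have ne: "(a, s) \<in> fraction S T a s" "(b, t) \<in> fraction S T b t"
    using C fraction_refl by auto
  have "(\<Union>(a', s')\<in>fraction S T a s. \<Union>(b', t')\<in>fraction S T b t.
      fraction S T (a' \<otimes> b') (s' \<otimes> t')) =
      (\<Union>_\<in>fraction S T a s. \<Union>_\<in>fraction S T b t. fraction S T (a \<otimes> b) (s \<otimes> t))"
    using all by force
  then show "fraction S T a s \<otimes>\<^bsub>localization S T\<^esub> fraction S T b t = fraction S T (a \<otimes> b) (s \<otimes> t)"
    unfolding localization_def using ne by auto
  have "(\<Union>(a', s')\<in>fraction S T a s. \<Union>(b', t')\<in>fraction S T b t.
      fraction S T (a' \<otimes> t' \<oplus> b' \<otimes> s') (s' \<otimes> t')) =
      (\<Union>_\<in>fraction S T a s. \<Union>_\<in>fraction S T b t. fraction S T (a \<otimes> t \<oplus> b \<otimes> s) (s \<otimes> t))"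
    using all by force
  then show "fraction S T a s \<oplus>\<^bsub>localization S T\<^esub> fraction S T b t =
      fraction S T (a \<otimes> t \<oplus> b \<otimes> s) (s \<otimes> t)"
    unfolding localization_def using ne by auto
qed

end

locale graded_domain = "domain" S for S (structure) +
  fixes gr :: "nat \<Rightarrow> 'a set"
  assumes gr_carrier: "\<And>d a. a \<in> gr d \<Longrightarrow> a \<in> carrier S"
    and gr_zero: "\<And>d. \<zero> \<in> gr d"
    and gr_add: "\<And>d a b. a \<in> gr d \<Longrightarrow> b \<in> gr d \<Longrightarrow> a \<oplus> b \<in> gr d"
    and gr_neg: "\<And>d a. a \<in> gr d \<Longrightarrow> \<ominus> a \<in> gr d"
    and gr_mult: "\<And>d e a b. a \<in> gr d \<Longrightarrow> b \<in> gr e \<Longrightarrow> a \<otimes> b \<in> gr (d + e)"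
    and gr_one: "\<one> \<in> gr 0"
begin

abbreviation "ratio P \<equiv> fraction S (homogeneous_outside gr P)"
abbreviation "loc P \<equiv> homogeneous_local_ring_at S gr P"

definition hfrac :: "'a set \<Rightarrow> nat \<Rightarrow> 'a \<Rightarrow> 'a \<Rightarrow> bool" where
  "hfrac P d a f \<longleftrightarrow> a \<in> gr d \<and> f \<in> gr d \<and> f \<notin> P"

definition loc_max :: "'a set \<Rightarrow> ('a \<times> 'a) set set" where
  "loc_max P = {ratio P a f | d a f. hfrac P d a f \<and> a \<in> P}"

lemma proj_point_prime: "P \<in> proj_points S gr \<Longrightarrow> primeideal P S"
  by (simp add: proj_points_def)

lemma fraction_set_prime:
  assumes "primeideal P S"
  shows "fraction_set S (homogeneous_outside gr P)"
proof
  interpret primeideal P S by fact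
  show "homogeneous_outside gr P \<subseteq> carrier S"
    using gr_carrier by (auto simp: homogeneous_outside_def)
  show "\<one> \<in> homogeneous_outside gr P"
    using gr_one I_notcarr one_imp_carrier by (auto simp: homogeneous_outside_def)
  show "\<zero> \<notin> homogeneous_outside gr P"
    using zero_closed by (auto simp: homogeneous_outside_def)
  show "s \<otimes> t \<in> homogeneous_outside gr P"
    if st: "s \<in> homogeneous_outside gr P" "t \<in> homogeneous_outside gr P" for s t
  proof -
    obtain d e where "s \<in> gr d" "t \<in> gr e" "s \<notin> P" "t \<notin> P"
      using st unfolding homogeneous_outside_def by blast
    then show ?thesis
      using gr_mult[of s d t e] gr_carrier I_prime[of s t] by (auto simp: homogeneous_outside_def)
  qed
qed

lemma hfracD:
  "hfrac P d a f \<Longrightarrow> a \<in> carrier S \<and> f \<in> carrier S \<and> f \<in> homogeneous_outside gr P"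
  using gr_carrier by (auto simp: hfrac_def homogeneous_outside_def)

lemma loc_carrier: "carrier (loc P) = {ratio P a f | d a f. hfrac P d a f}"
  by (auto simp: homogeneous_local_ring_at_def hfrac_def)

lemma loc_carrierI: "hfrac P d a f \<Longrightarrow> ratio P a f \<in> carrier (loc P)"
  by (auto simp: loc_carrier)

lemma loc_zero: "\<zero>\<^bsub>loc P\<^esub> = ratio P \<zero> \<one>" and loc_one: "\<one>\<^bsub>loc P\<^esub> = ratio P \<one> \<one>"
  by (simp_all add: homogeneous_local_ring_at_def localization_def)

context
  fixes P assumes P: "primeideal P S"
begin

interpretation P: primeideal P S by (rule P)
interpretation T: fraction_set S "homogeneous_outside gr P" by (rule fraction_set_prime[OF P])

lemma frac_eq_iff:
  assumes "hfrac P d a f" "hfrac P e b g"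
  shows "ratio P a f = ratio P b g \<longleftrightarrow> g \<otimes> a = f \<otimes> b"
  using T.fraction_eq_iff hfracD assms by blast

lemma one_notin: "\<one> \<notin> P"
  using P.one_imp_carrier P.I_notcarr by blast

lemma hfrac_one: "hfrac P 0 \<one> \<one>" and hfrac_zero: "hfrac P 0 \<zero> \<one>"
  using gr_one gr_zero one_notin by (auto simp: hfrac_def)

lemma hfrac_mult:
  assumes "hfrac P d a f" "hfrac P e b g"
  shows "hfrac P (d + e) (a \<otimes> b) (f \<otimes> g)"
  using assms gr_mult gr_carrier P.I_prime[of f g] by (auto simp: hfrac_def)

lemma hfrac_add:
  assumes "hfrac P d a f" "hfrac P e b g"
  shows "hfrac P (d + e) (a \<otimes> g \<oplus> b \<otimes> f) (f \<otimes> g)"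
  using assms gr_mult[of a d g e] gr_mult[of b e f d] gr_mult[of f d g e] gr_carrier P.I_prime[of f g]
  by (auto simp: hfrac_def add.commute intro!: gr_add)

lemma loc_mult:
  assumes "hfrac P d a f" "hfrac P e b g"
  shows "ratio P a f \<otimes>\<^bsub>loc P\<^esub> ratio P b g = ratio P (a \<otimes> b) (f \<otimes> g)"
  using T.localization_op(1) assms[THEN hfracD] by (simp add: homogeneous_local_ring_at_def)

lemma loc_add:
  assumes "hfrac P d a f" "hfrac P e b g"
  shows "ratio P a f \<oplus>\<^bsub>loc P\<^esub> ratio P b g = ratio P (a \<otimes> g \<oplus> b \<otimes> f) (f \<otimes> g)"
  using T.localization_op(2) assms[THEN hfracD] by (simp add: homogeneous_local_ring_at_def)

lemma loc_add_same:
  assumes "hfrac P d a f" "hfrac P d b f"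
  shows "ratio P a f \<oplus>\<^bsub>loc P\<^esub> ratio P b f = ratio P (a \<oplus> b) f"
proof -
  have ab: "hfrac P d (a \<oplus> b) f" using assms gr_add by (simp add: hfrac_def)
  show ?thesis unfolding loc_add[OF assms]
    unfolding frac_eq_iff[OF hfrac_add[OF assms] ab]
    using assms[THEN hfracD] by (simp add: l_distr r_distr m_ac)
qed

lemma loc_elem:
  assumes "x \<in> carrier (loc P)"
  obtains d a f where "hfrac P d a f" "x = ratio P a f"
  using assms by (auto simp: loc_carrier)

lemma cring_loc: "cring (loc P)"
proof (rule cringI)
  show "abelian_group (loc P)"
  proof (rule abelian_groupI)
    fix x y assume xK: "x \<in> carrier (loc P)" and yK: "y \<in> carrier (loc P)"
    obtain d a f where x: "hfrac P d a f" "x = ratio P a f" by (rule loc_elem[OF xK])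
    obtain e b g where y: "hfrac P e b g" "y = ratio P b g" by (rule loc_elem[OF yK])
    note xy = x y
    note C = hfracD[OF xy(1)] hfracD[OF xy(3)]
    show "x \<oplus>\<^bsub>loc P\<^esub> y \<in> carrier (loc P)"
      using loc_carrierI[OF hfrac_add[OF xy(1,3)]] loc_add[OF xy(1,3)] xy by simp
    show "x \<oplus>\<^bsub>loc P\<^esub> y = y \<oplus>\<^bsub>loc P\<^esub> x"
      using loc_add[OF xy(1,3)] loc_add[OF xy(3,1)] xy C by (simp add: m_ac a_ac)
    fix z assume zK: "z \<in> carrier (loc P)"
    obtain k c h where z: "hfrac P k c h" "z = ratio P c h" by (rule loc_elem[OF zK])
    note C = C hfracD[OF z(1)]
    have "x \<oplus>\<^bsub>loc P\<^esub> y \<oplus>\<^bsub>loc P\<^esub> z = ratio P ((a \<otimes> g \<oplus> b \<otimes> f) \<otimes> h \<oplus> c \<otimes> (f \<otimes> g)) (f \<otimes> g \<otimes> h)"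
      using loc_add[OF xy(1,3)] loc_add[OF hfrac_add[OF xy(1,3)] z(1)] xy z by simp
    moreover have "x \<oplus>\<^bsub>loc P\<^esub> (y \<oplus>\<^bsub>loc P\<^esub> z) = ratio P (a \<otimes> (g \<otimes> h) \<oplus> (b \<otimes> h \<oplus> c \<otimes> g) \<otimes> f) (f \<otimes> (g \<otimes> h))"
      using loc_add[OF xy(3) z(1)] loc_add[OF xy(1) hfrac_add[OF xy(3) z(1)]] xy z by simp
    moreover have "f \<otimes> g \<otimes> h = f \<otimes> (g \<otimes> h)" using C by (simp add: m_ac)
    moreover have "(a \<otimes> g \<oplus> b \<otimes> f) \<otimes> h \<oplus> c \<otimes> (f \<otimes> g) = a \<otimes> (g \<otimes> h) \<oplus> (b \<otimes> h \<oplus> c \<otimes> g) \<otimes> f"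
      using C by (simp add: l_distr r_distr m_ac a_ac)
    ultimately show "x \<oplus>\<^bsub>loc P\<^esub> y \<oplus>\<^bsub>loc P\<^esub> z = x \<oplus>\<^bsub>loc P\<^esub> (y \<oplus>\<^bsub>loc P\<^esub> z)" by simp
  next
    show "\<zero>\<^bsub>loc P\<^esub> \<in> carrier (loc P)" using loc_carrierI[OF hfrac_zero] loc_zero by simp
    fix x assume xK: "x \<in> carrier (loc P)"
    obtain d a f where x: "hfrac P d a f" "x = ratio P a f" by (rule loc_elem[OF xK])
    note C = hfracD[OF x(1)]
    show "\<zero>\<^bsub>loc P\<^esub> \<oplus>\<^bsub>loc P\<^esub> x = x"
      using loc_add[OF hfrac_zero x(1)] C x loc_zero by simp
    have n: "hfrac P d (\<ominus> a) f" using x(1) gr_neg by (simp add: hfrac_def)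
    have z: "hfrac P d (\<ominus> a \<oplus> a) f" using x(1) gr_neg gr_add by (simp add: hfrac_def)
    have "ratio P (\<ominus> a) f \<oplus>\<^bsub>loc P\<^esub> x = \<zero>\<^bsub>loc P\<^esub>"
      unfolding x(2) loc_add_same[OF n x(1)] loc_zero frac_eq_iff[OF z hfrac_zero]
      using C by (simp add: l_neg)
    then show "\<exists>y\<in>carrier (loc P). y \<oplus>\<^bsub>loc P\<^esub> x = \<zero>\<^bsub>loc P\<^esub>" using loc_carrierI[OF n] by blast
  qed
  show "comm_monoid (loc P)"
  proof (rule comm_monoidI)
    fix x y assume xK: "x \<in> carrier (loc P)" and yK: "y \<in> carrier (loc P)"
    obtain d a f where x: "hfrac P d a f" "x = ratio P a f" by (rule loc_elem[OF xK])
    obtain e b g where y: "hfrac P e b g" "y = ratio P b g" by (rule loc_elem[OF yK])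
    note xy = x y
    note C = hfracD[OF xy(1)] hfracD[OF xy(3)]
    show "x \<otimes>\<^bsub>loc P\<^esub> y \<in> carrier (loc P)"
      using loc_carrierI[OF hfrac_mult[OF xy(1,3)]] loc_mult[OF xy(1,3)] xy by simp
    show "x \<otimes>\<^bsub>loc P\<^esub> y = y \<otimes>\<^bsub>loc P\<^esub> x"
      using loc_mult[OF xy(1,3)] loc_mult[OF xy(3,1)] xy C by (simp add: m_ac)
    fix z assume zK: "z \<in> carrier (loc P)"
    obtain k c h where z: "hfrac P k c h" "z = ratio P c h" by (rule loc_elem[OF zK])
    note C = C hfracD[OF z(1)]
    show "x \<otimes>\<^bsub>loc P\<^esub> y \<otimes>\<^bsub>loc P\<^esub> z = x \<otimes>\<^bsub>loc P\<^esub> (y \<otimes>\<^bsub>loc P\<^esub> z)"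
      using loc_mult[OF xy(1,3)] loc_mult[OF hfrac_mult[OF xy(1,3)] z(1)]
        loc_mult[OF xy(3) z(1)] loc_mult[OF xy(1) hfrac_mult[OF xy(3) z(1)]] xy z C
      by (simp add: m_ac)
  next
    show "\<one>\<^bsub>loc P\<^esub> \<in> carrier (loc P)" using loc_carrierI[OF hfrac_one] loc_one by simp
    fix x assume xK: "x \<in> carrier (loc P)"
    obtain d a f where x: "hfrac P d a f" "x = ratio P a f" by (rule loc_elem[OF xK])
    show "\<one>\<^bsub>loc P\<^esub> \<otimes>\<^bsub>loc P\<^esub> x = x"
      using x loc_mult[OF hfrac_one x(1)] hfracD[OF x(1)] loc_one by simp
  qed
  fix x y z
  assume xK: "x \<in> carrier (loc P)" and yK: "y \<in> carrier (loc P)" and zK: "z \<in> carrier (loc P)"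
  obtain d a f where x: "hfrac P d a f" "x = ratio P a f" by (rule loc_elem[OF xK])
  obtain e b g where y: "hfrac P e b g" "y = ratio P b g" by (rule loc_elem[OF yK])
  obtain k c h where z: "hfrac P k c h" "z = ratio P c h" by (rule loc_elem[OF zK])
  note xyz = x y z
  note C = hfracD[OF xyz(1)] hfracD[OF xyz(3)] hfracD[OF xyz(5)]
  note xz = hfrac_mult[OF xyz(1,5)] and yz = hfrac_mult[OF xyz(3,5)]
  note xy = hfrac_add[OF xyz(1,3)]
  show "(x \<oplus>\<^bsub>loc P\<^esub> y) \<otimes>\<^bsub>loc P\<^esub> z = x \<otimes>\<^bsub>loc P\<^esub> z \<oplus>\<^bsub>loc P\<^esub> y \<otimes>\<^bsub>loc P\<^esub> z"
    unfolding xyz loc_add[OF xyz(1,3)] loc_mult[OF xy xyz(5)] loc_mult[OF xyz(1,5)]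
      loc_mult[OF xyz(3,5)] loc_add[OF xz yz] frac_eq_iff[OF hfrac_mult[OF xy xyz(5)] hfrac_add[OF xz yz]]
    using C by (simp add: l_distr r_distr m_ac)
qed

lemma local_ring_loc: "local_ring_with (loc P) (loc_max P)"
proof -
  interpret K: cring "loc P" by (rule cring_loc)
  \<comment> \<open>Whether the numerator lies in \<open>P\<close> does not depend on the fraction
    chosen: from \<open>g a = f b\<close> with \<open>b\<close> in \<open>P\<close> and
    \<open>g\<close> outside \<open>P\<close>, primality gives \<open>a\<close> in
    \<open>P\<close>.\<close>
  have mem: "ratio P a f \<in> loc_max P \<longleftrightarrow> a \<in> P" if h: "hfrac P d a f" for d a f
  proof
    assume "ratio P a f \<in> loc_max P"
    then obtain e b g where b: "hfrac P e b g" "b \<in> P" "ratio P a f = ratio P b g"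
      by (auto simp: loc_max_def)
    then have "g \<otimes> a = f \<otimes> b" using frac_eq_iff[OF h b(1)] by simp
    then have "g \<otimes> a \<in> P" using P.I_l_closed[OF b(2)] hfracD[OF h] by simp
    then show "a \<in> P" using P.I_prime hfracD[OF h] hfracD[OF b(1)] b(1) by (auto simp: hfrac_def)
  qed (use h in \<open>auto simp: loc_max_def\<close>)
  have "ideal (loc_max P) (loc P)"
  proof (rule K.idealI_cring)
    show "loc_max P \<subseteq> carrier (loc P)" by (auto simp: loc_max_def loc_carrier)
    show "\<zero>\<^bsub>loc P\<^esub> \<in> loc_max P" using mem[OF hfrac_zero] P.zero_closed loc_zero by simp
    fix x y assume "y \<in> loc_max P"
    then obtain e b g where y: "hfrac P e b g" "b \<in> P" "y = ratio P b g" by (auto simp: loc_max_def)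
    show "x \<oplus>\<^bsub>loc P\<^esub> y \<in> loc_max P" if xM: "x \<in> loc_max P"
    proof -
      obtain d a f where x: "hfrac P d a f" "a \<in> P" "x = ratio P a f"
        using xM by (auto simp: loc_max_def)
      have "a \<otimes> g \<oplus> b \<otimes> f \<in> P"
        using P.I_r_closed x(2) y(2) hfracD[OF x(1)] hfracD[OF y(1)] by (simp add: P.a_closed)
      then show ?thesis
        using loc_add[OF x(1) y(1)] mem[OF hfrac_add[OF x(1) y(1)]] x y by simp
    qed
    show "x \<otimes>\<^bsub>loc P\<^esub> y \<in> loc_max P" if xK: "x \<in> carrier (loc P)"
    proof -
      obtain d a f where x: "hfrac P d a f" "x = ratio P a f" using xK by (auto simp: loc_carrier)
      show ?thesis
        using loc_mult[OF x(1) y(1)] mem[OF hfrac_mult[OF x(1) y(1)]] x y P.I_l_closed hfracD[OF x(1)]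
        by simp
    qed
  qed
  moreover have "loc_max P \<noteq> carrier (loc P)"
    using mem[OF hfrac_one] loc_carrierI[OF hfrac_one] one_notin by blast
  moreover have "\<exists>y\<in>carrier (loc P). x \<otimes>\<^bsub>loc P\<^esub> y = \<one>\<^bsub>loc P\<^esub>"
    if xK: "x \<in> carrier (loc P) - loc_max P" for x
  proof -
    obtain d a f where x: "hfrac P d a f" "x = ratio P a f" using xK by (auto simp: loc_carrier)
    then have "a \<notin> P" using xK mem by blast
    then have y: "hfrac P d f a" using x by (simp add: hfrac_def)
    have "x \<otimes>\<^bsub>loc P\<^esub> ratio P f a = \<one>\<^bsub>loc P\<^esub>"
      unfolding x(2) loc_mult[OF x(1) y] loc_one frac_eq_iff[OF hfrac_mult[OF x(1) y] hfrac_one]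
      using hfracD[OF y] by (simp add: m_comm)
    then show ?thesis using loc_carrierI[OF y] by blast
  qed
  ultimately show ?thesis using cring_loc by (simp add: local_ring_with_def)
qed

end

end

section \<open>Topology, sections and stalks of Proj\<close>

lemma openin_spec_basic:
  "f \<in> carrier R \<Longrightarrow> openin (spec_top R) {P. primeideal P R \<and> f \<notin> P}"
  unfolding spec_top_def by (rule topology_generated_by_Basis) blast

lemma (in cring) topspace_spec: "topspace (spec_top R) = {P. primeideal P R}"
proof -
  have "\<one> \<notin> P" if "primeideal P R" for P
    using ideal.one_imp_carrier[of P R] primeideal.I_notcarr[OF that] primeideal.axioms(1)[OF that]
    by blast
  then have "\<Union>{{P. primeideal P R \<and> f \<notin> P} | f. f \<in> carrier R} = {P. primeideal P R}"
    using one_closed by blast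
  then show ?thesis by (simp add: spec_top_def)
qed

context graded_domain
begin

lemma topspace_proj: "topspace (proj_top S gr) = proj_points S gr"
  by (auto simp: proj_top_def topspace_spec proj_points_def)

lemma openin_proj_basic:
  assumes "f \<in> carrier S"
  shows "openin (proj_top S gr) {P \<in> proj_points S gr. f \<notin> P}"
proof -
  have "{P \<in> proj_points S gr. f \<notin> P} = {P. primeideal P S \<and> f \<notin> P} \<inter> proj_points S gr"
    by (auto simp: proj_points_def)
  then show ?thesis unfolding proj_top_def openin_subtopology
    using openin_spec_basic[OF assms] by blast
qed

lemma openin_proj_subset: "openin (proj_top S gr) U \<Longrightarrow> P \<in> U \<Longrightarrow> P \<in> proj_points S gr"
  using openin_subset topspace_proj by blast

definition local_fraction :: "'a set set \<Rightarrow> ('a set \<Rightarrow> ('a \<times> 'a) set) \<Rightarrow> bool" where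
  "local_fraction V s \<longleftrightarrow> (\<exists>d a f. \<forall>Q\<in>V. hfrac Q d a f \<and> s Q = ratio Q a f)"

text \<open>A function that is locally a homogeneous fraction of degree zero automatically takes
  values in the local rings, so only extensionality remains of the product condition.\<close>

lemma proj_section_iff:
  assumes U: "openin (proj_top S gr) U"
  shows "s \<in> carrier (proj_sections S gr U) \<longleftrightarrow> s \<in> extensional U \<and>
    (\<forall>P\<in>U. \<exists>V. openin (proj_top S gr) V \<and> P \<in> V \<and> V \<subseteq> U \<and> local_fraction V s)"
    (is "?L \<longleftrightarrow> ?R")
proof
  assume ?L
  then have s: "s \<in> (\<Pi>\<^sub>E P\<in>U. carrier (loc P))"
    "\<And>P. P \<in> U \<Longrightarrow> \<exists>V. openin (proj_top S gr) V \<and> P \<in> V \<and> V \<subseteq> U \<and>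
        (\<exists>d. \<exists>a\<in>gr d. \<exists>f\<in>gr d. \<forall>Q\<in>V. f \<notin> Q \<and> s Q = ratio Q a f)"
    by (auto simp: proj_sections_def pointwise_ring_def)
  have "\<exists>V. openin (proj_top S gr) V \<and> P \<in> V \<and> V \<subseteq> U \<and> local_fraction V s" if P: "P \<in> U" for P
  proof -
    obtain V d a f where V: "openin (proj_top S gr) V" "P \<in> V" "V \<subseteq> U" "a \<in> gr d" "f \<in> gr d"
      "\<forall>Q\<in>V. f \<notin> Q \<and> s Q = ratio Q a f" using s(2)[OF P] by blast
    then have "local_fraction V s" unfolding local_fraction_def hfrac_def by blast
    then show ?thesis using V by blast
  qed
  then show ?R using s(1) by (auto simp: PiE_def)
next
  assume R: ?R
  have "s P \<in> carrier (loc P)" if P: "P \<in> U" for P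
  proof -
    obtain V d a f where "P \<in> V" "\<forall>Q\<in>V. hfrac Q d a f \<and> s Q = ratio Q a f"
      using R P unfolding local_fraction_def by blast
    then show ?thesis using loc_carrierI by auto
  qed
  moreover have "\<exists>V. openin (proj_top S gr) V \<and> P \<in> V \<and> V \<subseteq> U \<and>
        (\<exists>d. \<exists>a\<in>gr d. \<exists>f\<in>gr d. \<forall>Q\<in>V. f \<notin> Q \<and> s Q = ratio Q a f)" if P: "P \<in> U" for P
  proof -
    obtain V d a f where V: "openin (proj_top S gr) V" "P \<in> V" "V \<subseteq> U"
      "\<forall>Q\<in>V. hfrac Q d a f \<and> s Q = ratio Q a f"
      using R P unfolding local_fraction_def by blast
    then have "a \<in> gr d" "f \<in> gr d" "\<forall>Q\<in>V. f \<notin> Q \<and> s Q = ratio Q a f" by (auto simp: hfrac_def)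
    then show ?thesis using V by blast
  qed
  ultimately show ?L using R by (auto simp: proj_sections_def pointwise_ring_def PiE_def)
qed

lemma proj_section_value:
  assumes "openin (proj_top S gr) U" "s \<in> carrier (proj_sections S gr U)" "P \<in> U"
  obtains V d a f where "openin (proj_top S gr) V" "P \<in> V" "V \<subseteq> U"
    "\<And>Q. Q \<in> V \<Longrightarrow> hfrac Q d a f \<and> s Q = ratio Q a f"
proof -
  obtain V where V: "openin (proj_top S gr) V" "P \<in> V" "V \<subseteq> U" "local_fraction V s"
    using assms(2,3) proj_section_iff[OF assms(1)] by blast
  then obtain d a f where "\<forall>Q\<in>V. hfrac Q d a f \<and> s Q = ratio Q a f"
    unfolding local_fraction_def by blast
  then show thesis using V that by blast
qed

lemma local_fraction_mono: "local_fraction V s \<Longrightarrow> W \<subseteq> V \<Longrightarrow> local_fraction W s"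
  unfolding local_fraction_def by blast

lemma local_fraction_cong:
  "local_fraction V s \<Longrightarrow> (\<And>Q. Q \<in> V \<Longrightarrow> t Q = s Q) \<Longrightarrow> local_fraction V t"
  unfolding local_fraction_def by metis

lemma proj_section_restrict:
  assumes "openin (proj_top S gr) U" "openin (proj_top S gr) W" "W \<subseteq> U"
    "s \<in> carrier (proj_sections S gr U)"
  shows "restrict s W \<in> carrier (proj_sections S gr W)"
  unfolding proj_section_iff[OF assms(2)]
proof (intro conjI ballI)
  fix P assume P: "P \<in> W"
  then obtain V where V: "openin (proj_top S gr) V" "P \<in> V" "local_fraction V s"
    using proj_section_iff[OF assms(1)] assms(3,4) by blast
  have "local_fraction (V \<inter> W) (restrict s W)"
    by (rule local_fraction_cong[OF local_fraction_mono[OF V(3)]]) auto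
  then show "\<exists>V. openin (proj_top S gr) V \<and> P \<in> V \<and> V \<subseteq> W \<and> local_fraction V (restrict s W)"
    using V P assms(2) by (meson Int_iff Int_lower2 openin_Int)
qed auto

text \<open>Serves for sum and product, with \<open>num\<close> the numerator of the result over the
  common denominator. On the intersection of two neighbourhoods where \<open>s\<close> and
  \<open>t\<close> are single fractions, the result is a single fraction too.\<close>

lemma proj_section_op:
  assumes U: "openin (proj_top S gr) U"
    and s: "s \<in> carrier (proj_sections S gr U)" and t: "t \<in> carrier (proj_sections S gr U)"
    and op: "\<And>P d e a b f g. \<lbrakk>P \<in> U; hfrac P d a f; hfrac P e b g\<rbrakk> \<Longrightarrow>
      hfrac P (d + e) (num a b f g) (f \<otimes> g) \<and>
      op P (ratio P a f) (ratio P b g) = ratio P (num a b f g) (f \<otimes> g)"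
  shows "(\<lambda>P\<in>U. op P (s P) (t P)) \<in> carrier (proj_sections S gr U)"
  unfolding proj_section_iff[OF U]
proof (intro conjI ballI)
  fix P assume P: "P \<in> U"
  obtain V d a f where V: "openin (proj_top S gr) V" "P \<in> V" "V \<subseteq> U"
    "\<And>Q. Q \<in> V \<Longrightarrow> hfrac Q d a f \<and> s Q = ratio Q a f"
    using proj_section_value[OF U s P] by blast
  obtain W e b g where W: "openin (proj_top S gr) W" "P \<in> W" "W \<subseteq> U"
    "\<And>Q. Q \<in> W \<Longrightarrow> hfrac Q e b g \<and> t Q = ratio Q b g"
    using proj_section_value[OF U t P] by blast
  have "local_fraction (V \<inter> W) (\<lambda>P\<in>U. op P (s P) (t P))"
    unfolding local_fraction_def
  proof (intro exI ballI)
    fix Q assume Q: "Q \<in> V \<inter> W"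
    then have "Q \<in> U" "hfrac Q d a f" "hfrac Q e b g" "s Q = ratio Q a f" "t Q = ratio Q b g"
      using V W by auto
    then show "hfrac Q (d + e) (num a b f g) (f \<otimes> g) \<and>
      (\<lambda>P\<in>U. op P (s P) (t P)) Q = ratio Q (num a b f g) (f \<otimes> g)"
      using op[of Q d a f e b g] by simp
  qed
  then show "\<exists>V. openin (proj_top S gr) V \<and> P \<in> V \<and> V \<subseteq> U \<and>
      local_fraction V (\<lambda>P\<in>U. op P (s P) (t P))"
    using V(1-3) W(1,2) by (meson Int_iff le_infI1 openin_Int)
qed auto

lemma proj_section_const:
  assumes "openin (proj_top S gr) U" "\<And>P. P \<in> U \<Longrightarrow> hfrac P d a f"
  shows "(\<lambda>P\<in>U. ratio P a f) \<in> carrier (proj_sections S gr U)"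
  unfolding proj_section_iff[OF assms(1)] local_fraction_def
  using assms by (auto intro!: exI[of _ U])

text \<open>Evaluation at \<open>P\<close> identifies the stalk with the homogeneous localization.
  Two sections with the same value at \<open>P\<close> agree nearby, because equality of
  \<open>a / f\<close> and \<open>b / g\<close> is the equation \<open>g a = f b\<close> in the
  domain \<open>S\<close>, which does not mention the prime.\<close>

lemma stalk_values_Proj:
  assumes P: "P \<in> proj_points S gr"
  shows "stalk_values (Proj S gr) P (loc P) (\<lambda>U s. s P) (loc_max P)"
proof -
  have simps: "space_top (Proj S gr) = proj_top S gr" "sections (Proj S gr) = proj_sections S gr"
    "restr (Proj S gr) U W s = restrict s W" for U W s by (simp_all add: Proj_def)
  have pr: "primeideal Q S" if "openin (proj_top S gr) U" "Q \<in> U" for U Q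
    using openin_proj_subset[OF that] proj_point_prime by blast
  have ops: "s \<otimes>\<^bsub>proj_sections S gr U\<^esub> t = (\<lambda>P\<in>U. s P \<otimes>\<^bsub>loc P\<^esub> t P)"
    "s \<oplus>\<^bsub>proj_sections S gr U\<^esub> t = (\<lambda>P\<in>U. s P \<oplus>\<^bsub>loc P\<^esub> t P)"
    "\<zero>\<^bsub>proj_sections S gr U\<^esub> = (\<lambda>P\<in>U. ratio P \<zero> \<one>)"
    "\<one>\<^bsub>proj_sections S gr U\<^esub> = (\<lambda>P\<in>U. ratio P \<one> \<one>)" for U s t
    by (simp_all add: proj_sections_def pointwise_ring_def loc_zero loc_one)
  have closed: "s \<otimes>\<^bsub>proj_sections S gr U\<^esub> t \<in> carrier (proj_sections S gr U)"
    "s \<oplus>\<^bsub>proj_sections S gr U\<^esub> t \<in> carrier (proj_sections S gr U)"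
    if "openin (proj_top S gr) U" "s \<in> carrier (proj_sections S gr U)"
      "t \<in> carrier (proj_sections S gr U)" for U s t
    unfolding ops
    using proj_section_op[OF that, of "\<lambda>a b f g. a \<otimes> b" "\<lambda>P. (\<otimes>\<^bsub>loc P\<^esub>)"]
      proj_section_op[OF that, of "\<lambda>a b f g. a \<otimes> g \<oplus> b \<otimes> f" "\<lambda>P. (\<oplus>\<^bsub>loc P\<^esub>)"]
      pr[OF that(1)] hfrac_mult loc_mult hfrac_add loc_add by simp_all
  have const: "\<one>\<^bsub>proj_sections S gr U\<^esub> \<in> carrier (proj_sections S gr U)"
     "\<zero>\<^bsub>proj_sections S gr U\<^esub> \<in> carrier (proj_sections S gr U)"
     if "openin (proj_top S gr) U" for U
    unfolding ops using proj_section_const[OF that hfrac_one[OF pr[OF that]]]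
      proj_section_const[OF that hfrac_zero[OF pr[OF that]]] by auto
  show ?thesis
  proof
    show "local_ring_with (loc P) (loc_max P)" using local_ring_loc proj_point_prime[OF P] by blast
    show "P \<in> topspace (space_top (Proj S gr))" using P by (simp add: simps topspace_proj)
  next
    fix U W s assume "openin (space_top (Proj S gr)) U" "openin (space_top (Proj S gr)) W"
      "P \<in> W" "W \<subseteq> U" "s \<in> carrier (sections (Proj S gr) U)"
    then show "restr (Proj S gr) U W s \<in> carrier (sections (Proj S gr) W) \<and>
        restr (Proj S gr) U W s P = s P"
      using proj_section_restrict by (simp add: simps)
  next
    fix U V s t assume "openin (space_top (Proj S gr)) U" "openin (space_top (Proj S gr)) V"
      "P \<in> U" "P \<in> V" "s \<in> carrier (sections (Proj S gr) U)"
      "t \<in> carrier (sections (Proj S gr) V)" "s P = t P"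
    note A = this[unfolded simps]
    obtain U' d a f where U: "openin (proj_top S gr) U'" "P \<in> U'" "U' \<subseteq> U"
      "\<And>Q. Q \<in> U' \<Longrightarrow> hfrac Q d a f \<and> s Q = ratio Q a f"
      using proj_section_value[OF A(1,5,3)] by blast
    obtain V' e b g where V: "openin (proj_top S gr) V'" "P \<in> V'" "V' \<subseteq> V"
      "\<And>Q. Q \<in> V' \<Longrightarrow> hfrac Q e b g \<and> t Q = ratio Q b g"
      using proj_section_value[OF A(2,6,4)] by blast
    have "ratio P a f = ratio P b g" using U(4)[OF U(2)] V(4)[OF V(2)] A(7) by simp
    then have eq: "g \<otimes> a = f \<otimes> b"
      using frac_eq_iff[OF proj_point_prime[OF P]] U(4)[OF U(2)] V(4)[OF V(2)] by blast
    have "s Q = t Q" if "Q \<in> U' \<inter> V'" for Q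
      using eq frac_eq_iff[OF pr[OF U(1), of Q], of d a f e b g] U(4)[of Q] V(4)[of Q] that by simp
    then have "restrict s (U' \<inter> V') = restrict t (U' \<inter> V')" by (rule restrict_ext)
    then show "\<exists>W. openin (space_top (Proj S gr)) W \<and> P \<in> W \<and> W \<subseteq> U \<inter> V \<and>
        restr (Proj S gr) U W s = restr (Proj S gr) V W t"
      using U V unfolding simps by (intro exI[of _ "U' \<inter> V'"]) auto
  next
    fix U assume "openin (space_top (Proj S gr)) U" "P \<in> U"
    note U = this[unfolded simps]
    have "s P \<in> carrier (loc P)" if "s \<in> carrier (proj_sections S gr U)" for s
      using proj_section_value[OF U(1) that U(2)] loc_carrierI by metis
    then show "(\<lambda>s. s P) \<in> ring_hom (sections (Proj S gr) U) (loc P)"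
      by (intro ring_hom_memI) (simp_all add: simps ops U loc_one)
    show "\<zero>\<^bsub>sections (Proj S gr) U\<^esub> \<in> carrier (sections (Proj S gr) U) \<and>
        \<zero>\<^bsub>sections (Proj S gr) U\<^esub> P = \<zero>\<^bsub>loc P\<^esub>"
      using const[OF U(1)] by (simp add: simps ops U loc_zero)
    show "\<one>\<^bsub>sections (Proj S gr) U\<^esub> \<in> carrier (sections (Proj S gr) U)"
      using const[OF U(1)] by (simp add: simps)
    fix s t assume "s \<in> carrier (sections (Proj S gr) U)" "t \<in> carrier (sections (Proj S gr) U)"
    then show "s \<otimes>\<^bsub>sections (Proj S gr) U\<^esub> t \<in> carrier (sections (Proj S gr) U) \<and>
        s \<oplus>\<^bsub>sections (Proj S gr) U\<^esub> t \<in> carrier (sections (Proj S gr) U)"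
      using closed[OF U(1)] by (simp add: simps)
  next
    fix l assume "l \<in> carrier (loc P)"
    then obtain d a f where l: "hfrac P d a f" "l = ratio P a f" by (auto simp: loc_carrier)
    let ?U = "{Q \<in> proj_points S gr. f \<notin> Q}"
    have U: "openin (proj_top S gr) ?U" using openin_proj_basic hfracD[OF l(1)] by blast
    moreover have "(\<lambda>Q\<in>?U. ratio Q a f) \<in> carrier (proj_sections S gr ?U)"
      by (rule proj_section_const[OF U, of d]) (use l in \<open>auto simp: hfrac_def\<close>)
    moreover have "P \<in> ?U" using P l by (auto simp: hfrac_def)
    ultimately show "\<exists>U s. openin (space_top (Proj S gr)) U \<and> P \<in> U \<and>
        s \<in> carrier (sections (Proj S gr) U) \<and> s P = l"
      unfolding simps using l(2) by (intro exI[of _ ?U] exI[of _ "\<lambda>Q\<in>?U. ratio Q a f"]) simp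
  qed
qed

end

section \<open>Bivariate homogeneous polynomials\<close>

lemma (in abelian_monoid) finsum_induct:
  assumes "finite I" "\<And>i. i \<in> I \<Longrightarrow> f i \<in> carrier G" "\<And>i. i \<in> I \<Longrightarrow> Q (f i)" "Q \<zero>"
    "\<And>x y. x \<in> carrier G \<Longrightarrow> y \<in> carrier G \<Longrightarrow> Q x \<Longrightarrow> Q y \<Longrightarrow> Q (x \<oplus> y)"
  shows "Q (finsum G f I)"
  using assms(1-3)
proof (induction I)
  case empty
  then show ?case using assms(4) by simp
next
  case (insert i I)
  then have "f \<in> I \<rightarrow> carrier G" by auto
  then show ?case using insert assms(5) by simp
qed

locale poly2_domain = "domain" R for R (structure)
begin

sublocale Q: UP_domain R "UP R"
  by unfold_locales simp

sublocale S: UP_domain "UP R" "UP (UP R)"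
  by unfold_locales simp

abbreviation "S \<equiv> poly2_ring R"
abbreviation "gr \<equiv> poly2_homogeneous R"

definition mono :: "'a \<Rightarrow> nat \<Rightarrow> nat \<Rightarrow> 'a poly2" where
  "mono c i j = monom S (monom (UP R) c j) i"

definition cf :: "'a poly2 \<Rightarrow> nat \<Rightarrow> nat \<Rightarrow> 'a" where
  "cf p i j = coeff (UP R) (coeff S p i) j"

lemma cf_closed [simp]: "p \<in> carrier S \<Longrightarrow> cf p i j \<in> carrier R"
  by (simp add: cf_def)

lemma mono_closed [simp]: "c \<in> carrier R \<Longrightarrow> mono c i j \<in> carrier S"
  by (simp add: mono_def)

lemma cf_mono [simp]: "c \<in> carrier R \<Longrightarrow> cf (mono c i j) k l = (if k = i \<and> l = j then c else \<zero>)"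
  by (auto simp add: cf_def mono_def)

lemma cf_add [simp]:
  "p \<in> carrier S \<Longrightarrow> q \<in> carrier S \<Longrightarrow> cf (p \<oplus>\<^bsub>S\<^esub> q) i j = cf p i j \<oplus> cf q i j"
  by (simp add: cf_def)

lemma cf_zero [simp]: "cf \<zero>\<^bsub>S\<^esub> i j = \<zero>"
  by (simp add: cf_def)

lemma cf_neg [simp]: "p \<in> carrier S \<Longrightarrow> cf (\<ominus>\<^bsub>S\<^esub> p) i j = \<ominus> cf p i j"
  by (simp add: cf_def)

lemma mono_zero [simp]: "mono \<zero> i j = \<zero>\<^bsub>S\<^esub>"
  by (simp add: mono_def)

lemma mono_mult:
  "a \<in> carrier R \<Longrightarrow> b \<in> carrier R \<Longrightarrow> mono a i j \<otimes>\<^bsub>S\<^esub> mono b k l = mono (a \<otimes> b) (i + k) (j + l)"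
  by (simp add: mono_def)

lemma one_mono: "\<one>\<^bsub>S\<^esub> = mono \<one> 0 0"
  by (simp add: mono_def)

lemma const_mono: "poly2_const R c = mono c 0 0"
  by (simp add: poly2_const_def mono_def)

lemma homogeneous_iff: "f \<in> gr d \<longleftrightarrow> f \<in> carrier S \<and> (\<forall>i j. cf f i j \<noteq> \<zero> \<longrightarrow> i + j = d)"
  by (simp add: poly2_homogeneous_def cf_def)

lemma homogeneous_mono: "c \<in> carrier R \<Longrightarrow> mono c i j \<in> gr (i + j)"
  by (auto simp: homogeneous_iff split: if_splits)

lemma homogeneous_zero: "\<zero>\<^bsub>S\<^esub> \<in> gr d"
  by (simp add: homogeneous_iff)

lemma homogeneous_add:
  assumes "a \<in> gr d" "b \<in> gr d"
  shows "a \<oplus>\<^bsub>S\<^esub> b \<in> gr d"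
proof -
  have "cf a i j \<noteq> \<zero> \<or> cf b i j \<noteq> \<zero>" if "cf a i j \<oplus> cf b i j \<noteq> \<zero>" for i j
    using that by auto
  then show ?thesis using assms by (auto simp: homogeneous_iff) blast+
qed

text \<open>Only the terms of \<open>p\<close> itself have to satisfy \<open>Q\<close>. This lets
  \<open>homogeneous_induct\<close> stay in one degree.\<close>

lemma poly2_induct:
  assumes p: "p \<in> carrier S" and zero: "Q \<zero>\<^bsub>S\<^esub>"
    and add: "\<And>x y. x \<in> carrier S \<Longrightarrow> y \<in> carrier S \<Longrightarrow> Q x \<Longrightarrow> Q y \<Longrightarrow> Q (x \<oplus>\<^bsub>S\<^esub> y)"
    and mono: "\<And>i j. Q (mono (cf p i j) i j)"
  shows "Q p"
proof -
  have inner: "Q (monom S (coeff S p i) i)" for i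
  proof -
    let ?q = "coeff S p i"
    have q: "?q \<in> carrier (UP R)" using p by simp
    have "Q (monom S (\<Oplus>\<^bsub>UP R\<^esub>j\<in>{..deg R ?q}. monom (UP R) (coeff (UP R) ?q j) j) i)"
    proof (rule Q.finsum_induct[where Q="\<lambda>r. Q (monom S r i)"])
      show "Q (monom S (monom (UP R) (coeff (UP R) ?q j) j) i)" for j
        using mono[of i j] by (simp add: cf_def mono_def)
      show "Q (monom S \<zero>\<^bsub>UP R\<^esub> i)" using zero by simp
      show "Q (monom S (x \<oplus>\<^bsub>UP R\<^esub> y) i)" if "x \<in> carrier (UP R)" "y \<in> carrier (UP R)"
        "Q (monom S x i)" "Q (monom S y i)" for x y
        using add[of "monom S x i" "monom S y i"] that by simp
    qed (use q in simp_all)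
    then show ?thesis using Q.up_repr[OF q] by simp
  qed
  have "Q (\<Oplus>\<^bsub>S\<^esub>i\<in>{..deg (UP R) p}. monom S (coeff S p i) i)"
    by (rule S.finsum_induct[where Q=Q]) (use inner add zero p in simp_all)
  then show ?thesis using S.up_repr[OF p] by simp
qed

lemma homogeneous_induct:
  assumes f: "f \<in> gr d" and zero: "Q \<zero>\<^bsub>S\<^esub>"
    and add: "\<And>x y. x \<in> gr d \<Longrightarrow> y \<in> gr d \<Longrightarrow> Q x \<Longrightarrow> Q y \<Longrightarrow> Q (x \<oplus>\<^bsub>S\<^esub> y)"
    and mono: "\<And>c i j. c \<in> carrier R \<Longrightarrow> i + j = d \<Longrightarrow> Q (mono c i j)"
  shows "Q f"
proof -
  have fS: "f \<in> carrier S" using f by (simp add: homogeneous_iff)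
  \<comment> \<open>Membership in \<open>gr d\<close> is carried along because additivity of
    \<open>Q\<close> is assumed only there.\<close>
  have "f \<in> gr d \<and> Q f"
  proof (rule poly2_induct[OF fS])
    show "\<zero>\<^bsub>S\<^esub> \<in> gr d \<and> Q \<zero>\<^bsub>S\<^esub>" using homogeneous_zero zero by simp
    show "x \<oplus>\<^bsub>S\<^esub> y \<in> gr d \<and> Q (x \<oplus>\<^bsub>S\<^esub> y)" if "x \<in> gr d \<and> Q x" "y \<in> gr d \<and> Q y" for x y
      using that add homogeneous_add by simp
    show "mono (cf f i j) i j \<in> gr d \<and> Q (mono (cf f i j) i j)" for i j
    proof (cases "cf f i j = \<zero>")
      case True
      then show ?thesis using homogeneous_zero zero by simp
    next
      case False
      then have "i + j = d" using f by (auto simp: homogeneous_iff)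
      then show ?thesis using mono[of "cf f i j" i j] homogeneous_mono[of "cf f i j" i j] fS by simp
    qed
  qed
  then show ?thesis by simp
qed

lemma graded_poly2: "graded_domain S gr"
proof -
  have carr: "a \<in> carrier S" if "a \<in> gr d" for a d using that by (simp add: homogeneous_iff)
  have mult1: "mono c i j \<otimes>\<^bsub>S\<^esub> b \<in> gr (i + j + e)" if c: "c \<in> carrier R" and b: "b \<in> gr e" for c i j b e
    using b
  proof (rule homogeneous_induct)
    show "mono c i j \<otimes>\<^bsub>S\<^esub> \<zero>\<^bsub>S\<^esub> \<in> gr (i + j + e)" using c homogeneous_zero by simp
    show "mono c i j \<otimes>\<^bsub>S\<^esub> (x \<oplus>\<^bsub>S\<^esub> y) \<in> gr (i + j + e)"
      if "x \<in> gr e" "y \<in> gr e" "mono c i j \<otimes>\<^bsub>S\<^esub> x \<in> gr (i + j + e)" "mono c i j \<otimes>\<^bsub>S\<^esub> y \<in> gr (i + j + e)" for x y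
      using that carr homogeneous_add c by (simp add: S.P.r_distr)
    show "mono c i j \<otimes>\<^bsub>S\<^esub> mono c' k l \<in> gr (i + j + e)" if "c' \<in> carrier R" "k + l = e" for c' k l
      using homogeneous_mono[of "c \<otimes> c'" "i + k" "j + l"] that c by (simp add: mono_mult ac_simps)
  qed
  have mult: "a \<otimes>\<^bsub>S\<^esub> b \<in> gr (d + e)" if a: "a \<in> gr d" and b: "b \<in> gr e" for a b d e
    using a
  proof (rule homogeneous_induct)
    show "\<zero>\<^bsub>S\<^esub> \<otimes>\<^bsub>S\<^esub> b \<in> gr (d + e)" using homogeneous_zero carr[OF b] by simp
    show "(x \<oplus>\<^bsub>S\<^esub> y) \<otimes>\<^bsub>S\<^esub> b \<in> gr (d + e)"
      if "x \<in> gr d" "y \<in> gr d" "x \<otimes>\<^bsub>S\<^esub> b \<in> gr (d + e)" "y \<otimes>\<^bsub>S\<^esub> b \<in> gr (d + e)" for x y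
      using that carr homogeneous_add b by (simp add: S.P.l_distr)
    show "mono c i j \<otimes>\<^bsub>S\<^esub> b \<in> gr (d + e)" if "c \<in> carrier R" "i + j = d" for c i j
      using mult1[OF that(1) b, of i j] that by simp
  qed
  show ?thesis
  proof
    show "\<one>\<^bsub>S\<^esub> \<in> gr 0" using homogeneous_mono[of \<one> 0 0] one_mono by simp
    show "\<ominus>\<^bsub>S\<^esub> a \<in> gr d" if "a \<in> gr d" for a d
      using that by (auto simp: homogeneous_iff)
  qed (use homogeneous_zero carr homogeneous_add mult in auto)
qed

sublocale graded_domain S gr
  by (rule graded_poly2)

abbreviation "T0 \<equiv> mono \<one> 1 0"
abbreviation "T1 \<equiv> mono \<one> 0 1"

lemma T_homogeneous: "T0 \<in> gr 1" "T1 \<in> gr 1"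
  using homogeneous_mono[of \<one> 1 0] homogeneous_mono[of \<one> 0 1] by simp_all

text \<open>Builds a form by multiplying with one variable at a time. It suits the computation of
  pullbacks, where only constants and the quotient of the two variables are understood
  directly.\<close>

lemma homogeneous_step_induct:
  assumes f: "f \<in> gr d"
    and zero: "\<And>d. Q d \<zero>\<^bsub>S\<^esub>"
    and const: "\<And>c. c \<in> carrier R \<Longrightarrow> Q 0 (mono c 0 0)"
    and T0: "\<And>d f. f \<in> gr d \<Longrightarrow> Q d f \<Longrightarrow> Q (Suc d) (T0 \<otimes>\<^bsub>S\<^esub> f)"
    and T1: "\<And>d f. f \<in> gr d \<Longrightarrow> Q d f \<Longrightarrow> Q (Suc d) (T1 \<otimes>\<^bsub>S\<^esub> f)"
    and add: "\<And>d f g. f \<in> gr d \<Longrightarrow> g \<in> gr d \<Longrightarrow> Q d f \<Longrightarrow> Q d g \<Longrightarrow> Q d (f \<oplus>\<^bsub>S\<^esub> g)"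
  shows "Q d f"
proof -
  have m0: "Q j (mono c 0 j)" if c: "c \<in> carrier R" for c j
  proof (induction j)
    case (Suc j)
    have "mono c 0 (Suc j) = T1 \<otimes>\<^bsub>S\<^esub> mono c 0 j" using c by (simp add: mono_mult)
    then show ?case using T1[OF _ Suc] homogeneous_mono[OF c, of 0 j] by simp
  qed (use const c in simp)
  have m: "Q (i + j) (mono c i j)" if c: "c \<in> carrier R" for c i j
  proof (induction i)
    case (Suc i)
    have "mono c (Suc i) j = T0 \<otimes>\<^bsub>S\<^esub> mono c i j" using c by (simp add: mono_mult)
    then show ?case using T0[OF _ Suc] homogeneous_mono[OF c, of i j] by simp
  qed (use m0 c in simp)
  show ?thesis using f
    by (rule homogeneous_induct) (use zero add m in auto)
qed

lemma homogeneous_decomposition: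
  assumes "p \<in> carrier S"
  obtains c N where "\<And>d. c d \<in> gr d" "p = (\<Oplus>\<^bsub>S\<^esub>d\<in>{..N::nat}. c d)"
proof -
  \<comment> \<open>The equation is demanded for all large bounds \<open>n\<close>, so that
    decompositions of two summands can be added over a common range.\<close>
  have "\<exists>c N. (\<forall>d. c d \<in> gr d) \<and> (\<forall>n\<ge>N. p = (\<Oplus>\<^bsub>S\<^esub>d\<in>{..n::nat}. c d))"
    using assms
  proof (rule poly2_induct)
    show "\<exists>c N. (\<forall>d. c d \<in> gr d) \<and> (\<forall>n\<ge>N. \<zero>\<^bsub>S\<^esub> = (\<Oplus>\<^bsub>S\<^esub>d\<in>{..n::nat}. c d))"
      by (intro exI[of _ "\<lambda>_. \<zero>\<^bsub>S\<^esub>"] exI[of _ 0]) (simp add: gr_zero)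
  next
    fix x y
    assume "\<exists>c N. (\<forall>d. c d \<in> gr d) \<and> (\<forall>n\<ge>N. x = (\<Oplus>\<^bsub>S\<^esub>d\<in>{..n::nat}. c d))"
      "\<exists>c N. (\<forall>d. c d \<in> gr d) \<and> (\<forall>n\<ge>N. y = (\<Oplus>\<^bsub>S\<^esub>d\<in>{..n::nat}. c d))"
    then obtain c N c' N' where c: "\<And>d. c d \<in> gr d" "\<And>n. n \<ge> N \<Longrightarrow> x = (\<Oplus>\<^bsub>S\<^esub>d\<in>{..n::nat}. c d)"
      "\<And>d. c' d \<in> gr d" "\<And>n. n \<ge> N' \<Longrightarrow> y = (\<Oplus>\<^bsub>S\<^esub>d\<in>{..n::nat}. c' d)" by auto
    have "x \<oplus>\<^bsub>S\<^esub> y = (\<Oplus>\<^bsub>S\<^esub>d\<in>{..n}. c d \<oplus>\<^bsub>S\<^esub> c' d)" if "n \<ge> max N N'" for n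
    proof -
      have "c \<in> {..n} \<rightarrow> carrier S" "c' \<in> {..n} \<rightarrow> carrier S" using c(1,3) gr_carrier by auto
      then show ?thesis using c(2)[of n] c(4)[of n] that by (simp add: S.P.finsum_addf)
    qed
    moreover have "c d \<oplus>\<^bsub>S\<^esub> c' d \<in> gr d" for d using c gr_add by simp
    ultimately show "\<exists>c N. (\<forall>d. c d \<in> gr d) \<and> (\<forall>n\<ge>N. x \<oplus>\<^bsub>S\<^esub> y = (\<Oplus>\<^bsub>S\<^esub>d\<in>{..n::nat}. c d))"
      by (intro exI[of _ "\<lambda>d. c d \<oplus>\<^bsub>S\<^esub> c' d"] exI[of _ "max N N'"]) simp
  next
    fix i j
    let ?m = "mono (cf p i j) i j"
    have m: "?m \<in> gr (i + j)" "?m \<in> carrier S" using assms homogeneous_mono by simp_all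
    let ?c = "\<lambda>d. if i + j = d then ?m else \<zero>\<^bsub>S\<^esub>"
    have "?m = (\<Oplus>\<^bsub>S\<^esub>d\<in>{..n}. ?c d)" if "n \<ge> i + j" for n
      using S.P.finsum_singleton[of "i + j" "{..n}" "\<lambda>_. ?m"] that m by simp
    then show "\<exists>c N. (\<forall>d. c d \<in> gr d) \<and> (\<forall>n\<ge>N. ?m = (\<Oplus>\<^bsub>S\<^esub>d\<in>{..n::nat}. c d))"
      using m gr_zero by (intro exI[of _ ?c] exI[of _ "i + j"]) simp
  qed
  then show ?thesis using that by blast
qed

text \<open>\<open>x\<close> replaces the outer variable \<open>T\<^sub>0\<close> and
  \<open>y\<close> the inner variable \<open>T\<^sub>1\<close>, with coefficients mapped by
  \<open>h\<close>.\<close>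

definition poly2_eval :: "('k, 'n) ring_scheme \<Rightarrow> ('a \<Rightarrow> 'k) \<Rightarrow> 'k \<Rightarrow> 'k \<Rightarrow> 'a poly2 \<Rightarrow> 'k" where
  "poly2_eval K h x y = eval (UP R) K (eval R K h y) x"

lemma
  assumes K: "cring K" and h: "h \<in> ring_hom R K" and xy: "x \<in> carrier K" "y \<in> carrier K"
  shows poly2_eval_hom: "poly2_eval K h x y \<in> ring_hom S K"
    and poly2_eval_mono: "c \<in> carrier R \<Longrightarrow>
      poly2_eval K h x y (mono c i j) = h c \<otimes>\<^bsub>K\<^esub> y [^]\<^bsub>K\<^esub> j \<otimes>\<^bsub>K\<^esub> x [^]\<^bsub>K\<^esub> i"
proof -
  interpret K: cring K by fact
  interpret E1: UP_pre_univ_prop R K h "UP R"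
    by unfold_locales (use h in auto)
  interpret E2: UP_pre_univ_prop "UP R" K "eval R K h y" "UP (UP R)"
    by unfold_locales (use E1.eval_ring_hom[OF xy(2)] in auto)
  show "poly2_eval K h x y \<in> ring_hom S K"
    unfolding poly2_eval_def by (rule E2.eval_ring_hom[OF xy(1)])
  show "poly2_eval K h x y (mono c i j) = h c \<otimes>\<^bsub>K\<^esub> y [^]\<^bsub>K\<^esub> j \<otimes>\<^bsub>K\<^esub> x [^]\<^bsub>K\<^esub> i"
    if "c \<in> carrier R"
    unfolding poly2_eval_def mono_def
    using that xy by (simp add: E2.eval_monom E1.eval_monom)
qed

end

section \<open>Valuation rings and the Zariski-Riemann space\<close>

text \<open>The nonunits of \<open>V\<close>. Zero is listed separately because its inverse is an
  unspecified value.\<close>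

definition val_max :: "('a, 'm) ring_scheme \<Rightarrow> 'a set \<Rightarrow> 'a set" where
  "val_max F V = {x \<in> V. x = \<zero>\<^bsub>F\<^esub> \<or> inv\<^bsub>F\<^esub> x \<notin> V}"

context field
begin

lemma inv_nonzero: "x \<in> carrier R \<Longrightarrow> x \<noteq> \<zero> \<Longrightarrow> inv x \<in> carrier R \<and> inv x \<noteq> \<zero>"
  using Units_inv_Units[of x] by (simp add: field_Units)

lemma r_inv_nonzero: "x \<in> carrier R \<Longrightarrow> x \<noteq> \<zero> \<Longrightarrow> x \<otimes> inv x = \<one>"
  using field_Units Units_r_inv by blast

lemma l_inv_nonzero: "x \<in> carrier R \<Longrightarrow> x \<noteq> \<zero> \<Longrightarrow> inv x \<otimes> x = \<one>"
  using field_Units Units_l_inv by blast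

lemma inv_inv_nonzero: "x \<in> carrier R \<Longrightarrow> x \<noteq> \<zero> \<Longrightarrow> inv (inv x) = x"
  using field_Units Units_inv_inv by blast

lemma inv_mult_nonzero:
  "x \<in> carrier R \<Longrightarrow> x \<noteq> \<zero> \<Longrightarrow> y \<in> carrier R \<Longrightarrow> y \<noteq> \<zero> \<Longrightarrow> inv (x \<otimes> y) = inv x \<otimes> inv y"
  using inv_nonzero r_inv_nonzero
  by (intro comm_inv_char) (simp_all add: m_assoc m_lcomm[of y])

lemma pow_nonzero: "x \<in> carrier R \<Longrightarrow> x \<noteq> \<zero> \<Longrightarrow> x [^] (n::nat) \<noteq> \<zero>"
  by (induction n) (auto simp: integral_iff)

lemma mult_inv_cancel: "x \<in> carrier R \<Longrightarrow> x \<noteq> \<zero> \<Longrightarrow> y \<in> carrier R \<Longrightarrow> x \<otimes> (inv x \<otimes> y) = y"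
  using inv_nonzero r_inv_nonzero by (simp add: m_assoc[symmetric])

lemma inv_mult_cancel: "x \<in> carrier R \<Longrightarrow> x \<noteq> \<zero> \<Longrightarrow> y \<in> carrier R \<Longrightarrow> inv x \<otimes> (x \<otimes> y) = y"
  using inv_nonzero l_inv_nonzero by (simp add: m_assoc[symmetric])

lemma divide_eq_iff:
  assumes "a \<in> carrier R" "b \<in> carrier R" "f \<in> carrier R" "g \<in> carrier R" "f \<noteq> \<zero>" "g \<noteq> \<zero>"
  shows "a \<otimes> inv f = b \<otimes> inv g \<longleftrightarrow> g \<otimes> a = f \<otimes> b"
proof -
  have i: "inv f \<in> carrier R" "inv g \<in> carrier R" using assms inv_nonzero by auto
  have "a \<otimes> inv f = b \<otimes> inv g \<longleftrightarrow> (f \<otimes> g) \<otimes> (a \<otimes> inv f) = (f \<otimes> g) \<otimes> (b \<otimes> inv g)"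
    using assms i by (subst m_lcancel) (auto simp: integral_iff)
  also have "(f \<otimes> g) \<otimes> (a \<otimes> inv f) = (f \<otimes> inv f) \<otimes> (g \<otimes> a)" using assms i by (simp add: m_ac)
  also have "(f \<otimes> g) \<otimes> (b \<otimes> inv g) = (g \<otimes> inv g) \<otimes> (f \<otimes> b)" using assms i by (simp add: m_ac)
  finally show ?thesis using assms by (simp add: r_inv_nonzero)
qed

lemma eq_divide_iff:
  assumes "a \<in> carrier R" "x \<in> carrier R" "f \<in> carrier R" "f \<noteq> \<zero>"
  shows "x = a \<otimes> inv f \<longleftrightarrow> x \<otimes> f = a"
  using divide_eq_iff[of a x f \<one>] assms by (auto simp: m_comm)

lemma subring_pow: "subring V R \<Longrightarrow> x \<in> V \<Longrightarrow> x [^] (n::nat) \<in> V"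
  by (induction n) (auto simp: subringE)

lemma valuation_subset: "valuation_ring V R \<Longrightarrow> V \<subseteq> carrier R"
  by (simp add: valuation_ring_def subringE(1))

lemma val_maxD:
  assumes "valuation_ring V R" "x \<in> V" "x \<notin> val_max R V"
  shows "x \<noteq> \<zero>" "inv x \<in> V"
  using assms by (auto simp: val_max_def)

text \<open>If \<open>x y\<close> were a unit of \<open>V\<close>, then so would be
  \<open>y\<close>, with inverse \<open>x \<otimes> inv (x \<otimes> y)\<close>.\<close>

lemma val_max_mult:
  assumes V: "valuation_ring V R" and x: "x \<in> V" and y: "y \<in> val_max R V"
  shows "x \<otimes> y \<in> val_max R V"
proof -
  have sub: "subring V R" using V by (simp add: valuation_ring_def)
  note C = valuation_subset[OF V]
  have yV: "y \<in> V" using y by (simp add: val_max_def)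
  have "inv y \<in> V" if "x \<otimes> y \<noteq> \<zero>" "inv (x \<otimes> y) \<in> V"
  proof -
    have nz: "x \<noteq> \<zero>" "y \<noteq> \<zero>" using that C x yV by auto
    then have "x \<otimes> inv (x \<otimes> y) = inv y"
      using C x yV inv_nonzero by (auto simp: inv_mult_nonzero mult_inv_cancel subset_iff)
    then show ?thesis using subringE(6)[OF sub x that(2)] by simp
  qed
  moreover have "y = \<zero> \<Longrightarrow> x \<otimes> y = \<zero>" using C x by auto
  ultimately show ?thesis using y subringE(6)[OF sub x yV] by (auto simp: val_max_def)
qed

lemma val_max_prime:
  assumes V: "valuation_ring V R" and xy: "x \<in> V" "y \<in> V" "x \<otimes> y \<in> val_max R V"
  shows "x \<in> val_max R V \<or> y \<in> val_max R V"
proof (rule ccontr)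
  assume "\<not> ?thesis"
  then have n: "x \<noteq> \<zero>" "inv x \<in> V" "y \<noteq> \<zero>" "inv y \<in> V" using val_maxD[OF V] xy by auto
  have sub: "subring V R" using V by (simp add: valuation_ring_def)
  note C = valuation_subset[OF V]
  have "x \<in> carrier R" "y \<in> carrier R" using C xy by auto
  then have "x \<otimes> y \<noteq> \<zero>" "inv (x \<otimes> y) = inv x \<otimes> inv y"
    using n by (auto simp: integral_iff inv_mult_nonzero)
  then show False using xy(3) subringE(6)[OF sub n(2,4)] by (simp add: val_max_def)
qed

text \<open>Divisibility over \<open>V\<close> is total. Hence a sum of two elements is
  \<open>c \<oplus> \<one>\<close> times one of them, which is how sums are treated in
  \<open>val_max_add\<close> and \<open>valuation_power_add\<close>.\<close>

lemma valuation_comparable: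
  assumes V: "valuation_ring V R" and xy: "x \<in> carrier R" "y \<in> carrier R"
  shows "(\<exists>c\<in>V. y = c \<otimes> x) \<or> (\<exists>c\<in>V. x = c \<otimes> y)"
proof (cases "x = \<zero> \<or> y = \<zero>")
  case True
  then show ?thesis
    using V xy subringE(2)[of V R] by (auto simp: valuation_ring_def intro!: bexI[of _ \<zero>])
next
  case False
  then have nz: "x \<noteq> \<zero>" "y \<noteq> \<zero>" by auto
  have i: "inv x \<in> carrier R" "inv y \<in> carrier R" using nz xy inv_nonzero by auto
  have "y \<otimes> inv x \<in> carrier R - {\<zero>}" using nz xy inv_nonzero integral_iff by auto
  then have "y \<otimes> inv x \<in> V \<or> inv (y \<otimes> inv x) \<in> V"
    using V by (simp add: valuation_ring_def)
  moreover have "inv (y \<otimes> inv x) = inv y \<otimes> x"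
    using nz xy inv_nonzero by (simp add: inv_mult_nonzero inv_inv_nonzero)
  moreover have "y = (y \<otimes> inv x) \<otimes> x" using nz xy i by (simp add: m_assoc l_inv_nonzero)
  moreover have "x = (inv y \<otimes> x) \<otimes> y" using nz xy i by (simp add: m_ac r_inv_nonzero)
  ultimately show ?thesis by metis
qed

lemma val_max_add:
  assumes V: "valuation_ring V R" and x: "x \<in> val_max R V" and y: "y \<in> val_max R V"
  shows "x \<oplus> y \<in> val_max R V"
proof -
  have sub: "subring V R" using V by (simp add: valuation_ring_def)
  note C = valuation_subset[OF V]
  have *: "c \<otimes> z \<oplus> z \<in> val_max R V" "z \<oplus> c \<otimes> z \<in> val_max R V"
    if c: "c \<in> V" and z: "z \<in> val_max R V" for c z
  proof -
    have zV: "z \<in> V" using z by (simp add: val_max_def)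
    then have cz: "c \<in> carrier R" "z \<in> carrier R" using c C by auto
    have "(c \<oplus> \<one>) \<otimes> z \<in> val_max R V"
      using val_max_mult[OF V _ z] subringE(3,7)[OF sub] c by simp
    then show "c \<otimes> z \<oplus> z \<in> val_max R V" using cz by (simp add: l_distr)
    then show "z \<oplus> c \<otimes> z \<in> val_max R V" using cz by (simp add: a_comm)
  qed
  have "x \<in> carrier R" "y \<in> carrier R" using x y C by (auto simp: val_max_def)
  then show ?thesis using valuation_comparable[OF V, of x y] * x y by blast
qed

lemma local_ring_valuation:
  assumes V: "valuation_ring V R"
  shows "local_ring_with (R\<lparr>carrier := V\<rparr>) (val_max R V)"
proof -
  have sub: "subring V R" using V by (simp add: valuation_ring_def)
  note C = valuation_subset[OF V]
  interpret V: cring "R\<lparr>carrier := V\<rparr>"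
    using subring_is_domain[OF sub] by (simp add: domain_def)
  have mV: "val_max R V \<subseteq> V" by (auto simp: val_max_def)
  have "ideal (val_max R V) (R\<lparr>carrier := V\<rparr>)"
  proof (rule V.idealI_cring)
    show "val_max R V \<subseteq> carrier (R\<lparr>carrier := V\<rparr>)" using mV by simp
  qed (use subringE(2)[OF sub] val_max_add[OF V] val_max_mult[OF V] in \<open>auto simp: val_max_def\<close>)
  moreover have "\<one> \<notin> val_max R V" using subringE(3)[OF sub] by (simp add: val_max_def)
  moreover have "\<exists>y\<in>V. x \<otimes> y = \<one>" if "x \<in> V - val_max R V" for x
    using that val_maxD[OF V, of x] r_inv_nonzero[of x] C by blast
  ultimately show ?thesis using V.is_cring subringE(3)[OF sub] by (auto simp: local_ring_with_def)
qed

lemma max_ideal_valuation: "valuation_ring V R \<Longrightarrow> max_ideal (R\<lparr>carrier := V\<rparr>) = val_max R V"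
  by (rule max_ideal_local_ring_with[OF local_ring_valuation])

text \<open>If \<open>w\<close> is not in \<open>V\<close>, then its inverse is, and
  \<open>w\<close> is the product of \<open>w^k\<close> with the power \<open>k - 1\<close> of that
  inverse.\<close>

lemma valuation_root:
  assumes V: "valuation_ring V R" and w: "w \<in> carrier R" "0 < k" "w [^] (k::nat) \<in> V"
  shows "w \<in> V"
proof (cases "w = \<zero> \<or> w \<in> V")
  case True
  then show ?thesis using V by (auto simp: valuation_ring_def subringE(2))
next
  case False
  have sub: "subring V R" using V by (simp add: valuation_ring_def)
  have iV: "inv w \<in> V" using V w(1) False by (auto simp: valuation_ring_def)
  obtain j where k: "k = Suc j" using w(2) gr0_conv_Suc by auto
  have ic: "inv w \<in> carrier R" using w False inv_nonzero by blast
  have "w [^] j \<otimes> inv w [^] j = \<one>"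
    using nat_pow_distrib[of w "inv w" j] w(1) ic False by (simp add: r_inv_nonzero)
  then have "w [^] k \<otimes> inv w [^] j = w"
    using w(1) ic by (simp add: k m_ac)
  then show ?thesis using subringE(6)[OF sub w(3) subring_pow[OF sub iV, of j]] by simp
qed

text \<open>The condition is not linear in \<open>y\<close>, but if \<open>z = c y\<close> then
  \<open>(y + z)^m x = (c + 1)^m y^m x\<close>. So the elements satisfying it are closed under
  addition.\<close>

lemma valuation_power_add:
  assumes V: "valuation_ring V R" and y: "y \<in> carrier R" "z \<in> carrier R" and x: "x \<in> carrier R"
    and m: "y [^] (m::nat) \<otimes> x \<in> V" "z [^] m \<otimes> x \<in> V"
  shows "(y \<oplus> z) [^] m \<otimes> x \<in> V"
proof -
  have sub: "subring V R" using V by (simp add: valuation_ring_def)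
  note C = valuation_subset[OF V]
  have *: "(c \<otimes> w \<oplus> w) [^] m \<otimes> x \<in> V" if c: "c \<in> V" and w: "w \<in> carrier R" "w [^] m \<otimes> x \<in> V" for c w
  proof -
    have cC: "c \<in> carrier R" using c C by blast
    have "(c \<otimes> w \<oplus> w) [^] m \<otimes> x = ((c \<oplus> \<one>) \<otimes> w) [^] m \<otimes> x"
      using cC w by (simp add: l_distr)
    also have "\<dots> = (c \<oplus> \<one>) [^] m \<otimes> (w [^] m \<otimes> x)"
      using cC w x by (simp add: nat_pow_distrib m_assoc)
    finally show ?thesis
      using subringE(6)[OF sub subring_pow[OF sub] w(2)] subringE(3,7)[OF sub] c by simp
  qed
  show ?thesis using valuation_comparable[OF V y] *[OF _ y(1) m(1)] *[OF _ y(2) m(2)] y C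
    by (auto simp: a_comm subset_iff)
qed

end

locale zr_setting = field F for F :: "'a ring" (structure) +
  fixes D A :: "'a set" and Z :: "'a set set"
  assumes Z_subset: "Z \<subseteq> zariski_riemann F D"
    and F_in_Z: "carrier F \<in> Z"
    and A_def: "A = \<Inter>Z"
begin

abbreviation "RA \<equiv> F\<lparr>carrier := A\<rparr>"
abbreviation "ZS \<equiv> zr_space F D Z"

lemma Z_valuation: "V \<in> Z \<Longrightarrow> valuation_ring V F"
  using Z_subset by (auto simp: zariski_riemann_def)

lemma Z_subring: "V \<in> Z \<Longrightarrow> subring V F"
  using Z_valuation by (simp add: valuation_ring_def)

lemma Z_carrier: "V \<in> Z \<Longrightarrow> x \<in> V \<Longrightarrow> x \<in> carrier F"
  using subringE(1)[OF Z_subring] by blast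

lemma A_subring: "subring A F"
  unfolding A_def using Z_subring F_in_Z by (intro subring_Inter) auto

lemma A_subset: "V \<in> Z \<Longrightarrow> A \<subseteq> V"
  by (auto simp: A_def)

lemma A_carrier: "a \<in> A \<Longrightarrow> a \<in> carrier F"
  using A_subset F_in_Z by blast

lemma space_top_ZS: "space_top ZS = subtopology (zariski_riemann_top F D) Z"
  by (simp add: zr_space_def)

lemma openin_basic:
  assumes "finite T" "T \<subseteq> carrier F"
  shows "openin (space_top ZS) {V \<in> Z. T \<subseteq> V}"
proof -
  have "openin (zariski_riemann_top F D) {V \<in> zariski_riemann F D. T \<subseteq> V}"
    unfolding zariski_riemann_top_def by (rule topology_generated_by_Basis) (use assms in blast)
  moreover have "{V \<in> Z. T \<subseteq> V} = {V \<in> zariski_riemann F D. T \<subseteq> V} \<inter> Z"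
    using Z_subset by blast
  ultimately show ?thesis unfolding space_top_ZS openin_subtopology by blast
qed

lemma topspace_ZS: "topspace (space_top ZS) = Z"
proof
  show "topspace (space_top ZS) \<subseteq> Z" by (simp add: space_top_ZS)
  have "{V \<in> Z. {} \<subseteq> V} = Z" by blast
  then show "Z \<subseteq> topspace (space_top ZS)" using openin_subset[OF openin_basic[of "{}"]] by simp
qed

lemma openin_subset_Z: "openin (space_top ZS) U \<Longrightarrow> U \<subseteq> Z"
  using openin_subset topspace_ZS by blast

text \<open>\<open>carrier F\<close> is the generic point: it contains every finite subset of
  \<open>F\<close> and so lies in every basic open set.\<close>

lemma F_in_open:
  assumes "openin (space_top ZS) U" "U \<noteq> {}"
  shows "carrier F \<in> U"
proof -
  have D: "carrier F \<in> zariski_riemann F D"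
    using F_in_Z Z_subset by blast
  have "T = {} \<or> carrier F \<in> T" if "openin (zariski_riemann_top F D) T" for T
    using that unfolding zariski_riemann_top_def openin_topology_generated_by_iff
    by induction (use D in auto)
  then show ?thesis using assms F_in_Z unfolding space_top_ZS openin_subtopology by auto
qed

lemma sections_ZS: "U \<noteq> {} \<Longrightarrow> sections ZS U = F\<lparr>carrier := \<Inter>U\<rparr>"
  by (simp add: zr_space_def zr_sections_def)

lemma restr_ZS: "W \<noteq> {} \<Longrightarrow> restr ZS U W s = s"
  by (simp add: zr_space_def)

text \<open>Restrictions to nonempty sets are inclusions, so a section is its own value. Each
  \<open>l\<close> in \<open>V\<close> is a section over the basic open set of the points of
  \<open>Z\<close> containing \<open>l\<close>.\<close>

lemma stalk_values_ZS:
  assumes V: "V \<in> Z"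
  shows "stalk_values ZS V (F\<lparr>carrier := V\<rparr>) (\<lambda>U s. s) (val_max F V)"
proof
  show "local_ring_with (F\<lparr>carrier := V\<rparr>) (val_max F V)"
    by (rule local_ring_valuation[OF Z_valuation[OF V]])
  show "V \<in> topspace (space_top ZS)" by (simp add: topspace_ZS V)
next
  fix U W s assume "openin (space_top ZS) U" "openin (space_top ZS) W" "V \<in> W" "W \<subseteq> U"
    "s \<in> carrier (sections ZS U)"
  moreover have "U \<noteq> {}" "W \<noteq> {}" using \<open>V \<in> W\<close> \<open>W \<subseteq> U\<close> by auto
  ultimately show "restr ZS U W s \<in> carrier (sections ZS W) \<and> restr ZS U W s = s"
    by (auto simp: sections_ZS restr_ZS)
next
  fix U W and s t :: 'a
  assume "openin (space_top ZS) U" "openin (space_top ZS) W" "V \<in> U" "V \<in> W" "s = t"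
  then show "\<exists>Y. openin (space_top ZS) Y \<and> V \<in> Y \<and> Y \<subseteq> U \<inter> W \<and> restr ZS U Y s = restr ZS W Y t"
    by (intro exI[of _ "U \<inter> W"]) (auto simp: zr_space_def)
next
  fix U assume U: "openin (space_top ZS) U" "V \<in> U"
  have sub: "subring (\<Inter>U) F" using U Z_subring openin_subset_Z[OF U(1)] by (intro subring_Inter) auto
  have ne: "U \<noteq> {}" using U by blast
  show "(\<lambda>s. s) \<in> ring_hom (sections ZS U) (F\<lparr>carrier := V\<rparr>)"
    using U ne by (intro ring_hom_memI) (auto simp: sections_ZS)
  show "\<zero>\<^bsub>sections ZS U\<^esub> \<in> carrier (sections ZS U) \<and> \<zero>\<^bsub>sections ZS U\<^esub> = \<zero>\<^bsub>F\<lparr>carrier := V\<rparr>\<^esub>"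
    using subringE(2)[OF sub] by (simp add: sections_ZS ne)
  show "\<one>\<^bsub>sections ZS U\<^esub> \<in> carrier (sections ZS U)"
    using subringE(3)[OF sub] by (simp add: sections_ZS ne)
  fix s t assume "s \<in> carrier (sections ZS U)" "t \<in> carrier (sections ZS U)"
  then have "s \<in> \<Inter>U" "t \<in> \<Inter>U" using ne by (simp_all add: sections_ZS)
  from subringE(6)[OF sub this] subringE(7)[OF sub this]
  show "s \<otimes>\<^bsub>sections ZS U\<^esub> t \<in> carrier (sections ZS U) \<and>
      s \<oplus>\<^bsub>sections ZS U\<^esub> t \<in> carrier (sections ZS U)"
    using ne by (simp add: sections_ZS)
next
  fix l assume "l \<in> carrier (F\<lparr>carrier := V\<rparr>)"
  then have l: "l \<in> V" by simp
  let ?U = "{W \<in> Z. {l} \<subseteq> W}"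
  have "openin (space_top ZS) ?U" using openin_basic[of "{l}"] Z_carrier[OF V l] by simp
  moreover have "V \<in> ?U" using l V by simp
  moreover from this have "l \<in> carrier (sections ZS ?U)" by (subst sections_ZS) auto
  ultimately show "\<exists>U s. openin (space_top ZS) U \<and> V \<in> U \<and> s \<in> carrier (sections ZS U) \<and> s = l"
    by blast
qed

end

sublocale zr_setting \<subseteq> P: poly2_domain RA
  using subring_is_domain[OF A_subring] by (simp add: poly2_domain_def)

section \<open>The Picard group\<close>

locale field_subring = field F for F (structure) +
  fixes A assumes A: "subring A F"
begin

abbreviation "sm \<equiv> submodule_of_field F A"
abbreviation "Inv \<equiv> invertible_ideals F A"

lemma A_C: "a \<in> A \<Longrightarrow> a \<in> carrier F"
  using subringE(1)[OF A] by blast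

lemma smI:
  assumes "I \<subseteq> carrier F" "\<zero> \<in> I" "\<And>x y. x \<in> I \<Longrightarrow> y \<in> I \<Longrightarrow> x \<oplus> y \<in> I"
    "\<And>a x. a \<in> A \<Longrightarrow> x \<in> I \<Longrightarrow> a \<otimes> x \<in> I"
  shows "sm I"
proof -
  have neg: "\<ominus> x \<in> I" if "x \<in> I" for x
  proof -
    have "(\<ominus> \<one>) \<otimes> x \<in> I" using assms(4)[OF _ that] subringE(3,5)[OF A] by simp
    then show ?thesis using that assms(1) by (auto simp: l_minus)
  qed
  have "subgroup I (add_monoid F)"
  proof (rule group.subgroupI)
    show "inv\<^bsub>add_monoid F\<^esub> x \<in> I" if "x \<in> I" for x
      using neg[OF that] by (simp add: a_inv_def)
  qed (use assms a_group in auto)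
  then show ?thesis using assms(4) by (simp add: submodule_of_field_def)
qed

lemma smD:
  assumes "sm I"
  shows "I \<subseteq> carrier F" "\<zero> \<in> I" "\<And>x y. x \<in> I \<Longrightarrow> y \<in> I \<Longrightarrow> x \<oplus> y \<in> I"
    "\<And>a x. a \<in> A \<Longrightarrow> x \<in> I \<Longrightarrow> a \<otimes> x \<in> I"
  using assms subgroup.subset[of I "add_monoid F"] subgroup.one_closed[of I "add_monoid F"]
    subgroup.m_closed[of I "add_monoid F"]
  by (auto simp: submodule_of_field_def)

lemma ideal_prod_least:
  assumes "x \<in> ideal_prod F I J" "\<And>i j. i \<in> I \<Longrightarrow> j \<in> J \<Longrightarrow> i \<otimes> j \<in> W"
    "\<And>x y. x \<in> W \<Longrightarrow> y \<in> W \<Longrightarrow> x \<oplus> y \<in> W"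
  shows "x \<in> W"
  using assms(1) by induction (use assms(2,3) in auto)

lemma sm_A: "sm A"
  by (rule smI) (use A_C subringE[OF A] in auto)

lemma ideal_prod_carrier:
  "sm I \<Longrightarrow> sm J \<Longrightarrow> x \<in> ideal_prod F I J \<Longrightarrow> x \<in> carrier F"
  by (erule ideal_prod_least) (use smD(1) in \<open>auto simp: subset_iff\<close>)

lemma sm_ideal_prod:
  assumes I: "sm I" and J: "sm J"
  shows "sm (ideal_prod F I J)"
proof (rule smI)
  show "ideal_prod F I J \<subseteq> carrier F" using ideal_prod_carrier[OF I J] by blast
  show "\<zero> \<in> ideal_prod F I J"
    using ideal_prod.prod[OF smD(2)[OF I] smD(2)[OF J], of F] by simp
  show "x \<oplus> y \<in> ideal_prod F I J" if "x \<in> ideal_prod F I J" "y \<in> ideal_prod F I J" for x y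
    using that by (rule ideal_prod.sum)
  fix a x assume a: "a \<in> A" and x: "x \<in> ideal_prod F I J"
  show "a \<otimes> x \<in> ideal_prod F I J" using x
  proof induction
    case (prod i j)
    have "a \<otimes> (i \<otimes> j) = (a \<otimes> i) \<otimes> j"
      using A_C[OF a] prod(1,2) smD(1)[OF I] smD(1)[OF J] by (simp add: m_assoc subset_iff)
    then show ?case using ideal_prod.prod[OF smD(4)[OF I a prod(1)] prod(2), of F] by simp
  next
    case (sum s t)
    have "a \<otimes> (s \<oplus> t) = a \<otimes> s \<oplus> a \<otimes> t"
      using a sum ideal_prod_carrier[OF I J] A_C by (simp add: r_distr)
    then show ?case using ideal_prod.sum[OF sum.IH] by simp
  qed
qed

lemma ideal_prod_comm:
  assumes "sm I" "sm J"
  shows "ideal_prod F I J = ideal_prod F J I"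
proof -
  have "x \<in> ideal_prod F J I" if "sm I" "sm J" "x \<in> ideal_prod F I J" for I J x
    using that(3)
  proof (rule ideal_prod_least)
    fix i j assume ij: "i \<in> I" "j \<in> J"
    then have "i \<otimes> j = j \<otimes> i" using smD(1)[OF that(1)] smD(1)[OF that(2)] by (intro m_comm) auto
    then show "i \<otimes> j \<in> ideal_prod F J I" using ideal_prod.prod[OF ij(2,1), of F] by simp
  qed (rule ideal_prod.sum)
  then show ?thesis using assms by blast
qed

lemma ideal_prod_assoc_subset:
  assumes I: "sm I" and J: "sm J" and K: "sm K"
  shows "ideal_prod F (ideal_prod F I J) K \<subseteq> ideal_prod F I (ideal_prod F J K)"
proof
  fix x assume "x \<in> ideal_prod F (ideal_prod F I J) K"
  then show "x \<in> ideal_prod F I (ideal_prod F J K)"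
  proof (rule ideal_prod_least)
    fix y k assume y: "y \<in> ideal_prod F I J" and k: "k \<in> K"
    have kC: "k \<in> carrier F" using k smD(1)[OF K] by blast
    show "y \<otimes> k \<in> ideal_prod F I (ideal_prod F J K)" using y
    proof induction
      case (prod i j)
      have "i \<otimes> j \<otimes> k = i \<otimes> (j \<otimes> k)"
        using prod(1,2) smD(1)[OF I] smD(1)[OF J] kC by (simp add: m_assoc subset_iff)
      then show ?case using ideal_prod.prod[OF prod(1) ideal_prod.prod[OF prod(2) k, of F], of F] by simp
    next
      case (sum s t)
      have "(s \<oplus> t) \<otimes> k = s \<otimes> k \<oplus> t \<otimes> k"
        using sum ideal_prod_carrier[OF I J] kC by (simp add: l_distr)
      then show ?case using ideal_prod.sum[OF sum.IH] by simp
    qed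
  qed (rule ideal_prod.sum)
qed

text \<open>The reverse inclusion is \<open>ideal_prod_assoc_subset\<close> for \<open>K\<close>,
  \<open>J\<close>, \<open>I\<close>, read through commutativity.\<close>

lemma ideal_prod_assoc:
  assumes I: "sm I" and J: "sm J" and K: "sm K"
  shows "ideal_prod F (ideal_prod F I J) K = ideal_prod F I (ideal_prod F J K)"
proof
  show "ideal_prod F I (ideal_prod F J K) \<subseteq> ideal_prod F (ideal_prod F I J) K"
    using ideal_prod_assoc_subset[OF K J I] ideal_prod_comm sm_ideal_prod I J K by metis
qed (rule ideal_prod_assoc_subset[OF assms])

lemma ideal_prod_A: "sm I \<Longrightarrow> ideal_prod F A I = I"
proof
  assume I: "sm I"
  show "ideal_prod F A I \<subseteq> I" using ideal_prod_least smD(3,4)[OF I] by blast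
  show "I \<subseteq> ideal_prod F A I"
  proof
    fix x assume x: "x \<in> I"
    then show "x \<in> ideal_prod F A I"
      using ideal_prod.prod[OF subringE(3)[OF A] x, of F] smD(1)[OF I] by auto
  qed
qed

lemma Inv_carrier: "I \<in> carrier Inv \<longleftrightarrow> sm I \<and> (\<exists>J. sm J \<and> ideal_prod F I J = A)"
  by (simp add: invertible_ideals_def)

lemma Inv_mult: "I \<otimes>\<^bsub>Inv\<^esub> J = ideal_prod F I J" and Inv_one: "\<one>\<^bsub>Inv\<^esub> = A"
  by (simp_all add: invertible_ideals_def)

lemma Inv_inverse:
  assumes "sm I" "sm J" "ideal_prod F I J = A"
  shows "I \<in> carrier Inv" "J \<in> carrier Inv"
  using assms ideal_prod_comm[OF assms(1,2)] by (auto simp: Inv_carrier)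

lemma comm_group_Inv: "comm_group Inv"
proof (rule comm_groupI, unfold Inv_mult Inv_one)
  show "A \<in> carrier Inv" using sm_A ideal_prod_A by (auto simp: Inv_carrier)
  fix I assume I: "I \<in> carrier Inv"
  then have sI: "sm I" by (simp add: Inv_carrier)
  then show "ideal_prod F A I = I" by (rule ideal_prod_A)
  obtain J where J: "sm J" "ideal_prod F I J = A" using I by (auto simp: Inv_carrier)
  then show "\<exists>J\<in>carrier Inv. ideal_prod F J I = A"
    using Inv_inverse[OF sI] ideal_prod_comm[OF sI] by auto
  fix K assume "K \<in> carrier Inv"
  then obtain L where K: "sm K" and L: "sm L" "ideal_prod F K L = A" by (auto simp: Inv_carrier)
  show "ideal_prod F I K = ideal_prod F K I" by (rule ideal_prod_comm[OF sI K])
  have "ideal_prod F (ideal_prod F I K) (ideal_prod F L J) =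
      ideal_prod F I (ideal_prod F (ideal_prod F K L) J)"
    using ideal_prod_assoc[OF sI K sm_ideal_prod[OF L(1) J(1)]] ideal_prod_assoc[OF K L(1) J(1)]
    by simp
  also have "\<dots> = A" using J ideal_prod_A L by simp
  finally have inverse: "ideal_prod F (ideal_prod F I K) (ideal_prod F L J) = A" .
  show "ideal_prod F I K \<in> carrier Inv"
    by (rule Inv_inverse(1)[OF sm_ideal_prod[OF sI K] sm_ideal_prod[OF L(1) J(1)] inverse])
  fix M assume "M \<in> carrier Inv"
  then show "ideal_prod F (ideal_prod F I K) M = ideal_prod F I (ideal_prod F K M)"
    using ideal_prod_assoc[OF sI K] by (simp add: Inv_carrier)
qed

lemma principal_eq: "x <# A = {x \<otimes> a | a. a \<in> A}"
  by (auto simp: l_coset_def)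

lemma sm_principal:
  assumes x: "x \<in> carrier F"
  shows "sm (x <# A)"
proof (rule smI)
  show "x <# A \<subseteq> carrier F" using x A_C by (auto simp: principal_eq)
  show "\<zero> \<in> x <# A" using x subringE(2)[OF A] by (force simp: principal_eq)
  fix y z assume "y \<in> x <# A" "z \<in> x <# A"
  then obtain a b where "a \<in> A" "b \<in> A" "y = x \<otimes> a" "z = x \<otimes> b" by (auto simp: principal_eq)
  moreover from this have "y \<oplus> z = x \<otimes> (a \<oplus> b)" using x A_C by (simp add: r_distr)
  ultimately show "y \<oplus> z \<in> x <# A" using subringE(7)[OF A] by (auto simp: principal_eq)
next
  fix a y assume "a \<in> A" "y \<in> x <# A"
  then obtain b where "a \<in> A" "b \<in> A" "y = x \<otimes> b" by (auto simp: principal_eq)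
  moreover from this have "a \<otimes> y = x \<otimes> (a \<otimes> b)" using x A_C by (simp add: m_lcomm)
  ultimately show "a \<otimes> y \<in> x <# A" using subringE(6)[OF A] by (auto simp: principal_eq)
qed

lemma principal_mult:
  assumes x: "x \<in> carrier F" and y: "y \<in> carrier F"
  shows "ideal_prod F (x <# A) (y <# A) = (x \<otimes> y) <# A"
proof
  show "ideal_prod F (x <# A) (y <# A) \<subseteq> (x \<otimes> y) <# A"
  proof
    fix z assume "z \<in> ideal_prod F (x <# A) (y <# A)"
    then show "z \<in> (x \<otimes> y) <# A"
    proof (rule ideal_prod_least)
      fix i j assume "i \<in> x <# A" "j \<in> y <# A"
      then obtain a b where "a \<in> A" "b \<in> A" "i = x \<otimes> a" "j = y \<otimes> b" by (auto simp: principal_eq)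
      moreover from this have "i \<otimes> j = (x \<otimes> y) \<otimes> (a \<otimes> b)" using x y A_C by (simp add: m_ac)
      ultimately show "i \<otimes> j \<in> (x \<otimes> y) <# A" using subringE(6)[OF A] by (auto simp: principal_eq)
    qed (use smD(3)[OF sm_principal] x y in auto)
  qed
  show "(x \<otimes> y) <# A \<subseteq> ideal_prod F (x <# A) (y <# A)"
  proof
    fix z assume "z \<in> (x \<otimes> y) <# A"
    then obtain a where a: "a \<in> A" "z = (x \<otimes> y) \<otimes> a" by (auto simp: principal_eq)
    then have "z = (x \<otimes> \<one>) \<otimes> (y \<otimes> a)" using x y A_C by (simp add: m_assoc)
    moreover have "x \<otimes> \<one> \<in> x <# A" "y \<otimes> a \<in> y <# A"
      using a subringE(3)[OF A] by (auto simp: principal_eq)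
    ultimately show "z \<in> ideal_prod F (x <# A) (y <# A)"
      using ideal_prod.prod[of "x \<otimes> \<one>" _ "y \<otimes> a"] by metis
  qed
qed

lemma principal_one: "\<one> <# A = A"
proof -
  have "\<one> <# A = (\<lambda>a. \<one> \<otimes> a) ` A" by (auto simp: principal_eq)
  also have "\<dots> = id ` A" using A_C by (intro image_cong) auto
  finally show ?thesis by simp
qed

lemma subgroup_principal: "subgroup (principal_ideals F A) Inv"
proof (rule group.subgroupI)
  interpret G: comm_group Inv by (rule comm_group_Inv)
  show "group Inv" ..
  have inv: "ideal_prod F (inv x <# A) (x <# A) = A" if "x \<in> carrier F" "x \<noteq> \<zero>" for x
    using that inv_nonzero[OF that] by (simp add: principal_mult principal_one l_inv_nonzero)
  have mem: "x <# A \<in> carrier Inv" if "x \<in> carrier F" "x \<noteq> \<zero>" for x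
    using Inv_inverse(2)[OF sm_principal sm_principal inv[OF that]] that inv_nonzero by blast
  then show "principal_ideals F A \<subseteq> carrier Inv" by (auto simp: principal_ideals_def)
  show "principal_ideals F A \<noteq> {}" using one_not_zero by (auto simp: principal_ideals_def)
  fix I assume "I \<in> principal_ideals F A"
  then obtain x where x: "x \<in> carrier F" "x \<noteq> \<zero>" "I = x <# A" by (auto simp: principal_ideals_def)
  have "inv\<^bsub>Inv\<^esub> I = inv x <# A"
    by (rule G.inv_equality) (use x inv mem inv_nonzero in \<open>auto simp: Inv_mult Inv_one\<close>)
  then show "inv\<^bsub>Inv\<^esub> I \<in> principal_ideals F A"
    using inv_nonzero[OF x(1,2)] by (auto simp: principal_ideals_def)
  fix J assume "J \<in> principal_ideals F A"
  then obtain y where y: "y \<in> carrier F" "y \<noteq> \<zero>" "J = y <# A" by (auto simp: principal_ideals_def)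
  then show "I \<otimes>\<^bsub>Inv\<^esub> J \<in> principal_ideals F A"
    using x principal_mult[OF x(1) y(1)] integral_iff
    by (auto simp: principal_ideals_def Inv_mult intro!: exI[of _ "x \<otimes> y"])
qed

text \<open>The power of a coset is the coset of the power, and a coset is trivial exactly when its
  representative is principal.\<close>

lemma torsion_picard_iff:
  "torsion_group (picard_group F A) \<longleftrightarrow>
    (\<forall>I\<in>carrier Inv. \<exists>n::nat. 0 < n \<and> (\<exists>x\<in>carrier F - {\<zero>}. I [^]\<^bsub>Inv\<^esub> n = x <# A))"
proof -
  interpret G: comm_group Inv by (rule comm_group_Inv)
  let ?H = "principal_ideals F A"
  interpret H: normal ?H Inv by (rule G.subgroup_imp_normal[OF subgroup_principal])
  interpret Q: group "Inv Mod ?H" by (rule H.factorgroup_is_group)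
  interpret h: group_hom Inv "Inv Mod ?H" "\<lambda>a. ?H #>\<^bsub>Inv\<^esub> a"
    by unfold_locales (rule H.r_coset_hom_Mod)
  have pow: "(?H #>\<^bsub>Inv\<^esub> I) [^]\<^bsub>Inv Mod ?H\<^esub> n = ?H #>\<^bsub>Inv\<^esub> (I [^]\<^bsub>Inv\<^esub> n)"
    if "I \<in> carrier Inv" for I and n :: nat
    using that by (induction n) simp_all
  have trivial: "(?H #>\<^bsub>Inv\<^esub> I) [^]\<^bsub>Inv Mod ?H\<^esub> n = \<one>\<^bsub>Inv Mod ?H\<^esub> \<longleftrightarrow> I [^]\<^bsub>Inv\<^esub> n \<in> ?H"
    if "I \<in> carrier Inv" for I and n :: nat
    unfolding pow[OF that] one_FactGroup
    using G.coset_join1[OF _ G.nat_pow_closed[OF that] subgroup_principal]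
      G.coset_join2[OF G.nat_pow_closed[OF that] subgroup_principal] by blast
  have "J \<in> ?H \<longleftrightarrow> (\<exists>x\<in>carrier F - {\<zero>}. J = x <# A)" for J
    by (auto simp: principal_ideals_def)
  then show ?thesis
    by (simp add: torsion_group_def picard_group_def carrier_FactGroup trivial del: one_FactGroup)
qed

lemma prod_in_Inv_power:
  assumes I: "I \<in> carrier Inv" and x: "x \<in> I [^]\<^bsub>Inv\<^esub> (m::nat)" and y: "y \<in> I [^]\<^bsub>Inv\<^esub> (n::nat)"
  shows "x \<otimes> y \<in> I [^]\<^bsub>Inv\<^esub> (m + n)"
proof -
  interpret G: comm_group Inv by (rule comm_group_Inv)
  show ?thesis
    using ideal_prod.prod[OF x y, of F] G.nat_pow_mult[OF I, of m n] by (simp add: Inv_mult)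
qed

lemma sm_Inv_power: "I \<in> carrier Inv \<Longrightarrow> sm (I [^]\<^bsub>Inv\<^esub> (n::nat))"
proof -
  interpret G: comm_group Inv by (rule comm_group_Inv)
  assume "I \<in> carrier Inv"
  then show ?thesis using G.nat_pow_closed Inv_carrier by blast
qed

lemma pow_in_Inv_power:
  assumes I: "I \<in> carrier Inv" and x: "x \<in> I [^]\<^bsub>Inv\<^esub> (m::nat)"
  shows "x [^] (n::nat) \<in> I [^]\<^bsub>Inv\<^esub> (m * n)"
proof (induction n)
  case 0
  then show ?case using subringE(3)[OF A] by (simp add: Inv_one)
next
  case (Suc n)
  then show ?case using prod_in_Inv_power[OF I Suc x] by (simp add: add.commute)
qed

end

section \<open>The morphism to the projective line given by an element of the field\<close>

locale zr_point = zr_setting +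
  fixes u assumes u: "u \<in> carrier F"
begin

interpretation FX: UP_domain F "UP F"
  by unfold_locales simp

text \<open>Dehomogenization at the coordinates \<open>(1, u)\<close>. The value of a single form
  depends on this choice of coordinates for the point; quotients of forms of equal degree do
  not.\<close>

definition ev :: "'a poly2 \<Rightarrow> 'a" where
  "ev = P.poly2_eval F (\<lambda>a. a) \<one> u"

text \<open>The substitution \<open>T\<^sub>0 \<mapsto> X\<close>, \<open>T\<^sub>1 \<mapsto> u X\<close>, which separates the homogeneous components.\<close>
definition gev :: "'a poly2 \<Rightarrow> nat \<Rightarrow> 'a" where
  "gev = P.poly2_eval (UP F) (\<lambda>a. monom (UP F) a 0) (monom (UP F) \<one> 1) (monom (UP F) u 1)"

lemma ev_hom: "ev \<in> ring_hom P.S F"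
  unfolding ev_def using u A_carrier
  by (intro P.poly2_eval_hom) (auto intro!: ring_hom_memI simp: is_cring)

lemma gev_hom: "gev \<in> ring_hom P.S (UP F)"
  unfolding gev_def using u A_carrier
  by (intro P.poly2_eval_hom) (auto intro!: ring_hom_memI simp: FX.UP_cring FX.monom_mult[symmetric] simp del: FX.monom_mult)

lemma ev_mono: "c \<in> A \<Longrightarrow> ev (P.mono c i j) = c \<otimes> u [^] j"
  unfolding ev_def using u A_carrier
  by (subst P.poly2_eval_mono) (auto intro!: ring_hom_memI simp: is_cring)

lemma gev_mono:
  assumes c: "c \<in> A"
  shows "gev (P.mono c i j) = monom (UP F) (c \<otimes> u [^] j) (i + j)"
proof -
  have "gev (P.mono c i j) = monom (UP F) c 0 \<otimes>\<^bsub>UP F\<^esub> monom (UP F) u 1 [^]\<^bsub>UP F\<^esub> j \<otimes>\<^bsub>UP F\<^esub>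
      monom (UP F) \<one> 1 [^]\<^bsub>UP F\<^esub> i"
    unfolding gev_def using u A_carrier c
    by (intro P.poly2_eval_mono) (auto intro!: ring_hom_memI simp: FX.UP_cring FX.monom_mult[symmetric] simp del: FX.monom_mult)
  then show ?thesis using u A_carrier[OF c] by (simp add: FX.monom_pow FX.monom_mult[symmetric] add.commute del: FX.monom_mult)
qed

sublocale ev: ring_hom_cring P.S F ev
  by unfold_locales (rule ev_hom)

interpretation gev: ring_hom_cring P.S "UP F" gev
  by unfold_locales (rule gev_hom)

lemma gev_homogeneous: "f \<in> P.gr d \<Longrightarrow> gev f = monom (UP F) (ev f) d"
proof (erule P.homogeneous_induct)
  show "gev \<zero>\<^bsub>P.S\<^esub> = monom (UP F) (ev \<zero>\<^bsub>P.S\<^esub>) d" by simp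
  show "gev (x \<oplus>\<^bsub>P.S\<^esub> y) = monom (UP F) (ev (x \<oplus>\<^bsub>P.S\<^esub> y)) d"
    if "x \<in> P.gr d" "y \<in> P.gr d" "gev x = monom (UP F) (ev x) d" "gev y = monom (UP F) (ev y) d" for x y
    using that P.gr_carrier by simp
  show "gev (P.mono c i j) = monom (UP F) (ev (P.mono c i j)) d" if "c \<in> carrier RA" "i + j = d" for c i j
    using that by (simp add: ev_mono gev_mono)
qed

text \<open>Dividing the coordinates \<open>1\<close> and \<open>u\<close> by it brings both into
  \<open>V\<close> and turns one of them into \<open>1\<close>.\<close>

definition scale :: "'a set \<Rightarrow> 'a" where
  "scale V = (if u \<in> V then \<one> else u)"

text \<open>Coefficients with respect to a generator \<open>scale V\<close> of the \<open>V\<close>-module spanned by \<open>1\<close> and \<open>u\<close>.\<close>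
definition nc :: "'a set \<Rightarrow> 'a poly2 \<Rightarrow> nat \<Rightarrow> 'a" where
  "nc V p k = coeff (UP F) (gev p) k \<otimes> inv (scale V) [^] k"

text \<open>The kernel of the map to polynomials in \<open>X\<close> over the residue field of
  \<open>V\<close> given by \<open>T\<^sub>0 \<mapsto> X / scale V\<close> and
  \<open>T\<^sub>1 \<mapsto> u X / scale V\<close>. The variable \<open>X\<close> records the
  degree, so that inhomogeneous polynomials are tested component by component.\<close>

definition point :: "'a set \<Rightarrow> 'a poly2 set" where
  "point V = {p \<in> carrier P.S. \<forall>k. nc V p k \<in> val_max F V}"

context
  fixes V assumes V: "V \<in> Z"
begin

lemma scale_props: "scale V \<in> carrier F" "scale V \<noteq> \<zero>" "inv (scale V) \<in> V"
    "inv (scale V) \<in> carrier F" "u \<otimes> inv (scale V) \<in> V" "inv (scale V) = \<one> \<or> u \<otimes> inv (scale V) = \<one>"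
proof -
  note sub = Z_subring[OF V]
  have nz: "u \<noteq> \<zero>" if "u \<notin> V" using that subringE(2)[OF sub] by blast
  show s: "scale V \<in> carrier F" "scale V \<noteq> \<zero>" using u nz by (auto simp: scale_def)
  show "inv (scale V) \<in> V"
    using Z_valuation[OF V] u nz subringE(3)[OF sub] by (auto simp: scale_def valuation_ring_def)
  show "inv (scale V) \<in> carrier F" using s inv_nonzero by blast
  show "u \<otimes> inv (scale V) \<in> V" "inv (scale V) = \<one> \<or> u \<otimes> inv (scale V) = \<one>"
    using u nz subringE(3)[OF sub] by (auto simp: scale_def r_inv_nonzero)
qed

lemma nc_carrier [simp]: "p \<in> carrier P.S \<Longrightarrow> nc V p k \<in> carrier F"
  using scale_props(4) by (simp add: nc_def)

lemma nc_add: "p \<in> carrier P.S \<Longrightarrow> q \<in> carrier P.S \<Longrightarrow> nc V (p \<oplus>\<^bsub>P.S\<^esub> q) k = nc V p k \<oplus> nc V q k"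
  using scale_props(4) by (simp add: nc_def l_distr)

lemma nc_mult:
  assumes p: "p \<in> carrier P.S" and q: "q \<in> carrier P.S"
  shows "nc V (p \<otimes>\<^bsub>P.S\<^esub> q) k = (\<Oplus>i\<in>{..k}. nc V p i \<otimes> nc V q (k - i))"
proof -
  let ?w = "inv (scale V)"
  note w = scale_props(4)
  have "nc V (p \<otimes>\<^bsub>P.S\<^esub> q) k =
      (\<Oplus>i\<in>{..k}. coeff (UP F) (gev p) i \<otimes> coeff (UP F) (gev q) (k - i)) \<otimes> ?w [^] k"
    using p q by (simp add: nc_def)
  also have "\<dots> = (\<Oplus>i\<in>{..k}. coeff (UP F) (gev p) i \<otimes> coeff (UP F) (gev q) (k - i) \<otimes> ?w [^] k)"
    using p q w by (intro finsum_ldistr) auto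
  also have "\<dots> = (\<Oplus>i\<in>{..k}. nc V p i \<otimes> nc V q (k - i))"
  proof (rule finsum_cong')
    fix i assume "i \<in> {..k}"
    then have "?w [^] k = ?w [^] i \<otimes> ?w [^] (k - i)" using w by (simp add: nat_pow_mult)
    then show "coeff (UP F) (gev p) i \<otimes> coeff (UP F) (gev q) (k - i) \<otimes> ?w [^] k =
        nc V p i \<otimes> nc V q (k - i)"
      using p q w by (simp add: nc_def m_ac)
  qed (use p q in auto)
  finally show ?thesis .
qed

lemma nc_homogeneous:
  assumes "f \<in> P.gr d"
  shows "nc V f k = (if k = d then ev f \<otimes> inv (scale V) [^] d else \<zero>)"
  using scale_props(4) assms P.gr_carrier[OF assms] by (simp add: nc_def gev_homogeneous)

lemma nc_mono:
  assumes c: "c \<in> A"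
  shows "nc V (P.mono c i j) k =
    (if k = i + j then c \<otimes> inv (scale V) [^] i \<otimes> (u \<otimes> inv (scale V)) [^] j else \<zero>)"
proof -
  have cC: "c \<in> carrier F" using A_carrier[OF c] .
  have "ev (P.mono c i j) \<otimes> inv (scale V) [^] (i + j) =
      c \<otimes> inv (scale V) [^] i \<otimes> (u \<otimes> inv (scale V)) [^] j"
    using c cC u scale_props(4) by (simp add: ev_mono nat_pow_mult[symmetric] nat_pow_distrib m_ac)
  then show ?thesis using nc_homogeneous[OF P.homogeneous_mono[of c i j], of k] c by simp
qed

lemma nc_in_V:
  assumes p: "p \<in> carrier P.S"
  shows "nc V p k \<in> V"
proof -
  note sub = Z_subring[OF V]
  show ?thesis
  proof (rule P.poly2_induct[OF p, where Q="\<lambda>p. nc V p k \<in> V"])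
    show "nc V \<zero>\<^bsub>P.S\<^esub> k \<in> V"
      using subringE(2)[OF sub] nc_homogeneous[OF P.gr_zero, of k 0] scale_props(4) by simp
    show "nc V (x \<oplus>\<^bsub>P.S\<^esub> y) k \<in> V"
      if "x \<in> carrier P.S" "y \<in> carrier P.S" "nc V x k \<in> V" "nc V y k \<in> V" for x y
      using that nc_add subringE(7)[OF sub] by simp
    fix i j
    have c: "P.cf p i j \<in> A" using P.cf_closed[OF p] by simp
    then show "nc V (P.mono (P.cf p i j) i j) k \<in> V"
      using subringE(2,6)[OF sub] subring_pow[OF sub] scale_props(3,5) A_subset[OF V]
      by (auto simp: nc_mono)
  qed
qed

lemma val_max_zero: "\<zero> \<in> val_max F V"
  using subringE(2)[OF Z_subring[OF V]] by (simp add: val_max_def)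

lemma val_max_finsum:
  assumes "finite I" "\<And>i. i \<in> I \<Longrightarrow> f i \<in> val_max F V"
  shows "(\<Oplus>i\<in>I. f i) \<in> val_max F V"
proof (rule finsum_induct[OF assms(1), where Q="\<lambda>x. x \<in> val_max F V"])
  show "f i \<in> carrier F" if "i \<in> I" for i
    using assms(2)[OF that] Z_carrier[OF V] by (simp add: val_max_def)
qed (use assms(2) val_max_zero val_max_add[OF Z_valuation[OF V]] in auto)

lemma homogeneous_in_point_iff:
  assumes "f \<in> P.gr d"
  shows "f \<in> point V \<longleftrightarrow> ev f \<otimes> inv (scale V) [^] d \<in> val_max F V"
  using nc_homogeneous[OF assms] P.gr_carrier[OF assms] val_max_zero
  by (auto simp: point_def)

lemma pointD: "p \<in> point V \<Longrightarrow> p \<in> carrier P.S" "p \<in> point V \<Longrightarrow> nc V p k \<in> val_max F V"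
  by (simp_all add: point_def)

lemma point_prime: "primeideal (point V) P.S"
proof (rule primeidealI)
  note val = Z_valuation[OF V]
  have sub: "point V \<subseteq> carrier P.S" by (auto simp: point_def)
  have mult: "p \<otimes>\<^bsub>P.S\<^esub> q \<in> point V" if p: "p \<in> carrier P.S" and q: "q \<in> point V" for p q
  proof -
    have "nc V (p \<otimes>\<^bsub>P.S\<^esub> q) k \<in> val_max F V" for k
      using p q val_max_mult[OF val nc_in_V[OF p]] by (auto simp: nc_mult point_def intro!: val_max_finsum)
    then show ?thesis using p q sub by (auto simp: point_def)
  qed
  show "ideal (point V) P.S"
  proof (rule P.S.P.idealI_cring)
    show "point V \<subseteq> carrier P.S" by (rule sub)
    show "\<zero>\<^bsub>P.S\<^esub> \<in> point V"
      using homogeneous_in_point_iff[OF P.gr_zero, of 0] val_max_zero by simp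
    show "p \<oplus>\<^bsub>P.S\<^esub> q \<in> point V" if p: "p \<in> point V" and q: "q \<in> point V" for p q
    proof -
      have "nc V (p \<oplus>\<^bsub>P.S\<^esub> q) k \<in> val_max F V" for k
        using p q val_max_add[OF val] by (simp add: nc_add point_def)
      then show ?thesis using p q by (simp add: point_def)
    qed
  qed (rule mult)
  show "cring P.S" by (rule P.S.P.is_cring)
  have "\<one> \<notin> val_max F V" using subringE(3)[OF Z_subring[OF V]] by (simp add: val_max_def)
  then have "\<one>\<^bsub>P.S\<^esub> \<notin> point V" using homogeneous_in_point_iff[OF P.gr_one] by simp
  then show "carrier P.S \<noteq> point V" by blast
  fix p q assume p: "p \<in> carrier P.S" and q: "q \<in> carrier P.S" and pq: "p \<otimes>\<^bsub>P.S\<^esub> q \<in> point V"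
  show "p \<in> point V \<or> q \<in> point V"
  proof (rule ccontr)
    assume "\<not> ?thesis"
    then have ex: "\<exists>k. nc V p k \<notin> val_max F V" "\<exists>k. nc V q k \<notin> val_max F V"
      using p q by (auto simp: point_def)
    \<comment> \<open>Gauss's argument: in the coefficient of the product at \<open>d + e\<close>,
      every term except that with index \<open>d\<close> has a factor below one of the two least
      degrees, hence in the maximal ideal.\<close>
    define d where "d = (LEAST k. nc V p k \<notin> val_max F V)"
    define e where "e = (LEAST k. nc V q k \<notin> val_max F V)"
    have d: "nc V p d \<notin> val_max F V" "\<And>k. k < d \<Longrightarrow> nc V p k \<in> val_max F V"
      using LeastI_ex[OF ex(1)] not_less_Least by (auto simp: d_def)
    have e: "nc V q e \<notin> val_max F V" "\<And>k. k < e \<Longrightarrow> nc V q k \<in> val_max F V"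
      using LeastI_ex[OF ex(2)] not_less_Least by (auto simp: e_def)
    let ?f = "\<lambda>i. nc V p i \<otimes> nc V q (d + e - i)"
    let ?r = "\<Oplus>i\<in>{..d + e} - {d}. ?f i"
    have f: "?f i \<in> carrier F" for i using p q by simp
    have r: "?r \<in> val_max F V"
    proof (rule val_max_finsum)
      fix i assume i: "i \<in> {..d + e} - {d}"
      show "?f i \<in> val_max F V"
      proof (cases "i < d")
        case True
        then have "nc V q (d + e - i) \<otimes> nc V p i \<in> val_max F V"
          using val_max_mult[OF val nc_in_V[OF q]] d(2) by blast
        then show ?thesis using p q by (simp add: m_comm)
      next
        case False
        then have "d + e - i < e" using i by auto
        then show ?thesis using val_max_mult[OF val nc_in_V[OF p]] e(2) by blast
      qed
    qed simp
    have rC: "?r \<in> carrier F" using f by simp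
    have "nc V (p \<otimes>\<^bsub>P.S\<^esub> q) (d + e) = (\<Oplus>i\<in>insert d ({..d + e} - {d}). ?f i)"
      using p q by (simp add: nc_mult insert_absorb)
    also have "\<dots> = ?f d \<oplus> ?r" using p q by (subst finsum_insert) auto
    finally have "?f d = nc V (p \<otimes>\<^bsub>P.S\<^esub> q) (d + e) \<oplus> (\<ominus> \<one>) \<otimes> ?r"
      using p q rC by (simp add: l_minus a_assoc r_neg)
    moreover have "(\<ominus> \<one>) \<otimes> ?r \<in> val_max F V"
      using val_max_mult[OF val _ r] subringE(3,5)[OF Z_subring[OF V]] by simp
    ultimately have "?f d \<in> val_max F V"
      using val_max_add[OF val] pq by (simp add: point_def)
    then show False
      using val_max_prime[OF val nc_in_V[OF p] nc_in_V[OF q], of d e] d(1) e(1) by simp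
  qed
qed

lemma point_proj: "point V \<in> proj_points P.S P.gr"
proof -
  interpret pt: primeideal "point V" P.S by (rule point_prime)
  let ?H = "point V \<inter> (\<Union>d. P.gr d)"
  have HS: "?H \<subseteq> carrier P.S" using pt.a_subset by blast
  interpret I: ideal "Idl\<^bsub>P.S\<^esub> ?H" P.S by (rule P.S.P.genideal_ideal[OF HS])
  have "p \<in> Idl\<^bsub>P.S\<^esub> ?H" if p: "p \<in> point V" for p
  proof -
    have pS: "p \<in> carrier P.S" by (rule pointD(1)[OF p])
    obtain c N where c: "\<And>d. c d \<in> P.gr d" and pc: "p = (\<Oplus>\<^bsub>P.S\<^esub>d\<in>{..N::nat}. c d)"
      by (rule P.homogeneous_decomposition[OF pS]) blast
    have cS: "c \<in> {..N} \<rightarrow> carrier P.S" using P.gr_carrier[OF c] by blast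
    have "c k \<in> ?H" if k: "k \<le> N" for k
    proof -
      \<comment> \<open>\<open>gev\<close> sends the component of degree \<open>d\<close> to a
        monomial of degree \<open>d\<close> in \<open>X\<close>, so the coefficient at
        \<open>k\<close> sees only \<open>c k\<close>.\<close>
      have "coeff (UP F) (gev p) k = (\<Oplus>d\<in>{..N}. coeff (UP F) (gev (c d)) k)"
        unfolding pc using cS by (subst gev.hom_finsum) (auto simp: FX.coeff_finsum Pi_def o_def)
      also have "\<dots> = (\<Oplus>d\<in>{..N}. if k = d then ev (c d) else \<zero>)"
        using P.gr_carrier[OF c] by (intro finsum_cong') (auto simp: gev_homogeneous[OF c])
      also have "\<dots> = ev (c k)"
        using finsum_singleton[of k "{..N}" "\<lambda>d. ev (c d)"] k P.gr_carrier[OF c] by simp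
      finally have "ev (c k) \<otimes> inv (scale V) [^] k = nc V p k" by (simp add: nc_def)
      then have "c k \<in> point V"
        unfolding homogeneous_in_point_iff[OF c[of k]] using pointD(2)[OF p, of k] by argo
      then show ?thesis using c by blast
    qed
    then have "\<And>k. k \<in> {..N} \<Longrightarrow> c k \<in> Idl\<^bsub>P.S\<^esub> ?H" using P.S.P.genideal_self[OF HS] by blast
    then show ?thesis unfolding pc
      by (intro P.S.P.finsum_induct[where Q="\<lambda>x. x \<in> Idl\<^bsub>P.S\<^esub> ?H"])
        (use cS I.zero_closed I.a_closed in blast)+
  qed
  then have "point V = Idl\<^bsub>P.S\<^esub> ?H"
    using P.S.P.genideal_minimal[OF pt.ideal_axioms, of ?H] by blast
  moreover have "\<not> (\<Union>d\<in>{0<..}. P.gr d) \<subseteq> point V"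
  proof -
    have o: "\<one> \<notin> val_max F V" using subringE(3)[OF Z_subring[OF V]] by (simp add: val_max_def)
    have "ev P.T0 = \<one>" "ev P.T1 = u"
      using ev_mono[of \<one> 1 0] ev_mono[of \<one> 0 1] subringE(3)[OF A_subring] u by simp_all
    \<comment> \<open>One of the two scaled coordinates equals \<open>\<one>\<close>, so the
      corresponding variable is outside the prime.\<close>
    then have "P.T0 \<notin> point V \<or> P.T1 \<notin> point V"
      using homogeneous_in_point_iff[OF P.T_homogeneous(1)] homogeneous_in_point_iff[OF P.T_homogeneous(2)]
        scale_props(4,6) o by auto
    then show ?thesis using P.T_homogeneous by auto
  qed
  ultimately show ?thesis
    using point_prime pt.ideal_axioms by (simp add: proj_points_def homogeneous_ideal_def)
qed

end

lemma continuous_point: "continuous_map (space_top ZS) (proj_top P.S P.gr) point"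
  unfolding proj_top_def continuous_map_in_subtopology
proof
  show "point \<in> topspace (space_top ZS) \<rightarrow> proj_points P.S P.gr"
    using point_proj by (auto simp: topspace_ZS)
  have op: "openin (space_top ZS) (point -` {Q. primeideal Q P.S \<and> f \<notin> Q} \<inter> topspace (space_top ZS))"
    if f: "f \<in> carrier P.S" for f
  proof (subst openin_subopen, intro ballI)
    fix V assume "V \<in> point -` {Q. primeideal Q P.S \<and> f \<notin> Q} \<inter> topspace (space_top ZS)"
    then have V: "V \<in> Z" "f \<notin> point V" by (auto simp: topspace_ZS)
    then obtain k where k: "nc V f k \<notin> val_max F V" using f by (auto simp: point_def)
    let ?x = "coeff (UP F) (gev f) k"
    have xC: "?x \<in> carrier F" using f by simp
    have y: "nc V f k \<noteq> \<zero>" "inv (nc V f k) \<in> V" "nc V f k \<in> carrier F"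
      using val_maxD[OF Z_valuation[OF V(1)] nc_in_V[OF V(1) f] k] nc_carrier[OF V(1) f] by auto
    \<comment> \<open>Two conditions keep \<open>f\<close> out of the prime on a neighbourhood: the
      first keeps the scaling used at \<open>V\<close> valid, the second keeps the chosen
      coefficient of \<open>f\<close> from becoming a nonunit.\<close>
    define T where "T = {if u \<in> V then u else inv u, inv (nc V f k)}"
    have T: "finite T" "T \<subseteq> V"
      using V y(2) Z_valuation[OF V(1)] u subringE(2)[OF Z_subring[OF V(1)]]
      by (auto simp: T_def valuation_ring_def)
    have "f \<notin> point W" if W: "W \<in> Z" "T \<subseteq> W" for W
    proof -
      note sub = Z_subring[OF W(1)]
      have iy: "inv (nc V f k) \<in> W" using W by (simp add: T_def)
      have "inv (nc W f k) \<in> W \<and> nc W f k \<noteq> \<zero>"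
      proof (cases "scale W = scale V")
        case True
        then show ?thesis using iy y(1) by (simp add: nc_def)
      next
        case False
        \<comment> \<open>The scaling can change only in this direction. Then \<open>W\<close>
          contains \<open>u\<close> and its inverse, so the two scaled coefficients differ by a unit
          of \<open>W\<close>.\<close>
        then have W': "u \<in> W" "u \<notin> V" using W(2) by (auto simp: scale_def T_def split: if_splits)
        then have nz: "u \<noteq> \<zero>" using subringE(2)[OF Z_subring[OF V(1)]] by blast
        have iu: "inv u \<in> W" "inv u \<in> carrier F" "inv u \<noteq> \<zero>"
          using W' W(2) inv_nonzero[OF u nz] by (auto simp: T_def)
        have nV: "nc V f k = ?x \<otimes> inv u [^] k" using W' by (simp add: nc_def scale_def)
        have nW: "nc W f k = ?x" using W' xC by (simp add: nc_def scale_def)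
        have x0: "?x \<noteq> \<zero>" using y(1) nV iu(2) by auto
        have pk: "inv u [^] k \<in> carrier F" "inv u [^] k \<noteq> \<zero>" using pow_nonzero[OF iu(2,3)] iu by auto
        have "inv ?x = inv u [^] k \<otimes> (inv (inv u [^] k) \<otimes> inv ?x)"
          using mult_inv_cancel[OF pk] inv_nonzero[OF xC x0] by simp
        also have "\<dots> = inv u [^] k \<otimes> inv (nc V f k)"
          unfolding nV using inv_mult_nonzero[OF pk xC x0] xC pk by (simp add: m_comm)
        finally have "inv ?x \<in> W" using subringE(6)[OF sub subring_pow[OF sub iu(1)] iy] by simp
        then show ?thesis using x0 nW by simp
      qed
      then show ?thesis by (auto simp: point_def val_max_def)
    qed
    moreover have "openin (space_top ZS) {W \<in> Z. T \<subseteq> W}"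
      using openin_basic[OF T(1)] T(2) Z_carrier[OF V(1)] by blast
    ultimately show "\<exists>U. openin (space_top ZS) U \<and> V \<in> U \<and>
        U \<subseteq> point -` {Q. primeideal Q P.S \<and> f \<notin> Q} \<inter> topspace (space_top ZS)"
      using T V point_prime by (intro exI[of _ "{W \<in> Z. T \<subseteq> W}"]) (auto simp: topspace_ZS)
  qed
  show "continuous_map (space_top ZS) (spec_top P.S) point"
    unfolding spec_top_def
  proof (rule continuous_on_generated_topo)
    have "\<Union>{{Q. primeideal Q P.S \<and> f \<notin> Q} | f. f \<in> carrier P.S} = {Q. primeideal Q P.S}"
      using P.S.P.topspace_spec by (simp add: spec_top_def)
    then show "point ` topspace (space_top ZS) \<subseteq>
        \<Union>{{Q. primeideal Q P.S \<and> f \<notin> Q} | f. f \<in> carrier P.S}"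
      using point_prime by (auto simp: topspace_ZS)
  qed (use op in auto)
qed

end

section \<open>The action of the morphism on sections and stalks\<close>

lemma P1_simps:
  "space_top (P1 R) = proj_top (poly2_ring R) (poly2_homogeneous R)"
  "sections (P1 R) = proj_sections (poly2_ring R) (poly2_homogeneous R)"
  "restr (P1 R) U W s = restrict s W"
  by (simp_all add: P1_def Proj_def)

lemma (in zr_setting) val_max_F: "val_max F (carrier F) = {\<zero>}"
  using inv_nonzero by (auto simp: val_max_def)

context zr_point
begin

text \<open>Multiplying numerator and denominator by the power \<open>d\<close> of
  \<open>inv (scale V)\<close> turns the denominator into a unit of \<open>V\<close> and moves the
  numerator into \<open>V\<close>, or into its maximal ideal if \<open>a\<close> vanishes at the
  point.\<close>

lemma ev_divide:
  assumes V: "V \<in> Z" and h: "P.hfrac (point V) d a f"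
  shows "ev f \<noteq> \<zero>" "ev a \<otimes> inv (ev f) \<in> V" "a \<in> point V \<Longrightarrow> ev a \<otimes> inv (ev f) \<in> val_max F V"
proof -
  let ?w = "inv (scale V) [^] d"
  note sub = Z_subring[OF V] and val = Z_valuation[OF V]
  have a: "a \<in> P.gr d" and f: "f \<in> P.gr d" "f \<notin> point V" using h by (auto simp: P.hfrac_def)
  have C: "ev a \<in> carrier F" "ev f \<in> carrier F" "?w \<in> carrier F" "inv (scale V) \<noteq> \<zero>"
    using P.gr_carrier[OF a] P.gr_carrier[OF f(1)] scale_props(1,2,4)[OF V] inv_nonzero by auto
  have w0: "?w \<noteq> \<zero>" using pow_nonzero[OF scale_props(4)[OF V] C(4)] .
  have aV: "ev a \<otimes> ?w \<in> V"
    using nc_in_V[OF V P.gr_carrier[OF a], of d] nc_homogeneous[OF V a, of d] by simp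
  have fV: "ev f \<otimes> ?w \<in> V"
    using nc_in_V[OF V P.gr_carrier[OF f(1)], of d] nc_homogeneous[OF V f(1), of d] by simp
  have fm: "ev f \<otimes> ?w \<notin> val_max F V" using f homogeneous_in_point_iff[OF V f(1)] by simp
  have unit: "ev f \<otimes> ?w \<noteq> \<zero>" "inv (ev f \<otimes> ?w) \<in> V" using val_maxD[OF val fV fm] by auto
  show f0: "ev f \<noteq> \<zero>" using unit(1) C by auto
  have eq: "ev a \<otimes> inv (ev f) = inv (ev f \<otimes> ?w) \<otimes> (ev a \<otimes> ?w)"
  proof -
    have "ev a \<otimes> inv (ev f) = (ev a \<otimes> ?w) \<otimes> inv (ev f \<otimes> ?w)"
      using C w0 f0 unit(1) by (subst divide_eq_iff) (auto simp: m_ac)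
    then show ?thesis using C unit(1) inv_nonzero[of "ev f \<otimes> ?w"] by (simp add: m_comm)
  qed
  show "ev a \<otimes> inv (ev f) \<in> V" unfolding eq using subringE(6)[OF sub unit(2) aV] .
  show "ev a \<otimes> inv (ev f) \<in> val_max F V" if "a \<in> point V"
    unfolding eq using val_max_mult[OF val unit(2)] homogeneous_in_point_iff[OF V a] that by simp
qed

text \<open>The future map on stalks at \<open>V\<close>. Independence of the fraction is proved in
  \<open>val_ratio\<close>.\<close>

definition val :: "'a set \<Rightarrow> ('a poly2 \<times> 'a poly2) set \<Rightarrow> 'a" where
  "val V l = (THE x. \<exists>d a f. P.hfrac (point V) d a f \<and> l = P.ratio (point V) a f \<and>
    x = ev a \<otimes> inv (ev f))"

lemma val_ratio:
  assumes V: "V \<in> Z" and h: "P.hfrac (point V) d a f"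
  shows "val V (P.ratio (point V) a f) = ev a \<otimes> inv (ev f)"
  unfolding val_def
proof (rule the_equality)
  fix x assume "\<exists>e b g. P.hfrac (point V) e b g \<and> P.ratio (point V) a f = P.ratio (point V) b g \<and>
    x = ev b \<otimes> inv (ev g)"
  then obtain e b g where b: "P.hfrac (point V) e b g" "P.ratio (point V) a f = P.ratio (point V) b g"
    "x = ev b \<otimes> inv (ev g)" by blast
  note C = P.hfracD[OF h] P.hfracD[OF b(1)]
  have "g \<otimes>\<^bsub>P.S\<^esub> a = f \<otimes>\<^bsub>P.S\<^esub> b"
    using b(2) P.frac_eq_iff[OF point_prime[OF V] h b(1)] by simp
  then have "ev (g \<otimes>\<^bsub>P.S\<^esub> a) = ev (f \<otimes>\<^bsub>P.S\<^esub> b)" by simp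
  then have "ev g \<otimes> ev a = ev f \<otimes> ev b" using C by simp
  then show "x = ev a \<otimes> inv (ev f)"
    unfolding b(3) using C ev_divide(1)[OF V h] ev_divide(1)[OF V b(1)] by (subst divide_eq_iff) auto
qed (use h in blast)

lemma val_hom:
  assumes V: "V \<in> Z"
  shows "val V \<in> ring_hom (P.loc (point V)) (F\<lparr>carrier := V\<rparr>)"
proof (rule ring_hom_memI)
  note prime = point_prime[OF V]
  fix x assume xL: "x \<in> carrier (P.loc (point V))"
  obtain d a f where x: "P.hfrac (point V) d a f" "x = P.ratio (point V) a f"
    by (rule P.loc_elem[OF prime xL])
  show "val V x \<in> carrier (F\<lparr>carrier := V\<rparr>)" using ev_divide(2)[OF V x(1)] x val_ratio[OF V x(1)] by simp
  fix y assume yL: "y \<in> carrier (P.loc (point V))"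
  obtain e b g where y: "P.hfrac (point V) e b g" "y = P.ratio (point V) b g"
    by (rule P.loc_elem[OF prime yL])
  note nz = ev_divide(1)[OF V x(1)] ev_divide(1)[OF V y(1)]
  have C: "ev a \<in> carrier F" "ev b \<in> carrier F" "ev f \<in> carrier F" "ev g \<in> carrier F"
    "a \<in> carrier P.S" "b \<in> carrier P.S" "f \<in> carrier P.S" "g \<in> carrier P.S"
    using P.hfracD[OF x(1)] P.hfracD[OF y(1)] by auto
  note I = inv_nonzero[OF C(3) nz(1)] inv_nonzero[OF C(4) nz(2)]
  show "val V (x \<otimes>\<^bsub>P.loc (point V)\<^esub> y) = val V x \<otimes>\<^bsub>F\<lparr>carrier := V\<rparr>\<^esub> val V y"
    unfolding x(2) y(2) P.loc_mult[OF prime x(1) y(1)]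
    using C nz I by (simp add: val_ratio[OF V x(1)] val_ratio[OF V y(1)]
        val_ratio[OF V P.hfrac_mult[OF prime x(1) y(1)]] inv_mult_nonzero m_ac)
  have "val V (x \<oplus>\<^bsub>P.loc (point V)\<^esub> y) = (ev a \<otimes> ev g \<oplus> ev b \<otimes> ev f) \<otimes> (inv (ev f) \<otimes> inv (ev g))"
    unfolding x(2) y(2) P.loc_add[OF prime x(1) y(1)]
    using C nz I by (simp add: val_ratio[OF V P.hfrac_add[OF prime x(1) y(1)]] inv_mult_nonzero)
  also have "\<dots> = ev a \<otimes> inv (ev f) \<otimes> (ev g \<otimes> inv (ev g)) \<oplus> ev b \<otimes> inv (ev g) \<otimes> (ev f \<otimes> inv (ev f))"
    using C I by (simp add: l_distr r_distr m_ac)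
  also have "\<dots> = ev a \<otimes> inv (ev f) \<oplus> ev b \<otimes> inv (ev g)"
    using C I nz by (simp add: r_inv_nonzero)
  finally show "val V (x \<oplus>\<^bsub>P.loc (point V)\<^esub> y) = val V x \<oplus>\<^bsub>F\<lparr>carrier := V\<rparr>\<^esub> val V y"
    unfolding x(2) y(2) by (simp add: val_ratio[OF V x(1)] val_ratio[OF V y(1)])
next
  show "val V \<one>\<^bsub>P.loc (point V)\<^esub> = \<one>\<^bsub>F\<lparr>carrier := V\<rparr>\<^esub>"
    unfolding P.loc_one by (simp add: val_ratio[OF V P.hfrac_one[OF point_prime[OF V]]])
qed

lemma val_loc_max:
  assumes V: "V \<in> Z"
  shows "val V ` P.loc_max (point V) \<subseteq> val_max F V"
  using ev_divide(3)[OF V] by (auto simp: P.loc_max_def val_ratio[OF V])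

abbreviation "K \<equiv> carrier F"

text \<open>A pulled back section is one and the same element of \<open>F\<close> at all points, so
  it is read off at the generic point. Over an empty preimage the only section is
  \<open>\<zero>\<close>.\<close>

definition morphism ::
  "('a set, 'a, 'a poly2 set, 'a poly2 set \<Rightarrow> ('a poly2 \<times> 'a poly2) set) ringed_map" where
  "morphism = \<lparr>pt = point,
    pull = (\<lambda>U s. if {V \<in> Z. point V \<in> U} = {} then \<zero> else val K (s (point K)))\<rparr>"

lemma pt_morphism [simp]: "pt morphism = point"
  by (simp add: morphism_def)

lemma preim_morphism [simp]: "preim ZS morphism U = {V \<in> Z. point V \<in> U}"
  by (auto simp: preim_def topspace_ZS morphism_def)

lemma pull_morphism_empty: "{V \<in> Z. point V \<in> U} = {} \<Longrightarrow> pull morphism U s = \<zero>"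
  unfolding morphism_def by simp

lemma pull_morphism_nonempty:
  "{V \<in> Z. point V \<in> U} \<noteq> {} \<Longrightarrow> pull morphism U s = val K (s (point K))"
  unfolding morphism_def by (simp only: ringed_map.simps if_False)

lemma openin_preim:
  assumes "openin (proj_top P.S P.gr) U"
  shows "openin (space_top ZS) {V \<in> Z. point V \<in> U}"
  using openin_continuous_map_preimage[OF continuous_point assms] by (simp add: topspace_ZS)

lemma point_O_in:
  assumes "openin (proj_top P.S P.gr) U" "V \<in> Z" "point V \<in> U"
  shows "point K \<in> U"
  using F_in_open[OF openin_preim[OF assms(1)]] assms(2,3) by blast

text \<open>Near \<open>point V\<close> the section is a single fraction \<open>a / f\<close>. This
  neighbourhood contains the image of the generic point, and at both points the value is
  \<open>ev a \<otimes> inv (ev f)\<close>.\<close>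

lemma pull_morphism:
  assumes U: "openin (proj_top P.S P.gr) U" and s: "s \<in> carrier (proj_sections P.S P.gr U)"
    and V: "V \<in> Z" "point V \<in> U"
  shows "pull morphism U s = val V (s (point V))" "s (point V) \<in> carrier (P.loc (point V))"
proof -
  obtain N d a f where N: "openin (proj_top P.S P.gr) N" "point V \<in> N" "N \<subseteq> U"
    "\<And>Q. Q \<in> N \<Longrightarrow> P.hfrac Q d a f \<and> s Q = P.ratio Q a f"
    using P.proj_section_value[OF U s V(2)] by blast
  have K: "point K \<in> N" using point_O_in[OF N(1) V(1) N(2)] .
  have "pull morphism U s = val K (s (point K))" using V by (auto simp: morphism_def)
  then show "pull morphism U s = val V (s (point V))"
    using N(4)[OF K] N(4)[OF N(2)] val_ratio[OF F_in_Z, of d a f] val_ratio[OF V(1), of d a f] by simp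
  show "s (point V) \<in> carrier (P.loc (point V))"
    using N(4)[OF N(2)] P.loc_carrierI[of "point V" d a f] by simp
qed

lemma pull_morphism_in:
  assumes U: "openin (proj_top P.S P.gr) U" and s: "s \<in> carrier (proj_sections P.S P.gr U)"
  shows "pull morphism U s \<in> carrier (sections ZS {V \<in> Z. point V \<in> U})"
proof (cases "{V \<in> Z. point V \<in> U} = {}")
  case True
  then show ?thesis unfolding True pull_morphism_empty[OF True] by (simp add: zr_space_def zr_sections_def)
next
  case False
  have "pull morphism U s \<in> V" if "V \<in> Z" "point V \<in> U" for V
    using pull_morphism[OF U s that] ring_hom_closed[OF val_hom[OF that(1)]] by simp
  then show ?thesis unfolding sections_ZS[OF False] by auto
qed

lemma lrs_morphism: "lrs_morphism ZS (P1 RA) morphism"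
  unfolding lrs_morphism_def
proof (intro conjI allI impI ballI, unfold P1_simps pt_morphism preim_morphism)
  show "continuous_map (space_top ZS) (proj_top P.S P.gr) point" by (rule continuous_point)
next
  fix U assume U: "openin (proj_top P.S P.gr) U"
  show "pull morphism U \<in> ring_hom (proj_sections P.S P.gr U) (sections ZS {V \<in> Z. point V \<in> U})"
  proof (cases "{V \<in> Z. point V \<in> U} = {}")
    case True
    show ?thesis
      unfolding True
      by (rule ring_hom_memI) (simp_all add: zr_space_def zr_sections_def pull_morphism_empty[OF True])
  next
    case False
    then obtain V where "V \<in> Z" "point V \<in> U" by blast
    then have K: "point K \<in> U" using point_O_in[OF U] by blast
    have pull: "pull morphism U s = val K (s (point K))" for s
      by (rule pull_morphism_nonempty[OF False])
    note sO = pull_morphism(2)[OF U _ F_in_Z K]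
    show ?thesis
    proof (rule ring_hom_memI)
      show "pull morphism U s \<in> carrier (sections ZS {V \<in> Z. point V \<in> U})"
        if "s \<in> carrier (proj_sections P.S P.gr U)" for s
        by (rule pull_morphism_in[OF U that])
    qed (use K sO ring_hom_mult[OF val_hom[OF F_in_Z]] ring_hom_add[OF val_hom[OF F_in_Z]]
        ring_hom_one[OF val_hom[OF F_in_Z]]
        in \<open>simp_all add: pull sections_ZS[OF False] proj_sections_def pointwise_ring_def\<close>)
  qed
next
  fix U W t assume U: "openin (proj_top P.S P.gr) U" and W: "openin (proj_top P.S P.gr) W" "W \<subseteq> U"
    and t: "t \<in> carrier (proj_sections P.S P.gr U)"
  show "restr ZS {V \<in> Z. point V \<in> U} {V \<in> Z. point V \<in> W} (pull morphism U t) =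
      pull morphism W (restrict t W)"
  proof (cases "{V \<in> Z. point V \<in> W} = {}")
    case True
    show ?thesis unfolding True pull_morphism_empty[OF True] by (simp add: zr_space_def)
  next
    case False
    then obtain V where V: "V \<in> Z" "point V \<in> W" by blast
    have "pull morphism U t = pull morphism W (restrict t W)"
      using pull_morphism(1)[OF U t V(1)] V W
        pull_morphism(1)[OF W(1) P.proj_section_restrict[OF U W t] V] by auto
    then show ?thesis using restr_ZS[OF False] by simp
  qed
next
  fix V assume "V \<in> topspace (space_top ZS)"
  then have V: "V \<in> Z" by (simp add: topspace_ZS)
  have "local_hom (stalk (P1 RA) (pt morphism V)) (stalk ZS V) (stalk_map ZS morphism V)"
  proof (rule local_hom_stalk_mapI[OF stalk_values_ZS[OF V]])
    show "stalk_values (P1 RA) (pt morphism V) (P.loc (point V)) (\<lambda>U s. s (point V)) (P.loc_max (point V))"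
      using P.stalk_values_Proj[OF point_proj[OF V]] by (simp add: P1_def)
    show "val V \<in> ring_hom (P.loc (point V)) (F\<lparr>carrier := V\<rparr>)" by (rule val_hom[OF V])
    show "val V ` P.loc_max (point V) \<subseteq> val_max F V" by (rule val_loc_max[OF V])
  qed (use openin_preim pull_morphism_in pull_morphism(1) V in \<open>auto simp: P1_simps\<close>)
  then show "local_hom (stalk (P1 RA) (point V)) (stalk ZS V) (stalk_map ZS morphism V)" by simp
qed

lemma pt_P1_to_spec: "pt (P1_to_spec RA) Q = {a \<in> A. P.mono a 0 0 \<in> Q}"
  by (simp add: P1_to_spec_def proj_to_spec_def P.const_mono)

lemma const_in_point_iff: "V \<in> Z \<Longrightarrow> a \<in> A \<Longrightarrow> P.mono a 0 0 \<in> point V \<longleftrightarrow> a \<in> val_max F V"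
  using homogeneous_in_point_iff[OF _ P.homogeneous_mono[of a 0 0]] A_carrier by (simp add: ev_mono)

lemma center_eq: "V \<in> Z \<Longrightarrow> center F A V = pt (P1_to_spec RA) (point V)"
  unfolding center_def pt_P1_to_spec max_ideal_valuation[OF Z_valuation]
  using const_in_point_iff by auto

end

section \<open>Sections over \<open>Spec A\<close> as elements of \<open>F\<close>, and
  compatibility with the structure morphisms\<close>

context zr_setting
begin

text \<open>The zero ideal is the generic point of \<open>Spec A\<close>: it avoids every element
  that some prime ideal avoids.\<close>

lemma zero_in_spec_open:
  assumes "openin (spec_top RA) W" "W \<noteq> {}"
  shows "{\<zero>} \<in> W"
proof -
  have p: "primeideal {\<zero>} RA"
    using P.zeroprimeideal by simp
  have f: "f \<noteq> \<zero>" if "primeideal Q RA" "f \<notin> Q" for f Q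
    using that additive_subgroup.zero_closed[of Q RA] ideal.axioms(1) primeideal.axioms(1) by fastforce
  have "\<forall>Q\<in>W. {\<zero>} \<in> W"
    using assms(1) unfolding spec_top_def openin_topology_generated_by_iff
    by induction (use p f in auto)
  then show ?thesis using assms(2) by blast
qed

lemma fraction_set_spec:
  assumes "primeideal Q RA"
  shows "fraction_set RA (A - Q)"
proof -
  interpret Q: primeideal Q RA by fact
  show ?thesis
  proof
    show "\<one>\<^bsub>RA\<^esub> \<in> A - Q" using Q.I_notcarr Q.one_imp_carrier subringE(3)[OF A_subring] by auto
    show "\<zero>\<^bsub>RA\<^esub> \<notin> A - Q" using Q.zero_closed by simp
    show "x \<otimes>\<^bsub>RA\<^esub> y \<in> A - Q" if "x \<in> A - Q" "y \<in> A - Q" for x y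
      using that Q.I_prime[of x y] subringE(6)[OF A_subring] by auto
  qed auto
qed

text \<open>Every section is globally one element \<open>a / b\<close> of \<open>F\<close>. Each
  neighbourhood on which it is a single fraction contains the zero ideal, and there the fraction
  must agree with \<open>a / b\<close>.\<close>

lemma spec_section_value:
  assumes W: "openin (spec_top RA) W" and ne: "W \<noteq> {}" and s: "s \<in> carrier (spec_sections RA W)"
  obtains a b where "a \<in> A" "b \<in> A" "b \<noteq> \<zero>"
    "\<And>Q c e. Q \<in> W \<Longrightarrow> (c, e) \<in> s Q \<Longrightarrow> a \<otimes> inv b \<otimes> e = c"
    "\<And>c e. (c, e) \<in> s {\<zero>} \<longleftrightarrow> c \<in> A \<and> e \<in> A - {\<zero>} \<and> e \<otimes> a = b \<otimes> c"
proof -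
  define L where "L N a f \<longleftrightarrow> (\<forall>Q\<in>N. f \<notin> Q \<and> s Q = fraction RA (A - Q) a f)" for N a f
  have "\<forall>Q\<in>W. \<exists>N. openin (spec_top RA) N \<and> Q \<in> N \<and> N \<subseteq> W \<and> (\<exists>a\<in>A. \<exists>f\<in>A. L N a f)"
    using s unfolding spec_sections_def pointwise_ring_def L_def by simp
  then have loc: "\<exists>N a f. openin (spec_top RA) N \<and> Q \<in> N \<and> N \<subseteq> W \<and> a \<in> A \<and> f \<in> A \<and> L N a f"
    if "Q \<in> W" for Q
    using that by blast
  have prime: "primeideal Q RA" if "Q \<in> W" for Q
    using that openin_subset[OF W] P.topspace_spec by auto
  have K: "{\<zero>} \<in> W" by (rule zero_in_spec_open[OF W ne])
  obtain N a b where N: "{\<zero>} \<in> N" "L N a b" and ab': "a \<in> A" "b \<in> A"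
    using loc[OF K] by blast
  then have "b \<notin> {\<zero>}" "s {\<zero>} = fraction RA (A - {\<zero>}) a b"
    unfolding L_def by blast+
  then have ab: "a \<in> A" "b \<in> A" "b \<noteq> \<zero>" "s {\<zero>} = fraction RA (A - {\<zero>}) a b"
    using ab' by simp_all
  have mem0: "(c, e) \<in> s {\<zero>} \<longleftrightarrow> c \<in> A \<and> e \<in> A - {\<zero>} \<and> e \<otimes> a = b \<otimes> c" for c e
    unfolding ab(4) using fraction_set.mem_fraction[OF fraction_set_spec[OF prime[OF K]], of a b c e] ab by simp
  show thesis
  proof (rule that[OF ab(1-3) _ mem0])
    fix Q c e assume Q: "Q \<in> W" and ce: "(c, e) \<in> s Q"
    obtain N a' f where N: "openin (spec_top RA) N" "Q \<in> N" "a' \<in> A" "f \<in> A" "L N a' f"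
      using loc[OF Q] by blast
    have NL: "f \<notin> Q \<and> s Q = fraction RA (A - Q) a' f" if "Q \<in> N" for Q
      using N(5) that by (simp add: L_def)
    have ON: "{\<zero>} \<in> N" using zero_in_spec_open[OF N(1)] N(2) by blast
    have f0: "f \<noteq> \<zero>" and "s {\<zero>} = fraction RA (A - {\<zero>}) a' f" using NL[OF ON] by auto
    then have "(a', f) \<in> s {\<zero>}"
      using fraction_set.fraction_refl[OF fraction_set_spec[OF prime[OF K]], of a' f] N by simp
    then have 1: "f \<otimes> a = b \<otimes> a'" using mem0 by blast
    have 2: "c \<in> A" "e \<in> A" "e \<otimes> a' = f \<otimes> c"
      using ce NL[OF N(2)] fraction_set.mem_fraction[OF fraction_set_spec[OF prime[OF Q]], of a' f c e] N by auto
    have C: "a \<in> carrier F" "b \<in> carrier F" "a' \<in> carrier F" "f \<in> carrier F" "c \<in> carrier F" "e \<in> carrier F"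
      using ab N 2 A_carrier by auto
    note I = inv_nonzero[OF C(2) ab(3)] inv_nonzero[OF C(4) f0]
    have "a \<otimes> inv b = a' \<otimes> inv f" using C ab(3) f0 1 by (subst divide_eq_iff) auto
    then have "a \<otimes> inv b \<otimes> e = inv f \<otimes> (e \<otimes> a')" using C I by (simp add: m_ac)
    also have "\<dots> = c" unfolding 2(3) using C f0 by (simp add: inv_mult_cancel)
    finally show "a \<otimes> inv b \<otimes> e = c" .
  qed
qed

lemma pull_zr_to_spec:
  assumes W: "W \<noteq> {}" "{\<zero>} \<in> W" and b: "a \<in> carrier F" "b \<in> carrier F" "b \<noteq> \<zero>" "(a, b) \<in> s {\<zero>}"
    and s: "\<And>Q c e. Q \<in> W \<Longrightarrow> (c, e) \<in> s Q \<Longrightarrow> a \<otimes> inv b \<otimes> e = c"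
  shows "pull (zr_to_spec F A) W s = a \<otimes> inv b"
proof -
  have "(THE x. x \<in> carrier F \<and> (\<forall>Q\<in>W. \<forall>(c, e)\<in>s Q. x \<otimes> e = c)) = a \<otimes> inv b"
  proof (rule the_equality)
    show "a \<otimes> inv b \<in> carrier F \<and> (\<forall>Q\<in>W. \<forall>(c, e)\<in>s Q. a \<otimes> inv b \<otimes> e = c)"
      using b s inv_nonzero by auto
    fix x assume x: "x \<in> carrier F \<and> (\<forall>Q\<in>W. \<forall>(c, e)\<in>s Q. x \<otimes> e = c)"
    then have "x \<otimes> b = a" using W(2) b(4) by blast
    then show "x = a \<otimes> inv b" using eq_divide_iff b x by simp
  qed
  then show ?thesis using W(1) by (simp add: zr_to_spec_def)
qed

end

context zr_point
begin

lemma commutes_morphism: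
  "commutes_over ZS (P1 RA) (Spec RA) (zr_to_spec F A) (P1_to_spec RA) morphism"
  unfolding commutes_over_def
proof (intro conjI ballI allI impI)
  fix V assume "V \<in> topspace (space_top ZS)"
  then show "pt (zr_to_spec F A) V = pt (P1_to_spec RA) (pt morphism V)"
    using center_eq by (simp add: topspace_ZS zr_to_spec_def)
next
  fix W s assume "openin (space_top (Spec RA)) W" "s \<in> carrier (sections (Spec RA) W)"
  then have W: "openin (spec_top RA) W" and s: "s \<in> carrier (spec_sections RA W)"
    by (simp_all add: Spec_def)
  have pre: "preim (P1 RA) (P1_to_spec RA) W = {Q \<in> proj_points P.S P.gr. pt (P1_to_spec RA) Q \<in> W}"
    by (auto simp: preim_def P1_simps P.topspace_proj)
  show "pull (zr_to_spec F A) W s =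
    pull morphism (preim (P1 RA) (P1_to_spec RA) W) (pull (P1_to_spec RA) W s)"
  proof (cases "W = {}")
    case True
    then have empty: "{V \<in> Z. point V \<in> preim (P1 RA) (P1_to_spec RA) W} = {}" unfolding pre by simp
    then show ?thesis unfolding pull_morphism_empty[OF empty] by (simp add: zr_to_spec_def True)
  next
    case False
    obtain a b where ab: "a \<in> A" "b \<in> A" "b \<noteq> \<zero>"
      "\<And>Q c e. Q \<in> W \<Longrightarrow> (c, e) \<in> s Q \<Longrightarrow> a \<otimes> inv b \<otimes> e = c"
      "\<And>c e. (c, e) \<in> s {\<zero>} \<longleftrightarrow> c \<in> A \<and> e \<in> A - {\<zero>} \<and> e \<otimes> a = b \<otimes> c"
      using spec_section_value[OF W False s] by blast
    have C: "a \<in> carrier F" "b \<in> carrier F" using ab A_carrier by auto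
    have zero: "{\<zero>} \<in> W" by (rule zero_in_spec_open[OF W False])
    have "(a, b) \<in> s {\<zero>}" using ab C by (simp add: m_comm)
    then have lhs: "pull (zr_to_spec F A) W s = a \<otimes> inv b"
      using pull_zr_to_spec[OF False zero C ab(3)] ab(4) by blast
    \<comment> \<open>Pullback along \<open>morphism\<close> is read off at \<open>point K\<close>,
      which lies over the zero ideal. Hence only the pairs representing \<open>s\<close> at that
      ideal matter.\<close>
    have "center F A K = {\<zero>}"
      unfolding center_def max_ideal_valuation[OF Z_valuation[OF F_in_Z]] val_max_F
      using subringE(2)[OF A_subring] by auto
    then have K: "pt (P1_to_spec RA) (point K) = {\<zero>}" using center_eq[OF F_in_Z] by simp
    have OW: "point K \<in> {Q \<in> proj_points P.S P.gr. pt (P1_to_spec RA) Q \<in> W}"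
      using K zero point_proj[OF F_in_Z] by simp
    have hf: "P.hfrac (point K) 0 (P.mono c 0 0) (P.mono e 0 0)" if "c \<in> A" "e \<in> A" "e \<noteq> \<zero>" for c e
      using that P.homogeneous_mono[of c 0 0] P.homogeneous_mono[of e 0 0]
        const_in_point_iff[OF F_in_Z, of e] by (simp add: P.hfrac_def val_max_F)
    have eq: "P.ratio (point K) (P.mono c 0 0) (P.mono e 0 0) =
        P.ratio (point K) (P.mono a 0 0) (P.mono b 0 0)" if "(c, e) \<in> s {\<zero>}" for c e
    proof -
      have ce: "c \<in> A" "e \<in> A" "e \<noteq> \<zero>" "e \<otimes> a = b \<otimes> c" using that ab(5) by auto
      show ?thesis
        unfolding P.frac_eq_iff[OF point_prime[OF F_in_Z] hf[OF ce(1-3)] hf[OF ab(1-3)]]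
        using ce ab by (simp add: P.mono_mult)
    qed
    have "pull (P1_to_spec RA) W s (point K) =
        (\<Union>(c, e)\<in>s {\<zero>}. P.ratio (point K) (P.mono c 0 0) (P.mono e 0 0))"
      using OW K by (simp add: P1_to_spec_def proj_to_spec_def P.const_mono)
    also have "\<dots> = (\<Union>_\<in>s {\<zero>}. P.ratio (point K) (P.mono a 0 0) (P.mono b 0 0))"
      by (rule SUP_cong[OF refl]) (metis (no_types, lifting) case_prod_conv eq surj_pair)
    also have "\<dots> = P.ratio (point K) (P.mono a 0 0) (P.mono b 0 0)"
      using \<open>(a, b) \<in> s {\<zero>}\<close> by auto
    finally have val_eq: "val K (pull (P1_to_spec RA) W s (point K)) = a \<otimes> inv b"
      using val_ratio[OF F_in_Z hf[OF ab(1-3)]] ab C by (simp add: ev_mono)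
    have ne: "{V \<in> Z. point V \<in> {Q \<in> proj_points P.S P.gr. pt (P1_to_spec RA) Q \<in> W}} \<noteq> {}"
      using OW F_in_Z by blast
    show ?thesis unfolding pre pull_morphism_nonempty[OF ne] lhs by (simp add: val_eq)
  qed
qed

lemma morphism_P1: "zr_P1_morphism F D Z A morphism"
  by (simp add: zr_P1_morphism_def lrs_morphism commutes_morphism)

end

section \<open>From nonvanishing polynomials to the Pruefer and torsion properties\<close>

lemma (in zr_setting) field_subring_A: "field_subring F A"
  by (intro field_subring.intro field_subring_axioms.intro field_axioms A_subring)

text \<open>\<open>ev f\<close> is an \<open>A\<close>-linear combination of the powers of
  \<open>u\<close> with exponent at most \<open>d\<close>.\<close>

lemma (in zr_point) ev_in_submodule:
  assumes f: "f \<in> P.gr d" and I: "submodule_of_field F A I" and pow: "\<And>i. i \<le> d \<Longrightarrow> u [^] i \<in> I"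
  shows "ev f \<in> I"
proof -
  interpret field_subring F A by (rule field_subring_A)
  show ?thesis using f
  proof (rule P.homogeneous_induct)
    show "ev \<zero>\<^bsub>P.S\<^esub> \<in> I" using smD(2)[OF I] by simp
    show "ev (x \<oplus>\<^bsub>P.S\<^esub> y) \<in> I" if "x \<in> P.gr d" "y \<in> P.gr d" "ev x \<in> I" "ev y \<in> I" for x y
      using that P.gr_carrier smD(3)[OF I] by simp
    show "ev (P.mono c i j) \<in> I" if "c \<in> carrier RA" "i + j = d" for c i j
      using that smD(4)[OF I _ pow[of j]] by (simp add: ev_mono)
  qed
qed

locale zr_nonvanishing = zr_setting +
  assumes nonvanishing: "\<And>\<phi>. zr_P1_morphism F D Z A \<phi> \<Longrightarrow>
    \<exists>d>0. \<exists>f\<in>poly2_homogeneous RA d. pt \<phi> ` Z \<subseteq> P1_nonvanishing RA f"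
begin

text \<open>Here \<open>x = f(1, u)\<close>. Since \<open>u^i\<close> is the value of the monomial
  \<open>T\<^sub>0\<^sup>d\<^sup>-\<^sup>i T\<^sub>1\<^sup>i\<close>, \<open>ev_divide\<close> puts
  \<open>u^i / x\<close> into every \<open>V\<close>. The last conclusion says that \<open>x\<close>
  is in the \<open>A\<close>-span of these powers; quantifying over submodules avoids naming
  coefficients.\<close>

lemma power_generator:
  assumes u: "u \<in> carrier F"
  obtains d :: nat and x where "0 < d" "x \<in> carrier F" "x \<noteq> \<zero>" "\<forall>i\<le>d. u [^] i \<otimes> inv x \<in> A"
    "\<forall>I. submodule_of_field F A I \<longrightarrow> (\<forall>i\<le>d. u [^] i \<in> I) \<longrightarrow> x \<in> I"
proof -
  interpret zr_point F D A Z u by unfold_locales (rule u)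
  obtain d f where d: "0 < d" and f: "f \<in> P.gr d" and im: "pt morphism ` Z \<subseteq> P1_nonvanishing RA f"
    using nonvanishing[OF morphism_P1] by blast
  have nf: "f \<notin> point V" if "V \<in> Z" for V
    using im that by (auto simp: P1_nonvanishing_def)
  have "u [^] i \<otimes> inv (ev f) \<in> A" if i: "i \<le> d" for i
  proof -
    have m: "P.mono \<one> (d - i) i \<in> P.gr d"
      using P.homogeneous_mono[of \<one> "d - i" i] subringE(3)[OF A_subring] i by simp
    have "ev (P.mono \<one> (d - i) i) = u [^] i" using u subringE(3)[OF A_subring] by (simp add: ev_mono)
    then have "u [^] i \<otimes> inv (ev f) \<in> V" if "V \<in> Z" for V
      using ev_divide(2)[OF that, of d "P.mono \<one> (d - i) i" f] nf[OF that] m f by (simp add: P.hfrac_def)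
    then show ?thesis by (auto simp: A_def)
  qed
  moreover have "ev f \<noteq> \<zero>"
    using ev_divide(1)[OF F_in_Z, of d f f] nf[OF F_in_Z] f by (simp add: P.hfrac_def)
  ultimately show thesis using that[of d "ev f"] d f P.gr_carrier[OF f] ev_in_submodule[OF f] by simp
qed

lemma pruefer: "pruefer_domain_with_quotient_field A F"
  unfolding pruefer_domain_with_quotient_field_def
proof (intro conjI allI impI)
  show "subring A F" by (rule A_subring)
  interpret FS: field_subring F A by (rule field_subring_A)
  fix P assume "primeideal P RA"
  then interpret P': primeideal P RA .
  have PA: "P \<subseteq> A" using P'.a_subset by simp
  have zP: "\<zero> \<in> P" using P'.zero_closed by simp
  have nz: "b \<noteq> \<zero>" "b \<in> carrier F" if "b \<in> A - P" for b using that zP A_carrier by auto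
  have oP: "\<one> \<in> A - P" using P'.I_notcarr P'.one_imp_carrier subringE(3)[OF A_subring] by auto
  have mP: "b \<otimes> c \<in> A - P" if "b \<in> A - P" "c \<in> A - P" for b c
    using that P'.I_prime[of b c] subringE(6)[OF A_subring] by auto
  let ?L = "localization_in F A P"
  have LI: "a \<otimes> inv b \<in> ?L" if "a \<in> A" "b \<in> A - P" for a b
    using that by (auto simp: localization_in_def)
  have LE: "\<exists>a b. a \<in> A \<and> b \<in> A - P \<and> x = a \<otimes> inv b" if "x \<in> ?L" for x
    using that by (auto simp: localization_in_def)
  have "subring ?L F"
  proof (rule subringI)
    show "?L \<subseteq> carrier F" using nz inv_nonzero A_carrier by (auto simp: localization_in_def)
    show "\<one> \<in> ?L" using LI[OF _ oP, of \<one>] oP by simp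
    fix x assume "x \<in> ?L"
    then obtain a b where a: "a \<in> A" "b \<in> A - P" "x = a \<otimes> inv b" using LE by blast
    note C = A_carrier[OF a(1)] nz[OF a(2)] inv_nonzero[OF nz(2,1)[OF a(2)]]
    have "\<ominus> x = (\<ominus> a) \<otimes> inv b" using a C by (simp add: l_minus)
    then show "\<ominus> x \<in> ?L" using LI[OF subringE(5)[OF A_subring a(1)] a(2)] by simp
    fix y assume "y \<in> ?L"
    then obtain c e where c: "c \<in> A" "e \<in> A - P" "y = c \<otimes> inv e" using LE by blast
    note C = C A_carrier[OF c(1)] nz[OF c(2)] inv_nonzero[OF nz(2,1)[OF c(2)]]
    have "x \<otimes> y = (a \<otimes> c) \<otimes> inv (b \<otimes> e)" using a c C by (simp add: inv_mult_nonzero m_ac)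
    then show "x \<otimes> y \<in> ?L" using LI[OF subringE(6)[OF A_subring a(1) c(1)] mP[OF a(2) c(2)]] by simp
    have "(a \<otimes> e \<oplus> c \<otimes> b) \<otimes> inv (b \<otimes> e) =
        (a \<otimes> inv b) \<otimes> (e \<otimes> inv e) \<oplus> (c \<otimes> inv e) \<otimes> (b \<otimes> inv b)"
      using C by (simp add: inv_mult_nonzero l_distr r_distr m_ac)
    then have "x \<oplus> y = (a \<otimes> e \<oplus> c \<otimes> b) \<otimes> inv (b \<otimes> e)" using a c C by (simp add: r_inv_nonzero)
    moreover have "a \<otimes> e \<oplus> c \<otimes> b \<in> A"
      using subringE(6,7)[OF A_subring] a c by simp
    ultimately show "x \<oplus> y \<in> ?L" using LI[OF _ mP[OF a(2) c(2)]] by simp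
  qed
  moreover have "u \<in> ?L \<or> inv u \<in> ?L" if u: "u \<in> carrier F" "u \<noteq> \<zero>" for u
  proof -
    obtain d :: nat and x where d: "0 < d" and x: "x \<in> carrier F" "x \<noteq> \<zero>"
      and b: "\<forall>i\<le>d. u [^] i \<otimes> inv x \<in> A"
      and span: "\<forall>I. submodule_of_field F A I \<longrightarrow> (\<forall>i\<le>d. u [^] i \<in> I) \<longrightarrow> x \<in> I"
      by (rule power_generator[OF u(1)]) (rule that)
    have ix: "inv x \<in> carrier F" using inv_nonzero[OF x] by blast
    have step: "u [^] Suc i \<otimes> inv x = u \<otimes> (u [^] i \<otimes> inv x)" for i
      using u ix by (simp add: m_ac)
    \<comment> \<open>If all \<open>u^i / x\<close> were in \<open>P\<close>, this submodule would
      contain all the powers, hence \<open>x\<close>, and \<open>x / x = 1\<close> would be in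
      \<open>P\<close>.\<close>
    let ?I = "{y \<in> carrier F. y \<otimes> inv x \<in> P}"
    have "submodule_of_field F A ?I"
    proof (rule FS.smI)
      show "\<zero> \<in> ?I" using ix zP by simp
      show "y \<oplus> z \<in> ?I" if "y \<in> ?I" "z \<in> ?I" for y z
        using that P'.a_closed[of "y \<otimes> inv x" "z \<otimes> inv x"] ix by (simp add: l_distr)
      show "a \<otimes> y \<in> ?I" if "a \<in> A" "y \<in> ?I" for a y
        using that P'.I_l_closed[of "y \<otimes> inv x" a] ix A_carrier[OF that(1)] by (simp add: m_assoc)
    qed auto
    moreover have "x \<notin> ?I" using x oP by (simp add: r_inv_nonzero)
    ultimately obtain i where i: "i \<le> d" "u [^] i \<otimes> inv x \<notin> P" using span[rule_format, of ?I] u by auto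
    then have bi: "u [^] i \<otimes> inv x \<in> A - P" using b by simp
    note bn = nz[OF bi]
    show ?thesis
    \<comment> \<open>A neighbour of \<open>i\<close> in \<open>0..d\<close> exists because
      \<open>d > 0\<close>: the next exponent yields \<open>u\<close>, and for \<open>i = d\<close>
      the preceding one yields \<open>inv u\<close>.\<close>
    proof (cases "i < d")
      case True
      then have "u [^] Suc i \<otimes> inv x \<in> A" using b[rule_format, of "Suc i"] by (simp only: Suc_leI)
      moreover have "u = (u [^] Suc i \<otimes> inv x) \<otimes> inv (u [^] i \<otimes> inv x)"
        unfolding step using u bn by (subst eq_divide_iff) auto
      ultimately show ?thesis using LI[OF _ bi] by metis
    next
      case False
      then obtain j where j: "i = Suc j" "j \<le> d" using d i(1) by (cases i) auto
      have jC: "u [^] j \<otimes> inv x \<in> carrier F" using u ix by simp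
      have "inv u \<otimes> (u [^] i \<otimes> inv x) = u [^] j \<otimes> inv x"
        unfolding j(1) step using u jC by (rule inv_mult_cancel)
      then have "inv u = (u [^] j \<otimes> inv x) \<otimes> inv (u [^] i \<otimes> inv x)"
        using eq_divide_iff[OF jC _ bn(2,1), of "inv u"] inv_nonzero[OF u] by simp
      then show ?thesis using LI[OF b[rule_format, OF j(2)] bi] by metis
    qed
  qed
  ultimately show "valuation_ring ?L F" by (auto simp: valuation_ring_def)
qed

end

section \<open>Finite generation of invertible ideals\<close>

context field_subring
begin

text \<open>If \<open>x\<close> is the sum of products \<open>i_k j_k\<close>, then
  \<open>x y\<close> is the sum of the \<open>(y j_k) i_k\<close> with \<open>y j_k\<close> in
  \<open>A\<close>, so the \<open>i_k\<close> generate every multiple of \<open>x\<close> by an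
  element of \<open>I\<close>. Generation is again expressed through all submodules containing
  \<open>G\<close>.\<close>

lemma ideal_prod_finite_generation:
  assumes I: "sm I" and J: "sm J" and IJ: "ideal_prod F I J \<subseteq> A" and x: "x \<in> ideal_prod F I J"
  shows "\<exists>G. finite G \<and> G \<subseteq> I \<and> (\<forall>W. sm W \<longrightarrow> G \<subseteq> W \<longrightarrow> (\<forall>y\<in>I. x \<otimes> y \<in> W))"
  using x
proof induction
  case (prod i j)
  have "i \<otimes> j \<otimes> y \<in> W" if W: "sm W" "{i} \<subseteq> W" and y: "y \<in> I" for W y
  proof -
    have "y \<otimes> j \<in> A" using IJ ideal_prod.prod[OF y prod(2), of F] by blast
    then have "(y \<otimes> j) \<otimes> i \<in> W" using smD(4)[OF W(1)] W(2) by simp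
    moreover have "i \<in> carrier F" "j \<in> carrier F" "y \<in> carrier F"
      using prod y smD(1)[OF I] smD(1)[OF J] by auto
    ultimately show ?thesis by (simp add: m_ac)
  qed
  then show ?case using prod by (intro exI[of _ "{i}"]) auto
next
  case (sum s t)
  obtain G where G: "finite G" "G \<subseteq> I" "\<forall>W. sm W \<longrightarrow> G \<subseteq> W \<longrightarrow> (\<forall>y\<in>I. s \<otimes> y \<in> W)"
    using sum.IH(1) by (elim exE conjE) (rule that)
  obtain H where H: "finite H" "H \<subseteq> I" "\<forall>W. sm W \<longrightarrow> H \<subseteq> W \<longrightarrow> (\<forall>y\<in>I. t \<otimes> y \<in> W)"
    using sum.IH(2) by (elim exE conjE) (rule that)
  have "(s \<oplus> t) \<otimes> y \<in> W" if W: "sm W" "G \<union> H \<subseteq> W" and y: "y \<in> I" for W y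
  proof -
    have "s \<in> carrier F" "t \<in> carrier F" "y \<in> carrier F"
      using sum ideal_prod_carrier[OF I J] y smD(1)[OF I] by auto
    moreover have "s \<otimes> y \<in> W" "t \<otimes> y \<in> W"
      using G(3)[rule_format, OF W(1) _ y] H(3)[rule_format, OF W(1) _ y] W(2) by simp_all
    ultimately show ?thesis using smD(3)[OF W(1)] by (simp add: l_distr)
  qed
  then show ?case using G(1,2) H(1,2) by (intro exI[of _ "G \<union> H"]) simp
qed

lemma invertible_finitely_generated:
  assumes "I \<in> carrier Inv"
  obtains G where "finite G" "G \<noteq> {}" "G \<subseteq> I - {\<zero>}" "\<And>W. sm W \<Longrightarrow> G \<subseteq> W \<Longrightarrow> I \<subseteq> W"
proof -
  obtain J where I: "sm I" and J: "sm J" and IJ: "ideal_prod F I J = A"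
    using assms by (auto simp: Inv_carrier)
  have "\<one> \<in> ideal_prod F I J" using IJ subringE(3)[OF A] by simp
  then have "\<exists>G. finite G \<and> G \<subseteq> I \<and> (\<forall>W. sm W \<longrightarrow> G \<subseteq> W \<longrightarrow> (\<forall>y\<in>I. \<one> \<otimes> y \<in> W))"
    by (rule ideal_prod_finite_generation[OF I J equalityD1[OF IJ]])
  then obtain G where G: "finite G" "G \<subseteq> I" "\<forall>W. sm W \<longrightarrow> G \<subseteq> W \<longrightarrow> (\<forall>y\<in>I. \<one> \<otimes> y \<in> W)"
    by (elim exE conjE) (rule that)
  \<comment> \<open>Zero is dropped from the generators because a generator becomes a denominator in
    \<open>common_power_generator\<close>.\<close>
  have gen: "I \<subseteq> W" if W: "sm W" "G - {\<zero>} \<subseteq> W" for W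
  proof
    fix y assume y: "y \<in> I"
    have "G \<subseteq> W" using W(2) smD(2)[OF W(1)] by auto
    then have "\<one> \<otimes> y \<in> W" using G(3)[rule_format, OF W(1) _ y] by simp
    then show "y \<in> W" using y smD(1)[OF I] by auto
  qed
  have ne: "G - {\<zero>} \<noteq> {}"
  proof
    assume "G - {\<zero>} = {}"
    moreover have "sm {\<zero>}" by (rule smI) (auto simp: A_C)
    ultimately have I0: "I \<subseteq> {\<zero>}" using gen by blast
    have "x = \<zero>" if x: "x \<in> ideal_prod F I J" for x
      using x by induction (use I0 smD(1)[OF J] in \<open>auto simp: subset_iff\<close>)
    then show False using \<open>\<one> \<in> ideal_prod F I J\<close> one_not_zero by blast
  qed
  show thesis by (rule that[OF _ ne _ gen]) (use G(1,2) in auto)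
qed

end

section \<open>Torsion of the Picard group\<close>

context zr_nonvanishing
begin

interpretation FS: field_subring F A
  by (rule field_subring_A)

text \<open>Induction over the generators. Given \<open>m\<close> and \<open>x\<close> for
  \<open>G\<close>, \<open>power_generator\<close> for \<open>t = g^m / x\<close> supplies
  \<open>d\<close> and \<open>y\<close>, and \<open>x^d y\<close> works with exponent
  \<open>m d\<close>. For \<open>h\<close> in \<open>G\<close> the quotient is
  \<open>(h^m / x)^d\<close> times \<open>1 / y\<close>, which is in \<open>A\<close> by the
  exponent \<open>0\<close>; for \<open>g\<close> it is \<open>t^d / y\<close>.\<close>

lemma common_power_generator:
  assumes I: "I \<in> carrier FS.Inv" and G: "finite G" "G \<noteq> {}" "G \<subseteq> I - {\<zero>}"
  shows "\<exists>m x. 0 < m \<and> x \<in> carrier F \<and> x \<noteq> \<zero> \<and> (\<forall>g\<in>G. g [^] m \<otimes> inv x \<in> A) \<and>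
    x \<in> I [^]\<^bsub>FS.Inv\<^esub> (m::nat)"
proof -
  interpret Inv: comm_group FS.Inv by (rule FS.comm_group_Inv)
  have IC: "I \<subseteq> carrier F" using I FS.smD(1) by (auto simp: FS.Inv_carrier)
  show ?thesis using G
  proof (induction G rule: finite_ne_induct)
    case (singleton g)
    then have g: "g \<in> I" "g \<in> carrier F" "g \<noteq> \<zero>" using IC by auto
    show ?case
      using g subringE(3)[OF A_subring] Inv.nat_pow_eone[OF I]
      by (intro exI[of _ "1::nat"] exI[of _ g]) (simp add: r_inv_nonzero)
  next
    case (insert g G)
    then obtain m :: nat and x
      where m: "0 < m" and x: "x \<in> carrier F" "x \<noteq> \<zero>" "x \<in> I [^]\<^bsub>FS.Inv\<^esub> m"
      and G: "\<And>h. h \<in> G \<Longrightarrow> h [^] m \<otimes> inv x \<in> A" by auto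
    have g: "g \<in> I" "g \<in> carrier F" "g \<noteq> \<zero>" using insert IC by auto
    have ix: "inv x \<in> carrier F" "inv x \<noteq> \<zero>" using inv_nonzero[OF x(1,2)] by auto
    define t where "t = g [^] m \<otimes> inv x"
    have t: "t \<in> carrier F" using g ix by (simp add: t_def)
    have xt: "x \<otimes> t = g [^] m" using g x ix mult_inv_cancel[OF x(1,2), of "g [^] m"] by (simp add: t_def m_comm)
    obtain d :: nat and y where d: "0 < d" and y: "y \<in> carrier F" "y \<noteq> \<zero>"
      and ty: "\<forall>i\<le>d. t [^] i \<otimes> inv y \<in> A"
      and span: "\<forall>I. submodule_of_field F A I \<longrightarrow> (\<forall>i\<le>d. t [^] i \<in> I) \<longrightarrow> y \<in> I"
      by (rule power_generator[OF t]) (rule that)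
    have iy: "inv y \<in> carrier F" using inv_nonzero[OF y] by blast
    have xd: "x [^] d \<in> carrier F" "x [^] d \<noteq> \<zero>" using x pow_nonzero by auto
    have ixd: "inv (x [^] d) = inv x [^] d"
    proof -
      have "x [^] d \<otimes> inv x [^] d = \<one>"
        using nat_pow_distrib[of x "inv x" d] x ix by (simp add: r_inv_nonzero)
      then show ?thesis using xd ix by (intro comm_inv_char) auto
    qed
    have inv: "inv (x [^] d \<otimes> y) = inv x [^] d \<otimes> inv y"
      using xd y ixd by (simp add: inv_mult_nonzero)
    have "h [^] (m * d) \<otimes> inv (x [^] d \<otimes> y) \<in> A" if h: "h \<in> insert g G" for h
    proof -
      have hC: "h \<in> carrier F" using h g insert.prems IC by auto
      have eq: "h [^] (m * d) \<otimes> inv (x [^] d \<otimes> y) = (h [^] m \<otimes> inv x) [^] d \<otimes> inv y"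
        unfolding inv using hC ix iy by (simp add: nat_pow_distrib nat_pow_pow m_assoc)
      show ?thesis
      proof (cases "h = g")
        case True
        then show ?thesis unfolding eq using ty[rule_format, of d] by (simp add: t_def)
      next
        case False
        then have "(h [^] m \<otimes> inv x) [^] d \<in> A" using G h subring_pow[OF A_subring] by simp
        moreover have "inv y \<in> A" using ty[rule_format, of 0] iy by simp
        ultimately show ?thesis unfolding eq using subringE(6)[OF A_subring] by simp
      qed
    qed
    moreover have "x [^] d \<otimes> y \<in> I [^]\<^bsub>FS.Inv\<^esub> (m * d)"
    proof -
      \<comment> \<open>For \<open>i \<le> d\<close> the denominators cancel:
        \<open>x^d t^i = x^(d - i) g^(m i)\<close>, an element of \<open>I^(m d)\<close>. So this
        submodule contains the powers of \<open>t\<close> whose span contains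
        \<open>y\<close>.\<close>
      let ?W = "{z \<in> carrier F. x [^] d \<otimes> z \<in> I [^]\<^bsub>FS.Inv\<^esub> (m * d)}"
      note Imd = FS.smD[OF FS.sm_Inv_power[OF I, of "m * d"]]
      have "submodule_of_field F A ?W"
      proof (rule FS.smI)
        show "\<zero> \<in> ?W" using xd Imd(2) by simp
        show "w \<oplus> z \<in> ?W" if "w \<in> ?W" "z \<in> ?W" for w z
          using that Imd(3) xd by (simp add: r_distr)
        show "a \<otimes> w \<in> ?W" if "a \<in> A" "w \<in> ?W" for a w
          using that Imd(4)[of a "x [^] d \<otimes> w"] xd A_carrier[OF that(1)] by (simp add: m_lcomm)
      qed auto
      moreover have "t [^] i \<in> ?W" if i: "i \<le> d" for i
      proof -
        have "x [^] d \<otimes> t [^] i = x [^] (d - i) \<otimes> (x [^] i \<otimes> t [^] i)"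
          using x t i by (simp add: m_assoc[symmetric] nat_pow_mult)
        also have "\<dots> = x [^] (d - i) \<otimes> g [^] (m * i)"
          using x t g xt nat_pow_distrib[of x t i] by (simp add: nat_pow_pow)
        finally have eq: "x [^] d \<otimes> t [^] i = x [^] (d - i) \<otimes> g [^] (m * i)" .
        have "g [^] m \<in> I [^]\<^bsub>FS.Inv\<^esub> m"
          using FS.pow_in_Inv_power[OF I, of g 1 m] g Inv.nat_pow_eone[OF I] by simp
        then have "g [^] (m * i) \<in> I [^]\<^bsub>FS.Inv\<^esub> (m * i)"
          using FS.pow_in_Inv_power[OF I, of "g [^] m" m i] g by (simp add: nat_pow_pow)
        then have "x [^] (d - i) \<otimes> g [^] (m * i) \<in> I [^]\<^bsub>FS.Inv\<^esub> (m * (d - i) + m * i)"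
          by (rule FS.prod_in_Inv_power[OF I FS.pow_in_Inv_power[OF I x(3)]])
        moreover have "m * (d - i) + m * i = m * d" using i by (simp add: distrib_left[symmetric])
        ultimately show ?thesis using eq t by simp
      qed
      ultimately show ?thesis using span[rule_format, of ?W] by blast
    qed
    moreover have "x [^] d \<otimes> y \<in> carrier F" "x [^] d \<otimes> y \<noteq> \<zero>" using xd y integral_iff by auto
    ultimately show ?case using m d
      by (intro exI[of _ "m * d"] exI[of _ "x [^] d \<otimes> y"]) simp
  qed
qed

text \<open>The inclusion of \<open>I^m\<close> in \<open>x A\<close> can be tested in each
  valuation ring \<open>V\<close> of \<open>Z\<close>. The condition that \<open>y^m / x\<close> is
  in \<open>V\<close> holds for the generators and passes to all of \<open>I\<close> by
  \<open>valuation_power_add\<close>. Multiplying, \<open>z^m / x^m\<close> is in \<open>V\<close>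
  for \<open>z\<close> in \<open>I^m\<close>, and \<open>valuation_root\<close> removes the
  exponent.\<close>

lemma torsion_picard: "torsion_group (picard_group F A)"
  unfolding FS.torsion_picard_iff
proof
  interpret Inv: comm_group FS.Inv by (rule FS.comm_group_Inv)
  fix I assume I: "I \<in> carrier FS.Inv"
  then have sI: "submodule_of_field F A I" by (simp add: FS.Inv_carrier)
  obtain G where G: "finite G" "G \<noteq> {}" "G \<subseteq> I - {\<zero>}"
    and gen: "\<And>W. submodule_of_field F A W \<Longrightarrow> G \<subseteq> W \<Longrightarrow> I \<subseteq> W"
    using FS.invertible_finitely_generated[OF I] by blast
  obtain m x where m: "0 < m" and x: "x \<in> carrier F" "x \<noteq> \<zero>" "x \<in> I [^]\<^bsub>FS.Inv\<^esub> (m::nat)"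
    and gx: "\<And>g. g \<in> G \<Longrightarrow> g [^] m \<otimes> inv x \<in> A"
    using common_power_generator[OF I G] by blast
  have ix: "inv x \<in> carrier F" using inv_nonzero x by blast
  have sub: "I [^]\<^bsub>FS.Inv\<^esub> m \<subseteq> x <# A"
  proof
    fix z assume z: "z \<in> I [^]\<^bsub>FS.Inv\<^esub> m"
    then have zC: "z \<in> carrier F" using FS.smD(1)[OF FS.sm_Inv_power[OF I]] by blast
    have "z \<otimes> inv x \<in> V" if V: "V \<in> Z" for V
    proof -
      note val = Z_valuation[OF V] and sub = Z_subring[OF V]
      \<comment> \<open>Stated for any factor \<open>c\<close>, as it is applied with
        \<open>inv x\<close> for \<open>I\<close> and with powers of \<open>inv x\<close> for the
        powers of \<open>I\<close>.\<close>
      have power_mod: "submodule_of_field F A {y \<in> carrier F. y [^] m \<otimes> c \<in> V}" if c: "c \<in> carrier F" for c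
      proof (rule FS.smI)
        show "\<zero> \<in> {y \<in> carrier F. y [^] m \<otimes> c \<in> V}"
          using m c subringE(2)[OF sub] by (simp add: nat_pow_zero)
        show "w \<oplus> z \<in> {y \<in> carrier F. y [^] m \<otimes> c \<in> V}"
          if "w \<in> {y \<in> carrier F. y [^] m \<otimes> c \<in> V}" "z \<in> {y \<in> carrier F. y [^] m \<otimes> c \<in> V}" for w z
          using that valuation_power_add[OF val _ _ c] by simp
        show "a \<otimes> w \<in> {y \<in> carrier F. y [^] m \<otimes> c \<in> V}"
          if a: "a \<in> A" and w: "w \<in> {y \<in> carrier F. y [^] m \<otimes> c \<in> V}" for a w
        proof -
          have "(a \<otimes> w) [^] m \<otimes> c = a [^] m \<otimes> (w [^] m \<otimes> c)"
            using A_carrier[OF a] w c by (simp add: nat_pow_distrib m_assoc)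
          moreover have "a [^] m \<in> V" using a A_subset[OF V] subring_pow[OF sub] by blast
          ultimately show ?thesis using w A_carrier[OF a] subringE(6)[OF sub] by simp
        qed
      qed auto
      have I_power: "y [^] m \<otimes> inv x \<in> V" if "y \<in> I" for y
      proof -
        have "G \<subseteq> {y \<in> carrier F. y [^] m \<otimes> inv x \<in> V}"
          using gx G(3) FS.smD(1)[OF sI] A_subset[OF V] by auto
        then show ?thesis using gen[OF power_mod[OF ix]] that by blast
      qed
      \<comment> \<open>The exponent \<open>m\<close> is fixed while \<open>k\<close> grows; at
        \<open>k = m\<close> the expression is the power \<open>m\<close> of
        \<open>z \<otimes> inv x\<close>.\<close>
      have "y [^] m \<otimes> inv x [^] k \<in> V" if "y \<in> I [^]\<^bsub>FS.Inv\<^esub> k" for y and k :: nat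
        using that
      proof (induction k arbitrary: y)
        case 0
        then have "y \<in> V" using A_subset[OF V] by (auto simp: FS.Inv_one)
        then show ?case using subring_pow[OF sub] Z_carrier[OF V] by simp
      next
        case (Suc k)
        let ?W = "{y \<in> carrier F. y [^] m \<otimes> inv x [^] Suc k \<in> V}"
        have W: "submodule_of_field F A ?W" using power_mod ix by simp
        have "y \<in> ideal_prod F (I [^]\<^bsub>FS.Inv\<^esub> k) I" using Suc.prems by (simp add: FS.Inv_mult)
        then have "y \<in> ?W"
        proof (rule FS.ideal_prod_least)
          fix i j assume ij: "i \<in> I [^]\<^bsub>FS.Inv\<^esub> k" "j \<in> I"
          have C: "i \<in> carrier F" "j \<in> carrier F"
            using ij FS.smD(1)[OF sI] FS.smD(1)[OF FS.sm_Inv_power[OF I]] by auto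
          have "(i \<otimes> j) [^] m \<otimes> inv x [^] Suc k = (i [^] m \<otimes> inv x [^] k) \<otimes> (j [^] m \<otimes> inv x)"
            using C ix by (simp add: nat_pow_distrib m_ac)
          then show "i \<otimes> j \<in> ?W"
            using subringE(6)[OF sub Suc.IH[OF ij(1)] I_power[OF ij(2)]] C by simp
        qed (rule FS.smD(3)[OF W])
        then show ?case by simp
      qed
      from this[OF z] have "(z \<otimes> inv x) [^] m \<in> V" using zC ix by (simp add: nat_pow_distrib)
      then show ?thesis using valuation_root[OF val _ m] zC ix by simp
    qed
    then have "z \<otimes> inv x \<in> A" by (auto simp: A_def)
    moreover have "z = x \<otimes> (z \<otimes> inv x)" using x zC ix mult_inv_cancel[OF x(1,2) zC] by (simp add: m_comm)
    ultimately show "z \<in> x <# A" by (auto simp: FS.principal_eq)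
  qed
  have "x \<otimes> a \<in> I [^]\<^bsub>FS.Inv\<^esub> m" if "a \<in> A" for a
    using FS.smD(4)[OF FS.sm_Inv_power[OF I] that x(3)] x A_carrier[OF that] by (simp add: m_comm)
  then have "I [^]\<^bsub>FS.Inv\<^esub> m = x <# A" using sub by (auto simp: FS.principal_eq)
  then show "\<exists>n::nat. 0 < n \<and> (\<exists>x\<in>carrier F - {\<zero>}. I [^]\<^bsub>FS.Inv\<^esub> n = x <# A)"
    using m x by blast
qed

end

section \<open>From the Pruefer and torsion properties to nonvanishing polynomials\<close>

lemma (in cring) ideal_in_primeideal:
  assumes I: "ideal I R" and one: "\<one> \<notin> I"
  obtains P where "primeideal P R" "I \<subseteq> P"
proof -
  let ?A = "{J. ideal J R \<and> I \<subseteq> J \<and> \<one> \<notin> J}"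
  have "\<exists>M\<in>?A. \<forall>X\<in>?A. M \<subseteq> X \<longrightarrow> X = M"
  proof (rule subset_Zorn_nonempty)
    show "?A \<noteq> {}" using I one by blast
    fix C assume C: "C \<noteq> {}" "subset.chain ?A C"
    then have "subset.chain {J. ideal J R} C" by (auto simp: pred_on.chain_def)
    then have "ideal (\<Union>C) R" using chain_Union_is_ideal[of C] C(1) by simp
    then show "\<Union>C \<in> ?A" using C by (auto simp: pred_on.chain_def)
  qed
  then obtain M where "M \<in> ?A" and max: "\<forall>X\<in>?A. M \<subseteq> X \<longrightarrow> X = M"
    by (elim bexE) (rule that)
  then have M: "ideal M R" "I \<subseteq> M" "\<one> \<notin> M" by simp_all
  have "maximalideal M R"
  proof (rule maximalidealI)
    show "carrier R \<noteq> M" using M(3) by blast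
    show "J = M \<or> J = carrier R" if J: "ideal J R" "M \<subseteq> J" "J \<subseteq> carrier R" for J
    proof (cases "\<one> \<in> J")
      case True
      then show ?thesis using ideal.one_imp_carrier[OF J(1)] by simp
    next
      case False
      then have "J \<in> ?A" using J(1,2) M(2) by simp
      then show ?thesis using max J(2) by blast
    qed
  qed (rule M(1))
  then show thesis by (rule that[OF maximalideal_prime M(2)])
qed

context zr_setting
begin

text \<open>The inverse is \<open>?J\<close>, the elements of \<open>A\<close> that multiply
  \<open>u\<close> into \<open>A\<close>. If the product were proper, it would lie in a prime
  \<open>P\<close> of \<open>A\<close>. If \<open>u = a / b\<close> with \<open>b\<close> outside
  \<open>P\<close>, then \<open>b\<close> is in \<open>?J\<close> and \<open>1 b\<close> is in the
  product; if \<open>inv u = a / b\<close>, then \<open>a\<close> is in \<open>?J\<close> and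
  \<open>u a = b\<close> is in the product.\<close>

lemma span_invertible:
  assumes pruefer: "pruefer_domain_with_quotient_field A F" and u: "u \<in> carrier F"
  shows "{a \<oplus> b \<otimes> u | a b. a \<in> A \<and> b \<in> A} \<in> carrier (invertible_ideals F A)" (is "?I \<in> _")
proof -
  interpret FS: field_subring F A by (rule field_subring_A)
  note sub = A_subring
  have II: "a \<oplus> b \<otimes> u \<in> ?I" if "a \<in> A" "b \<in> A" for a b using that by blast
  let ?J = "{z \<in> A. z \<otimes> u \<in> A}"
  have I: "submodule_of_field F A ?I"
  proof (rule FS.smI)
    show "?I \<subseteq> carrier F" using u A_carrier by auto
    show "\<zero> \<in> ?I" using II[OF subringE(2)[OF sub] subringE(2)[OF sub]] u by simp
    fix x y assume "x \<in> ?I" "y \<in> ?I"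
    then obtain a b c d where ab: "a \<in> A" "b \<in> A" "x = a \<oplus> b \<otimes> u"
      and cd: "c \<in> A" "d \<in> A" "y = c \<oplus> d \<otimes> u" by blast
    have "x \<oplus> y = (a \<oplus> c) \<oplus> (b \<oplus> d) \<otimes> u"
      using ab cd u A_carrier by (simp add: l_distr a_ac)
    then show "x \<oplus> y \<in> ?I" using II subringE(7)[OF sub] ab(1,2) cd(1,2) by simp
  next
    fix e x assume e: "e \<in> A" and "x \<in> ?I"
    then obtain a b where ab: "a \<in> A" "b \<in> A" "x = a \<oplus> b \<otimes> u" by blast
    have "e \<otimes> x = (e \<otimes> a) \<oplus> (e \<otimes> b) \<otimes> u"
      using ab e u A_carrier by (simp add: r_distr m_assoc)
    then show "e \<otimes> x \<in> ?I" using II subringE(6)[OF sub] ab(1,2) e by simp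
  qed
  have J: "submodule_of_field F A ?J"
  proof (rule FS.smI)
    show "?J \<subseteq> carrier F" using A_carrier by auto
    show "\<zero> \<in> ?J" using u subringE(2)[OF sub] by simp
    show "x \<oplus> y \<in> ?J" if "x \<in> ?J" "y \<in> ?J" for x y
      using that u A_carrier subringE(7)[OF sub] by (simp add: l_distr)
    show "a \<otimes> x \<in> ?J" if "a \<in> A" "x \<in> ?J" for a x
      using that u A_carrier subringE(6)[OF sub] by (simp add: m_assoc)
  qed
  have IJ: "ideal_prod F ?I ?J \<subseteq> A"
  proof
    fix x assume "x \<in> ideal_prod F ?I ?J"
    then show "x \<in> A"
    proof (rule FS.ideal_prod_least)
      fix i z assume "i \<in> ?I" and z: "z \<in> ?J"
      then obtain a b where ab: "a \<in> A" "b \<in> A" "i = a \<oplus> b \<otimes> u" by blast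
      have "i \<otimes> z = a \<otimes> z \<oplus> b \<otimes> (z \<otimes> u)"
        using ab z u A_carrier by (simp add: l_distr m_assoc m_comm[of u z])
      then show "i \<otimes> z \<in> A" using ab z subringE(6,7)[OF sub] by simp
    qed (rule subringE(7)[OF sub])
  qed
  note prod = FS.smD[OF FS.sm_ideal_prod[OF I J]]
  have oneI: "\<one> \<in> ?I" and uI: "u \<in> ?I"
    using II[OF subringE(3)[OF sub] subringE(2)[OF sub]]
      II[OF subringE(2)[OF sub] subringE(3)[OF sub]] u by simp_all
  have "\<one> \<in> ideal_prod F ?I ?J"
  proof (rule ccontr)
    assume none: "\<one> \<notin> ideal_prod F ?I ?J"
    have "ideal (ideal_prod F ?I ?J) RA"
      by (rule P.idealI_cring) (use IJ prod in auto)
    then obtain P where P: "primeideal P RA" "ideal_prod F ?I ?J \<subseteq> P"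
      using P.ideal_in_primeideal none by auto
    interpret P': primeideal P RA by fact
    have val: "valuation_ring (localization_in F A P) F"
      using pruefer P(1) by (simp add: pruefer_domain_with_quotient_field_def)
    have not: "z \<notin> A - P" if "z \<in> ?J \<or> (\<exists>w\<in>?J. z = u \<otimes> w)" for z
      using that P(2) ideal_prod.prod[OF oneI, of z ?J F] ideal_prod.prod[OF uI, of _ ?J F] A_carrier
      by auto
    have nz: "b \<noteq> \<zero>" "b \<in> carrier F" if "b \<in> A - P" for b
      using that P'.zero_closed A_carrier by auto
    show False
    proof (cases "u \<in> localization_in F A P")
      case True
      then obtain a b where ab: "a \<in> A" "b \<in> A - P" "u = a \<otimes> inv b" by (auto simp: localization_in_def)
      then have "u \<otimes> b = a" using eq_divide_iff[OF A_carrier[OF ab(1)] u nz(2,1)[OF ab(2)]] by blast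
      then have "b \<in> ?J" using ab u nz[OF ab(2)] by (simp add: m_comm)
      then show False using not ab(2) by blast
    next
      case False
      have u0: "u \<noteq> \<zero>"
        using False val subringE(2)[of "localization_in F A P" F] by (auto simp: valuation_ring_def)
      then have "inv u \<in> localization_in F A P" using False val u by (auto simp: valuation_ring_def)
      then obtain a b where ab: "a \<in> A" "b \<in> A - P" "inv u = a \<otimes> inv b" by (auto simp: localization_in_def)
      then have "inv u \<otimes> b = a"
        using eq_divide_iff[OF A_carrier[OF ab(1)] _ nz(2,1)[OF ab(2)], of "inv u"] inv_nonzero[OF u u0]
        by blast
      then have b: "b = u \<otimes> a" using mult_inv_cancel[OF u u0 nz(2)[OF ab(2)]] by simp
      then have "a \<in> ?J" using ab u A_carrier[OF ab(1)] by (simp add: m_comm)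
      then show False using not[of b] b ab(2) by blast
    qed
  qed
  then have "A \<subseteq> ideal_prod F ?I ?J" using prod(4) A_carrier by fastforce
  then have "ideal_prod F ?I ?J = A" using IJ by blast
  then show ?thesis using I J by (auto simp: FS.Inv_carrier)
qed

end

context zr_point
begin

text \<open>Multiplication by \<open>a \<oplus> b \<otimes> u\<close> lifts to multiplication by the
  linear form \<open>a T\<^sub>0 + b T\<^sub>1\<close>. The powers of \<open>u\<close> are products
  of \<open>u\<close> and \<open>\<one>\<close>, both in \<open>I\<close>.\<close>

lemma power_span:
  fixes n :: nat
  assumes I: "I = {a \<oplus> b \<otimes> u | a b. a \<in> A \<and> b \<in> A}" and inv: "I \<in> carrier (invertible_ideals F A)"
  shows "I [^]\<^bsub>invertible_ideals F A\<^esub> n \<subseteq> ev ` P.gr n"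
    and "i \<le> n \<Longrightarrow> u [^] i \<in> I [^]\<^bsub>invertible_ideals F A\<^esub> n"
proof -
  interpret FS: field_subring F A by (rule field_subring_A)
  interpret Inv: comm_group FS.Inv by (rule FS.comm_group_Inv)
  show "I [^]\<^bsub>FS.Inv\<^esub> n \<subseteq> ev ` P.gr n"
  proof (induction n)
    case 0
    have "a \<in> ev ` P.gr 0" if "a \<in> A" for a
      using ev_mono[of a 0 0] P.homogeneous_mono[of a 0 0] that A_carrier[OF that]
      by (intro image_eqI[of _ _ "P.mono a 0 0"]) simp_all
    then show ?case by (auto simp: FS.Inv_one)
  next
    case (Suc n)
    show ?case
    proof
      fix x assume "x \<in> I [^]\<^bsub>FS.Inv\<^esub> Suc n"
      then have "x \<in> ideal_prod F (I [^]\<^bsub>FS.Inv\<^esub> n) I" by (simp add: FS.Inv_mult)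
      then show "x \<in> ev ` P.gr (Suc n)"
      proof (rule FS.ideal_prod_least)
        fix y z assume "y \<in> I [^]\<^bsub>FS.Inv\<^esub> n" "z \<in> I"
        then obtain g a b where g: "g \<in> P.gr n" "y = ev g" and ab: "a \<in> A" "b \<in> A" "z = a \<oplus> b \<otimes> u"
          using Suc I by blast
        define l where "l = P.mono a 1 0 \<oplus>\<^bsub>P.S\<^esub> P.mono b 0 1"
        have l: "l \<in> P.gr 1"
          unfolding l_def using P.gr_add[of "P.mono a 1 0" 1 "P.mono b 0 1"] ab
            P.homogeneous_mono[of a 1 0] P.homogeneous_mono[of b 0 1] by simp
        have "ev l = z" unfolding l_def using ab u A_carrier by (simp add: ev_mono)
        then have "y \<otimes> z = ev (g \<otimes>\<^bsub>P.S\<^esub> l)" using g P.gr_carrier[OF g(1)] P.gr_carrier[OF l] by simp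
        then show "y \<otimes> z \<in> ev ` P.gr (Suc n)" using P.gr_mult[OF g(1) l] by auto
      next
        fix y z assume "y \<in> ev ` P.gr (Suc n)" "z \<in> ev ` P.gr (Suc n)"
        then obtain g h where gh: "g \<in> P.gr (Suc n)" "y = ev g" "h \<in> P.gr (Suc n)" "z = ev h" by blast
        then have "y \<oplus> z = ev (g \<oplus>\<^bsub>P.S\<^esub> h)" using P.gr_carrier by simp
        then show "y \<oplus> z \<in> ev ` P.gr (Suc n)" using P.gr_add gh by blast
      qed
    qed
  qed
  note A01 = subringE(2,3)[OF A_subring]
  have "\<one> \<oplus> \<zero> \<otimes> u \<in> I" "\<zero> \<oplus> \<one> \<otimes> u \<in> I" unfolding I using A01 by blast+
  then have 1: "\<one> \<in> I [^]\<^bsub>FS.Inv\<^esub> (1::nat)" "u \<in> I [^]\<^bsub>FS.Inv\<^esub> (1::nat)"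
    using Inv.nat_pow_eone[OF inv] u by simp_all
  show "u [^] i \<in> I [^]\<^bsub>FS.Inv\<^esub> n" if "i \<le> n"
    using FS.prod_in_Inv_power[OF inv FS.pow_in_Inv_power[OF inv 1(2), of i]
        FS.pow_in_Inv_power[OF inv 1(1), of "n - i"]] u that by simp
qed

end

text \<open>A monomial of positive degree is divisible by one of the variables. Consequently every
  point of Proj misses \<open>T0\<close> or \<open>T1\<close>, and the two charts cover the
  line.\<close>

lemma (in poly2_domain) positive_degree_in_ideal:
  assumes "ideal Q S" "T0 \<in> Q" "T1 \<in> Q" "f \<in> gr d" "0 < d"
  shows "f \<in> Q"
  using assms(4)
proof (rule homogeneous_induct)
  interpret Q: ideal Q S by fact
  show "\<zero>\<^bsub>S\<^esub> \<in> Q" by (rule Q.zero_closed)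
  show "x \<oplus>\<^bsub>S\<^esub> y \<in> Q" if "x \<in> Q" "y \<in> Q" for x y using that by (rule Q.a_closed)
  fix c and i j :: nat assume c: "c \<in> carrier R" and ij: "i + j = d"
  show "mono c i j \<in> Q"
  proof (cases i)
    case 0
    then obtain k where "j = Suc k" using ij assms(5) by (cases j) auto
    then have "mono c i j = mono c i k \<otimes>\<^bsub>S\<^esub> T1" using c by (simp add: mono_mult)
    then show ?thesis using Q.I_l_closed[OF assms(3)] c by simp
  next
    case (Suc k)
    then have "mono c i j = mono c k j \<otimes>\<^bsub>S\<^esub> T0" using c by (simp add: mono_mult)
    then show ?thesis using Q.I_l_closed[OF assms(2)] c by simp
  qed
qed

lemma (in poly2_domain) pure_power_notin_prime:
  assumes "primeideal Q S"
  shows "T0 \<notin> Q \<Longrightarrow> mono \<one> n 0 \<notin> Q" "T1 \<notin> Q \<Longrightarrow> mono \<one> 0 n \<notin> Q"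
proof -
  interpret Q: primeideal Q S by fact
  have one: "mono \<one> 0 0 \<notin> Q" using one_notin[OF assms] by (simp add: one_mono)
  show "mono \<one> n 0 \<notin> Q" if "T0 \<notin> Q"
  proof (induction n)
    case (Suc n)
    have "mono \<one> (Suc n) 0 = T0 \<otimes>\<^bsub>S\<^esub> mono \<one> n 0" by (simp add: mono_mult)
    then show ?case using Suc that Q.I_prime[of T0 "mono \<one> n 0"] by auto
  qed (use one in simp)
  show "mono \<one> 0 n \<notin> Q" if "T1 \<notin> Q"
  proof (induction n)
    case (Suc n)
    have "mono \<one> 0 (Suc n) = T1 \<otimes>\<^bsub>S\<^esub> mono \<one> 0 n" by (simp add: mono_mult)
    then show ?case using Suc that Q.I_prime[of T1 "mono \<one> 0 n"] by auto
  qed (use one in simp)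
qed

lemma (in poly2_domain) const_hom: "(\<lambda>a. mono a 0 0) \<in> ring_hom R S"
proof (rule ring_hom_memI)
  fix a b assume "a \<in> carrier R" "b \<in> carrier R"
  then show "mono (a \<otimes> b) 0 0 = mono a 0 0 \<otimes>\<^bsub>S\<^esub> mono b 0 0"
    "mono (a \<oplus> b) 0 0 = mono a 0 0 \<oplus>\<^bsub>S\<^esub> mono b 0 0"
    by (simp_all only: mono_mult) (simp_all add: mono_def)
qed (simp_all add: one_mono)

section \<open>Morphisms to the projective line\<close>

locale zr_map = zr_setting +
  fixes \<phi> assumes \<phi>: "zr_P1_morphism F D Z A \<phi>"
begin

abbreviation "q \<equiv> pt \<phi>"

lemma lrs: "lrs_morphism ZS (P1 RA) \<phi>"
  and commutes: "commutes_over ZS (P1 RA) (Spec RA) (zr_to_spec F A) (P1_to_spec RA) \<phi>"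
  using \<phi> by (simp_all add: zr_P1_morphism_def Let_def)

lemma preim_phi: "preim ZS \<phi> U = {V \<in> Z. q V \<in> U}"
  by (auto simp: preim_def topspace_ZS)

lemma continuous_q: "continuous_map (space_top ZS) (proj_top P.S P.gr) q"
  using lrs by (simp add: lrs_morphism_def P1_simps)

lemma q_proj: "V \<in> Z \<Longrightarrow> q V \<in> proj_points P.S P.gr"
  using continuous_map_image_subset_topspace[OF continuous_q] by (auto simp: P.topspace_proj topspace_ZS)

lemma q_prime: "V \<in> Z \<Longrightarrow> primeideal (q V) P.S"
  using q_proj P.proj_point_prime by blast

lemma openin_preim_phi:
  "openin (proj_top P.S P.gr) U \<Longrightarrow> openin (space_top ZS) {V \<in> Z. q V \<in> U}"
  using openin_continuous_map_preimage[OF continuous_q] by (simp add: topspace_ZS)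

lemma q_F_in:
  assumes "openin (proj_top P.S P.gr) U" "V \<in> Z" "q V \<in> U"
  shows "q (carrier F) \<in> U"
  using F_in_open[OF openin_preim_phi[OF assms(1)]] assms(2,3) by blast

lemma pull_hom:
  assumes U: "openin (proj_top P.S P.gr) U"
  shows "pull \<phi> U \<in> ring_hom (proj_sections P.S P.gr U) (sections ZS {V \<in> Z. q V \<in> U})"
  using lrs U by (simp add: lrs_morphism_def P1_simps preim_phi)

text \<open>The preimage of \<open>W\<close> contains the generic point, so restriction on
  \<open>Z\<close> does not change the element of \<open>F\<close>.\<close>

lemma pull_restrict:
  assumes U: "openin (proj_top P.S P.gr) U" and W: "openin (proj_top P.S P.gr) W" "W \<subseteq> U"
    and t: "t \<in> carrier (proj_sections P.S P.gr U)" and F: "q (carrier F) \<in> W"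
  shows "pull \<phi> W (restrict t W) = pull \<phi> U t"
proof -
  have "restr ZS {V \<in> Z. q V \<in> U} {V \<in> Z. q V \<in> W} (pull \<phi> U t) = pull \<phi> W (restrict t W)"
    using lrs U W t by (simp add: lrs_morphism_def P1_simps preim_phi)
  moreover have "{V \<in> Z. q V \<in> W} \<noteq> {}" using F F_in_Z by blast
  ultimately show ?thesis using restr_ZS by simp
qed

text \<open>The place where \<open>\<phi>\<close> being a morphism of locally ringed spaces, and not
  only of ringed spaces, enters.\<close>

lemma pull_loc_max:
  assumes V: "V \<in> Z" and U: "openin (proj_top P.S P.gr) U" "q V \<in> U"
    and t: "t \<in> carrier (proj_sections P.S P.gr U)" "t (q V) \<in> P.loc_max (q V)"
  shows "pull \<phi> U t \<in> val_max F V"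
proof -
  have Y: "stalk_values (P1 RA) (q V) (P.loc (q V)) (\<lambda>U s. s (q V)) (P.loc_max (q V))"
    using P.stalk_values_Proj[OF q_proj[OF V]] by (simp add: P1_def)
  have loc: "local_hom (stalk (P1 RA) (q V)) (stalk ZS V) (stalk_map ZS \<phi> V)"
    using lrs V by (simp add: lrs_morphism_def topspace_ZS)
  show ?thesis
    by (rule local_hom_stalk_mapD[OF stalk_values_ZS[OF V] Y loc])
      (use U t openin_preim_phi ring_hom_closed[OF pull_hom[OF U(1)] t(1)] in \<open>simp_all add: P1_simps preim_phi\<close>)
qed

context
  fixes U assumes U: "openin (proj_top P.S P.gr) U" and FU: "q (carrier F) \<in> U"
begin

lemma pull_sections: "sections ZS {V \<in> Z. q V \<in> U} = F\<lparr>carrier := \<Inter>{V \<in> Z. q V \<in> U}\<rparr>"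
  using FU F_in_Z by (intro sections_ZS) blast

lemma pull_carrier: "t \<in> carrier (proj_sections P.S P.gr U) \<Longrightarrow> pull \<phi> U t \<in> carrier F"
  using ring_hom_closed[OF pull_hom[OF U], of t] FU F_in_Z unfolding pull_sections by auto

lemma pull_mult:
  assumes "s \<in> carrier (proj_sections P.S P.gr U)" "t \<in> carrier (proj_sections P.S P.gr U)"
  shows "pull \<phi> U (\<lambda>Q\<in>U. s Q \<otimes>\<^bsub>P.loc Q\<^esub> t Q) = pull \<phi> U s \<otimes> pull \<phi> U t"
  using ring_hom_mult[OF pull_hom[OF U] assms] unfolding pull_sections
  by (simp add: proj_sections_def pointwise_ring_def)

lemma pull_add:
  assumes "s \<in> carrier (proj_sections P.S P.gr U)" "t \<in> carrier (proj_sections P.S P.gr U)"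
  shows "pull \<phi> U (\<lambda>Q\<in>U. s Q \<oplus>\<^bsub>P.loc Q\<^esub> t Q) = pull \<phi> U s \<oplus> pull \<phi> U t"
  using ring_hom_add[OF pull_hom[OF U] assms] unfolding pull_sections
  by (simp add: proj_sections_def pointwise_ring_def)

text \<open>Here compatibility with the maps to \<open>Spec A\<close> enters. It is applied to the
  global section \<open>c\<close> of \<open>Spec A\<close>, which becomes \<open>c / 1\<close> on
  the projective line and \<open>c\<close> on \<open>Z\<close>; the result is then restricted to
  \<open>U\<close>.\<close>

lemma pull_const:
  assumes c: "c \<in> A"
  shows "pull \<phi> U (\<lambda>Q\<in>U. P.ratio Q (P.mono c 0 0) (P.mono \<one> 0 0)) = c"
proof -
  let ?X = "proj_points P.S P.gr"
  let ?W = "{Q. primeideal Q RA}"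
  let ?s = "\<lambda>Q\<in>?W. fraction RA (A - Q) c \<one>"
  let ?t = "\<lambda>Q\<in>?X. P.ratio Q (P.mono c 0 0) (P.mono \<one> 0 0)"
  have oA: "\<one> \<in> A" and zA: "\<zero> \<in> A" using subringE(2,3)[OF A_subring] by auto
  have W: "openin (spec_top RA) ?W"
    using openin_topspace[of "spec_top RA"] by (simp add: P.topspace_spec)
  have oQ: "\<one> \<in> A - Q" if "primeideal Q RA" for Q
    using primeideal.I_notcarr[OF that] ideal.one_imp_carrier[OF primeideal.axioms(1)[OF that]] oA by auto
  have X: "openin (proj_top P.S P.gr) ?X"
    using openin_topspace[of "proj_top P.S P.gr"] by (simp add: P.topspace_proj)
  have const_notin: "P.mono \<one> 0 0 \<notin> Q" if "Q \<in> ?X" for Q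
    using P.one_notin[OF P.proj_point_prime[OF that]] by (simp add: P.one_mono)
  have hf: "P.hfrac Q 0 (P.mono c 0 0) (P.mono \<one> 0 0)" if "Q \<in> ?X" for Q
    using const_notin[OF that] P.homogeneous_mono[of c 0 0] P.homogeneous_mono[of \<one> 0 0] c oA
    by (simp add: P.hfrac_def)
  have t: "?t \<in> carrier (proj_sections P.S P.gr ?X)"
    by (rule P.proj_section_const[OF X hf])
  have s: "?s \<in> carrier (spec_sections RA ?W)"
  proof -
    have "?s \<in> (\<Pi>\<^sub>E Q\<in>?W. carrier (local_ring_at RA Q))"
      using oQ c by (auto simp: local_ring_at_def localization_def)
    moreover have "\<forall>P\<in>?W. \<exists>V. openin (spec_top RA) V \<and> P \<in> V \<and> V \<subseteq> ?W \<and>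
        (\<exists>a\<in>A. \<exists>f\<in>A. \<forall>Q\<in>V. f \<notin> Q \<and> ?s Q = fraction RA (A - Q) a f)"
    proof
      fix P assume "P \<in> ?W"
      moreover have "\<forall>Q\<in>?W. \<one> \<notin> Q \<and> ?s Q = fraction RA (A - Q) c \<one>" using oQ by simp
      ultimately show "\<exists>V. openin (spec_top RA) V \<and> P \<in> V \<and> V \<subseteq> ?W \<and>
        (\<exists>a\<in>A. \<exists>f\<in>A. \<forall>Q\<in>V. f \<notin> Q \<and> ?s Q = fraction RA (A - Q) a f)"
        using W oA c by (intro exI[of _ ?W] conjI bexI[of _ c] bexI[of _ \<one>]) simp_all
    qed
    ultimately show ?thesis unfolding spec_sections_def pointwise_ring_def by simp
  qed
  have mem: "(a, b) \<in> ?s Q \<longleftrightarrow> a \<in> A \<and> b \<in> A - Q \<and> b \<otimes> c = a" if Q: "Q \<in> ?W" for Q a b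
  proof -
    have "(a, b) \<in> fraction RA (A - Q) c \<one> \<longleftrightarrow> a \<in> A \<and> b \<in> A - Q \<and> b \<otimes> c = \<one> \<otimes> a"
      using fraction_set.mem_fraction[OF fraction_set_spec, of Q c \<one> a b] Q c oQ by simp
    then show ?thesis using Q A_carrier by auto
  qed
  have zero: "{\<zero>} \<in> ?W" using P.zeroprimeideal by simp
  have "pull (zr_to_spec F A) ?W ?s = c \<otimes> inv \<one>"
  proof (rule pull_zr_to_spec)
    show "(c, \<one>) \<in> ?s {\<zero>}" using mem[OF zero] c oA A_carrier one_not_zero by simp
    show "c \<otimes> inv \<one> \<otimes> b = a" if "Q \<in> ?W" "(a, b) \<in> ?s Q" for Q a b
      using mem[OF that(1)] that(2) c A_carrier by (auto simp: m_comm)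
  qed (use zero c A_carrier in auto)
  then have lhs: "pull (zr_to_spec F A) ?W ?s = c" using A_carrier[OF c] by simp
  have pi_prime: "pt (P1_to_spec RA) Q \<in> ?W" if Q: "Q \<in> ?X" for Q
  proof -
    interpret Q: primeideal Q P.S by (rule P.proj_point_prime[OF Q])
    interpret const: ring_hom_ring RA P.S "\<lambda>a. P.mono a 0 0"
      by (rule ring_hom_ringI2[OF P.ring_axioms P.S.P.ring_axioms P.const_hom])
    have eq: "pt (P1_to_spec RA) Q = {a \<in> A. P.mono a 0 0 \<in> Q}"
      by (simp add: P1_to_spec_def proj_to_spec_def P.const_mono)
    have "primeideal {a \<in> A. P.mono a 0 0 \<in> Q} RA"
    proof (rule primeidealI)
      show "ideal {a \<in> A. P.mono a 0 0 \<in> Q} RA"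
        using const.ideal_vimage[OF Q.ideal_axioms] by simp
      show "cring RA" by (rule P.is_cring)
      show "carrier RA \<noteq> {a \<in> A. P.mono a 0 0 \<in> Q}" using oA const_notin[OF Q] by auto
      show "a \<in> {a \<in> A. P.mono a 0 0 \<in> Q} \<or> b \<in> {a \<in> A. P.mono a 0 0 \<in> Q}"
        if "a \<in> carrier RA" "b \<in> carrier RA" "a \<otimes>\<^bsub>RA\<^esub> b \<in> {a \<in> A. P.mono a 0 0 \<in> Q}" for a b
        using that Q.I_prime[of "P.mono a 0 0" "P.mono b 0 0"] by (simp add: P.mono_mult)
    qed
    then show ?thesis by (simp add: eq)
  qed
  have pre: "preim (P1 RA) (P1_to_spec RA) ?W = ?X"
    using pi_prime by (auto simp: preim_def P1_simps P.topspace_proj)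
  have pull_q: "pull (P1_to_spec RA) ?W ?s = ?t"
  proof
    fix Q
    show "pull (P1_to_spec RA) ?W ?s Q = ?t Q"
    proof (cases "Q \<in> ?X")
      case True
      let ?p = "pt (P1_to_spec RA) Q"
      have p: "?p = {a \<in> A. P.mono a 0 0 \<in> Q}"
        by (simp add: P1_to_spec_def proj_to_spec_def P.const_mono)
      have eq: "P.ratio Q (P.mono a 0 0) (P.mono b 0 0) = P.ratio Q (P.mono c 0 0) (P.mono \<one> 0 0)"
        if "(a, b) \<in> ?s ?p" for a b
      proof -
        have ab: "a \<in> A" "b \<in> A" "P.mono b 0 0 \<notin> Q" "b \<otimes> c = a"
          using that mem[OF pi_prime[OF True]] p by auto
        have h: "P.hfrac Q 0 (P.mono a 0 0) (P.mono b 0 0)"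
          using ab P.homogeneous_mono[of a 0 0] P.homogeneous_mono[of b 0 0] by (simp add: P.hfrac_def)
        show ?thesis
          unfolding P.frac_eq_iff[OF P.proj_point_prime[OF True] h hf[OF True]]
          using ab c oA A_carrier by (simp add: P.mono_mult)
      qed
      have "(c, \<one>) \<in> ?s ?p" using mem[OF pi_prime[OF True]] oQ pi_prime[OF True] c A_carrier[OF c] by simp
      moreover have "(\<Union>(a, b)\<in>?s ?p. P.ratio Q (P.mono a 0 0) (P.mono b 0 0)) =
          (\<Union>_\<in>?s ?p. P.ratio Q (P.mono c 0 0) (P.mono \<one> 0 0))"
        by (rule SUP_cong[OF refl]) (metis (no_types, lifting) case_prod_conv eq surj_pair)
      ultimately have "(\<Union>(a, b)\<in>?s ?p. P.ratio Q (P.mono a 0 0) (P.mono b 0 0)) =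
          P.ratio Q (P.mono c 0 0) (P.mono \<one> 0 0)" by auto
      moreover have "pull (P1_to_spec RA) ?W ?s Q =
          (\<Union>(a, b)\<in>?s ?p. P.ratio Q (P.mono a 0 0) (P.mono b 0 0))"
        using True pi_prime[OF True] unfolding P1_to_spec_def proj_to_spec_def Let_def
        by (simp add: P.const_mono)
      ultimately show ?thesis using True by simp
    next
      case False
      then show ?thesis by (simp add: P1_to_spec_def proj_to_spec_def)
    qed
  qed
  have "\<forall>W. openin (spec_top RA) W \<longrightarrow> (\<forall>s\<in>carrier (spec_sections RA W).
      pull (zr_to_spec F A) W s = pull \<phi> (preim (P1 RA) (P1_to_spec RA) W) (pull (P1_to_spec RA) W s))"
    using commutes unfolding commutes_over_def by (simp add: Spec_def)
  then have "pull (zr_to_spec F A) ?W ?s =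
      pull \<phi> (preim (P1 RA) (P1_to_spec RA) ?W) (pull (P1_to_spec RA) ?W ?s)"
    using W s by blast
  then have "pull (zr_to_spec F A) ?W ?s = pull \<phi> ?X ?t" unfolding pre pull_q .
  then have "pull \<phi> ?X ?t = c" using lhs by simp
  moreover have UX: "U \<subseteq> ?X" using P.openin_proj_subset[OF U] by blast
  moreover have "restrict ?t U = (\<lambda>Q\<in>U. P.ratio Q (P.mono c 0 0) (P.mono \<one> 0 0))"
    using UX by (intro restrict_ext) auto
  ultimately show ?thesis using pull_restrict[OF X U UX t FU] by simp
qed

end

end

section \<open>The two standard charts and the pullback of forms\<close>

context zr_map
begin

definition U0 :: "'a poly2 set set" where "U0 = {Q \<in> proj_points P.S P.gr. P.T0 \<notin> Q}"
definition U1 :: "'a poly2 set set" where "U1 = {Q \<in> proj_points P.S P.gr. P.T1 \<notin> Q}"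

lemma T_closed: "P.T0 \<in> carrier P.S" "P.T1 \<in> carrier P.S"
  using P.T_homogeneous P.gr_carrier by blast+

lemma openin_U: "openin (proj_top P.S P.gr) U0" "openin (proj_top P.S P.gr) U1"
  unfolding U0_def U1_def using P.openin_proj_basic T_closed by blast+

lemma U_prime: "Q \<in> U0 \<Longrightarrow> primeideal Q P.S" "Q \<in> U1 \<Longrightarrow> primeideal Q P.S"
  using P.proj_point_prime by (auto simp: U0_def U1_def)

lemma one_A: "\<one> \<in> carrier RA"
  using subringE(3)[OF A_subring] by simp

lemma hfrac0: "Q \<in> U0 \<Longrightarrow> f \<in> P.gr n \<Longrightarrow> P.hfrac Q n f (P.mono \<one> n 0)"
  using P.pure_power_notin_prime(1)[OF U_prime(1)] P.homogeneous_mono[OF one_A, of n 0]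
  by (auto simp: P.hfrac_def U0_def)

lemma hfrac1: "Q \<in> U1 \<Longrightarrow> f \<in> P.gr n \<Longrightarrow> P.hfrac Q n f (P.mono \<one> 0 n)"
  using P.pure_power_notin_prime(2)[OF U_prime(2)] P.homogeneous_mono[OF one_A, of 0 n]
  by (auto simp: P.hfrac_def U1_def)

lemma proj_point_cases:
  assumes "V \<in> Z"
  shows "q V \<in> U0 \<or> q V \<in> U1"
proof (rule ccontr)
  assume "\<not> ?thesis"
  then have "P.T0 \<in> q V" "P.T1 \<in> q V" using q_proj[OF assms] by (auto simp: U0_def U1_def)
  then have "\<And>f d. f \<in> P.gr d \<Longrightarrow> 0 < d \<Longrightarrow> f \<in> q V"
    using P.positive_degree_in_ideal[OF primeideal.axioms(1)[OF q_prime[OF assms]]] by blast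
  then show False using q_proj[OF assms] by (auto simp: proj_points_def)
qed

definition sec0 :: "nat \<Rightarrow> 'a poly2 \<Rightarrow> 'a poly2 set \<Rightarrow> ('a poly2 \<times> 'a poly2) set" where
  "sec0 n f = (\<lambda>Q\<in>U0. P.ratio Q f (P.mono \<one> n 0))"
definition sec1 :: "nat \<Rightarrow> 'a poly2 \<Rightarrow> 'a poly2 set \<Rightarrow> ('a poly2 \<times> 'a poly2) set" where
  "sec1 n f = (\<lambda>Q\<in>U1. P.ratio Q f (P.mono \<one> 0 n))"

lemma sec0_section: "f \<in> P.gr n \<Longrightarrow> sec0 n f \<in> carrier (proj_sections P.S P.gr U0)"
  unfolding sec0_def using P.proj_section_const[OF openin_U(1)] hfrac0 by blast

lemma sec1_section: "f \<in> P.gr n \<Longrightarrow> sec1 n f \<in> carrier (proj_sections P.S P.gr U1)"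
  unfolding sec1_def using P.proj_section_const[OF openin_U(2)] hfrac1 by blast

context
  assumes FU: "q (carrier F) \<in> U0"
begin

definition u :: 'a where "u = pull \<phi> U0 (sec0 1 P.T1)"

lemma u_carrier: "u \<in> carrier F"
  unfolding u_def by (rule pull_carrier[OF openin_U(1) FU sec0_section[OF P.T_homogeneous(2)]])

interpretation zr_point F D A Z u
  by unfold_locales (rule u_carrier)

text \<open>On this chart \<open>f\<close> divided by the power \<open>n\<close> of
  \<open>T0\<close> is a polynomial in \<open>T1 / T0\<close> with coefficients in \<open>A\<close>.
  The pullback is a ring homomorphism that fixes \<open>A\<close> and sends \<open>T1 / T0\<close>
  to \<open>u\<close>.\<close>

lemma pull_sec0: "f \<in> P.gr n \<Longrightarrow> pull \<phi> U0 (sec0 n f) = ev f"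
proof (erule P.homogeneous_step_induct[where Q="\<lambda>n f. pull \<phi> U0 (sec0 n f) = ev f"])
  note pull_add = pull_add[OF openin_U(1) FU] and pull_mult = pull_mult[OF openin_U(1) FU]
  have add: "pull \<phi> U0 (sec0 d (f \<oplus>\<^bsub>P.S\<^esub> g)) = pull \<phi> U0 (sec0 d f) \<oplus> pull \<phi> U0 (sec0 d g)"
    if f: "f \<in> P.gr d" and g: "g \<in> P.gr d" for f g d
  proof -
    have "sec0 d (f \<oplus>\<^bsub>P.S\<^esub> g) = (\<lambda>Q\<in>U0. sec0 d f Q \<oplus>\<^bsub>P.loc Q\<^esub> sec0 d g Q)"
      unfolding sec0_def
      by (rule restrict_ext) (simp add: P.loc_add_same[OF U_prime(1) hfrac0 hfrac0] f g)
    then show ?thesis using pull_add[OF sec0_section[OF f] sec0_section[OF g]] by simp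
  qed
  \<comment> \<open>Additivity gives \<open>r = r \<oplus> r\<close> for this value, hence
    \<open>r = \<zero>\<close>.\<close>
  show "pull \<phi> U0 (sec0 d \<zero>\<^bsub>P.S\<^esub>) = ev \<zero>\<^bsub>P.S\<^esub>" for d
    using add[OF P.gr_zero P.gr_zero, of d] pull_carrier[OF openin_U(1) FU sec0_section[OF P.gr_zero, of d]]
    by simp
  show "pull \<phi> U0 (sec0 0 (P.mono c 0 0)) = ev (P.mono c 0 0)" if "c \<in> carrier RA" for c
    using pull_const[OF openin_U(1) FU, of c] that A_carrier by (simp add: sec0_def ev_mono)
  fix d f assume f: "f \<in> P.gr d" and IH: "pull \<phi> U0 (sec0 d f) = ev f"
  have fS: "f \<in> carrier P.S" using P.gr_carrier[OF f] .
  have pS: "P.mono \<one> d 0 \<in> carrier P.S" using one_A by simp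
  have pd: "P.mono \<one> (Suc d) 0 = P.T0 \<otimes>\<^bsub>P.S\<^esub> P.mono \<one> d 0"
    using P.mono_mult[OF one_A one_A, of 1 0 d 0] by simp
  have ev_T: "ev P.T0 = \<one>" "ev P.T1 = u"
    using one_A u_carrier by (simp_all add: ev_mono)
  have T0f: "P.T0 \<otimes>\<^bsub>P.S\<^esub> f \<in> P.gr (Suc d)" and T1f: "P.T1 \<otimes>\<^bsub>P.S\<^esub> f \<in> P.gr (Suc d)"
    using P.gr_mult[OF P.T_homogeneous(1) f] P.gr_mult[OF P.T_homogeneous(2) f] by simp_all
  \<comment> \<open>Multiplication by \<open>T0\<close> raises numerator and denominator alike, so
    the section does not change; on the other side \<open>ev P.T0\<close> is
    \<open>\<one>\<close>.\<close>
  have "sec0 (Suc d) (P.T0 \<otimes>\<^bsub>P.S\<^esub> f) = sec0 d f"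
    unfolding sec0_def
  proof (rule restrict_ext)
    fix Q assume Q: "Q \<in> U0"
    show "P.ratio Q (P.T0 \<otimes>\<^bsub>P.S\<^esub> f) (P.mono \<one> (Suc d) 0) = P.ratio Q f (P.mono \<one> d 0)"
      unfolding P.frac_eq_iff[OF U_prime(1)[OF Q] hfrac0[OF Q T0f] hfrac0[OF Q f]]
      unfolding pd
      using fS pS T_closed by (simp add: P.S.P.m_ac)
  qed
  then show "pull \<phi> U0 (sec0 (Suc d) (P.T0 \<otimes>\<^bsub>P.S\<^esub> f)) = ev (P.T0 \<otimes>\<^bsub>P.S\<^esub> f)"
    using IH fS T_closed ev_T by simp
  have sec_value: "sec0 (Suc d) (P.T1 \<otimes>\<^bsub>P.S\<^esub> f) Q = sec0 1 P.T1 Q \<otimes>\<^bsub>P.loc Q\<^esub> sec0 d f Q"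
    if Q: "Q \<in> U0" for Q
    using P.loc_mult[OF U_prime(1)[OF Q] hfrac0[OF Q P.T_homogeneous(2)] hfrac0[OF Q f]] Q
    unfolding sec0_def by (simp add: pd)
  have "sec0 (Suc d) (P.T1 \<otimes>\<^bsub>P.S\<^esub> f) = restrict (sec0 (Suc d) (P.T1 \<otimes>\<^bsub>P.S\<^esub> f)) U0"
    by (simp add: sec0_def)
  also have "\<dots> = (\<lambda>Q\<in>U0. sec0 1 P.T1 Q \<otimes>\<^bsub>P.loc Q\<^esub> sec0 d f Q)"
    by (rule restrict_ext) (rule sec_value)
  finally have "sec0 (Suc d) (P.T1 \<otimes>\<^bsub>P.S\<^esub> f) = (\<lambda>Q\<in>U0. sec0 1 P.T1 Q \<otimes>\<^bsub>P.loc Q\<^esub> sec0 d f Q)" .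
  then have "pull \<phi> U0 (sec0 (Suc d) (P.T1 \<otimes>\<^bsub>P.S\<^esub> f)) = u \<otimes> ev f"
    using pull_mult[OF sec0_section[OF P.T_homogeneous(2)] sec0_section[OF f]]
    unfolding IH u_def[symmetric] by argo
  moreover have "ev (P.T1 \<otimes>\<^bsub>P.S\<^esub> f) = u \<otimes> ev f" using fS T_closed ev_T by simp
  ultimately show "pull \<phi> U0 (sec0 (Suc d) (P.T1 \<otimes>\<^bsub>P.S\<^esub> f)) = ev (P.T1 \<otimes>\<^bsub>P.S\<^esub> f)"
    by simp
  show "pull \<phi> U0 (sec0 d (f \<oplus>\<^bsub>P.S\<^esub> g)) = ev (f \<oplus>\<^bsub>P.S\<^esub> g)"
    if "g \<in> P.gr d" "pull \<phi> U0 (sec0 d g) = ev g" for g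
    using add[OF f that(1)] IH that fS P.gr_carrier by simp
qed

text \<open>On the overlap the function of \<open>f\<close> on the second chart times the power
  \<open>n\<close> of \<open>T1 / T0\<close> is the function of \<open>f\<close> on the first chart.
  All three pullbacks are unaffected by restriction to the overlap.\<close>

lemma pull_sec1:
  assumes f: "f \<in> P.gr n" and FU1: "q (carrier F) \<in> U1"
  shows "pull \<phi> U1 (sec1 n f) \<otimes> u [^] n = ev f"
proof -
  let ?U = "U0 \<inter> U1"
  let ?T = "P.mono \<one> 0 n"
  have U: "openin (proj_top P.S P.gr) ?U" using openin_U by blast
  have F: "q (carrier F) \<in> ?U" using FU FU1 by blast
  have T: "?T \<in> P.gr n" using P.homogeneous_mono[OF one_A, of 0 n] by simp
  have C: "?T \<in> carrier P.S" "f \<in> carrier P.S" "P.mono \<one> n 0 \<in> carrier P.S"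
    using one_A P.gr_carrier[OF f] by simp_all
  have product: "(\<lambda>Q\<in>?U. restrict (sec1 n f) ?U Q \<otimes>\<^bsub>P.loc Q\<^esub> restrict (sec0 n ?T) ?U Q) = restrict (sec0 n f) ?U"
  proof (rule restrict_ext)
    fix Q assume Q: "Q \<in> ?U"
    then have Q': "Q \<in> U0" "Q \<in> U1" by auto
    note h = hfrac1[OF Q'(2) f] hfrac0[OF Q'(1) T] and p = U_prime(1)[OF Q'(1)]
    have "P.ratio Q f ?T \<otimes>\<^bsub>P.loc Q\<^esub> P.ratio Q ?T (P.mono \<one> n 0) = P.ratio Q f (P.mono \<one> n 0)"
      unfolding P.loc_mult[OF p h] P.frac_eq_iff[OF p P.hfrac_mult[OF p h] hfrac0[OF Q'(1) f]]
      using C by (simp add: P.S.P.m_ac)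
    then show "restrict (sec1 n f) ?U Q \<otimes>\<^bsub>P.loc Q\<^esub> restrict (sec0 n ?T) ?U Q = sec0 n f Q"
      using Q' by (simp add: sec0_def sec1_def)
  qed
  have secs: "restrict (sec1 n f) ?U \<in> carrier (proj_sections P.S P.gr ?U)"
    "restrict (sec0 n ?T) ?U \<in> carrier (proj_sections P.S P.gr ?U)"
    using P.proj_section_restrict[OF openin_U(2) U _ sec1_section[OF f]]
      P.proj_section_restrict[OF openin_U(1) U _ sec0_section[OF T]] by auto
  have "pull \<phi> ?U (restrict (sec0 n f) ?U) =
      pull \<phi> ?U (restrict (sec1 n f) ?U) \<otimes> pull \<phi> ?U (restrict (sec0 n ?T) ?U)"
    using pull_mult[OF U F secs] unfolding product .
  moreover have "pull \<phi> ?U (restrict (sec0 n f) ?U) = ev f"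
    using pull_restrict[OF openin_U(1) U _ sec0_section[OF f] F] pull_sec0[OF f] by simp
  moreover have "pull \<phi> ?U (restrict (sec0 n ?T) ?U) = u [^] n"
    using pull_restrict[OF openin_U(1) U _ sec0_section[OF T] F] pull_sec0[OF T] u_carrier one_A
    by (simp add: ev_mono)
  moreover have "pull \<phi> ?U (restrict (sec1 n f) ?U) = pull \<phi> U1 (sec1 n f)"
    using pull_restrict[OF openin_U(2) U _ sec1_section[OF f] F] by simp
  ultimately show ?thesis by simp
qed

lemma nonvanishing_generic:
  assumes pruefer: "pruefer_domain_with_quotient_field A F" and torsion: "torsion_group (picard_group F A)"
  obtains n :: nat and f where "0 < n" "f \<in> P.gr n" "f \<noteq> \<zero>\<^bsub>P.S\<^esub>" "\<And>V. V \<in> Z \<Longrightarrow> f \<notin> q V"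
proof -
  interpret FS: field_subring F A by (rule field_subring_A)
  define I where "I = {a \<oplus> b \<otimes> u | a b. a \<in> A \<and> b \<in> A}"
  have I: "I \<in> carrier FS.Inv" unfolding I_def by (rule span_invertible[OF pruefer u_carrier])
  obtain n :: nat and x where n: "0 < n" and x: "x \<in> carrier F" "x \<noteq> \<zero>" "I [^]\<^bsub>FS.Inv\<^esub> n = x <# A"
    using torsion I unfolding FS.torsion_picard_iff by blast
  have "x \<otimes> \<one> \<in> x <# A" using one_A by (auto simp: FS.principal_eq)
  then have "x \<in> I [^]\<^bsub>FS.Inv\<^esub> n" using x by simp
  then obtain f where f: "f \<in> P.gr n" "ev f = x" using power_span(1)[OF I_def I, of n] by blast
  have pow: "u [^] i \<otimes> inv x \<in> A" if i: "i \<le> n" for i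
  proof -
    obtain a where a: "a \<in> A" "u [^] i = x \<otimes> a"
      using power_span(2)[OF I_def I i] x(3) by (auto simp: FS.principal_eq)
    then have "u [^] i \<otimes> inv x = inv x \<otimes> (x \<otimes> a)"
      using x inv_nonzero[OF x(1,2)] A_carrier[OF a(1)] by (simp add: m_comm)
    then show ?thesis using inv_mult_cancel[OF x(1,2) A_carrier[OF a(1)]] a(1) by simp
  qed
  have "f \<notin> q V" if V: "V \<in> Z" for V
  proof
    assume fV: "f \<in> q V"
    have one: "\<one> \<notin> val_max F V" using subringE(3)[OF Z_subring[OF V]] by (simp add: val_max_def)
    show False
    proof (cases "q V \<in> U0")
      case True
      \<comment> \<open>On this chart the pullback of \<open>f\<close> is \<open>x\<close>. If
        \<open>f\<close> vanished at \<open>q V\<close>, then \<open>x\<close> would be a nonunit of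
        \<open>V\<close>, against \<open>u^0 / x\<close> in \<open>A\<close>.\<close>
      have "sec0 n f (q V) \<in> P.loc_max (q V)"
        using True hfrac0[OF True f(1)] fV by (auto simp: sec0_def P.loc_max_def)
      then have "x \<in> val_max F V"
        using pull_loc_max[OF V openin_U(1) True sec0_section[OF f(1)]] pull_sec0[OF f(1)] f(2) by simp
      moreover have "inv x \<in> V" using pow[of 0] inv_nonzero[OF x(1,2)] A_subset[OF V] by auto
      ultimately show False using x(2) by (simp add: val_max_def)
    next
      case False
      then have U1: "q V \<in> U1" using proj_point_cases[OF V] by blast
      \<comment> \<open>On this chart the exponent \<open>n\<close> is decisive: \<open>?y\<close>
        times \<open>u^n\<close> is \<open>x\<close>, so \<open>u^n / x\<close>, an element of
        \<open>A\<close>, would be inverse to the nonunit \<open>?y\<close>.\<close>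
      let ?y = "pull \<phi> U1 (sec1 n f)"
      have FU1: "q (carrier F) \<in> U1" by (rule q_F_in[OF openin_U(2) V U1])
      have "sec1 n f (q V) \<in> P.loc_max (q V)"
        using U1 hfrac1[OF U1 f(1)] fV by (auto simp: sec1_def P.loc_max_def)
      then have y: "?y \<in> val_max F V" by (rule pull_loc_max[OF V openin_U(2) U1 sec1_section[OF f(1)]])
      have yC: "?y \<in> carrier F" using y Z_carrier[OF V] by (simp add: val_max_def)
      have "(u [^] n \<otimes> inv x) \<otimes> ?y = (?y \<otimes> u [^] n) \<otimes> inv x"
        using yC u_carrier inv_nonzero[OF x(1,2)] by (simp add: m_ac)
      also have "\<dots> = \<one>" using pull_sec1[OF f(1) FU1] f(2) r_inv_nonzero[OF x(1,2)] by simp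
      finally have "(u [^] n \<otimes> inv x) \<otimes> ?y = \<one>" .
      then show False
        using val_max_mult[OF Z_valuation[OF V] _ y, of "u [^] n \<otimes> inv x"] pow[of n] A_subset[OF V] one by auto
    qed
  qed
  moreover have "f \<noteq> \<zero>\<^bsub>P.S\<^esub>" using f(2) x(2) by auto
  ultimately show thesis using that n f(1) by blast
qed

end

lemma nonvanishing_exists:
  assumes "pruefer_domain_with_quotient_field A F" "torsion_group (picard_group F A)"
  shows "\<exists>d>0. \<exists>f\<in>P.gr d. f \<noteq> \<zero>\<^bsub>P.S\<^esub> \<and> q ` Z \<subseteq> P1_nonvanishing RA f"
proof (cases "q (carrier F) \<in> U0")
  case True
  obtain n :: nat and f where "0 < n" "f \<in> P.gr n" "f \<noteq> \<zero>\<^bsub>P.S\<^esub>" "\<And>V. V \<in> Z \<Longrightarrow> f \<notin> q V"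
    by (rule nonvanishing_generic[OF True assms]) (rule that)
  then show ?thesis using q_proj by (intro exI[of _ n] conjI bexI[of _ f]) (auto simp: P1_nonvanishing_def)
next
  case False
  \<comment> \<open>If some \<open>q V\<close> were in \<open>U0\<close>, the generic point would be
    mapped into \<open>U0\<close> as well. So the whole image lies in \<open>U1\<close>, and
    \<open>T1\<close> of degree \<open>1\<close> serves as \<open>f\<close>.\<close>
  have "P.T1 \<notin> q V" if V: "V \<in> Z" for V
    using proj_point_cases[OF V] q_F_in[OF openin_U(1) V] False by (auto simp: U1_def)
  moreover have "P.T1 \<noteq> \<zero>\<^bsub>P.S\<^esub>"
    using P.cf_mono[OF one_A, of 0 1 0 1] P.cf_zero[of 0 1] one_not_zero by auto
  ultimately show ?thesis using q_proj P.T_homogeneous(2)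
    by (intro exI[of _ 1] conjI bexI[of _ P.T1]) (auto simp: P1_nonvanishing_def)
qed

end

theorem theorem3p5:
  fixes F :: "'a ring" and D A :: "'a set" and Z :: "'a set set"
  assumes "field F"
    and "subring D F"
    and "Z \<subseteq> zariski_riemann F D"
    and "carrier F \<in> Z"
    and "A = \<Inter>Z"
  shows "(pruefer_domain_with_quotient_field A F \<and> torsion_group (picard_group F A)) \<longleftrightarrow>
    (\<forall>\<phi>. zr_P1_morphism F D Z A \<phi> \<longrightarrow>
      (\<exists>d>0. \<exists>f\<in>poly2_homogeneous (F\<lparr>carrier := A\<rparr>) d.
        f \<noteq> \<zero>\<^bsub>poly2_ring (F\<lparr>carrier := A\<rparr>)\<^esub> \<and>
        pt \<phi> ` Z \<subseteq> P1_nonvanishing (F\<lparr>carrier := A\<rparr>) f))"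
proof -
  interpret zr_setting F D A Z
    using assms by (simp add: zr_setting_def zr_setting_axioms_def)
  show ?thesis
  proof
    assume "pruefer_domain_with_quotient_field A F \<and> torsion_group (picard_group F A)"
    then show "\<forall>\<phi>. zr_P1_morphism F D Z A \<phi> \<longrightarrow>
      (\<exists>d>0. \<exists>f\<in>P.gr d. f \<noteq> \<zero>\<^bsub>P.S\<^esub> \<and> pt \<phi> ` Z \<subseteq> P1_nonvanishing RA f)"
      using zr_map.nonvanishing_exists[of F D A Z] zr_setting_axioms
      by (simp add: zr_map_def zr_map_axioms_def)
  next
    assume "\<forall>\<phi>. zr_P1_morphism F D Z A \<phi> \<longrightarrow>
      (\<exists>d>0. \<exists>f\<in>P.gr d. f \<noteq> \<zero>\<^bsub>P.S\<^esub> \<and> pt \<phi> ` Z \<subseteq> P1_nonvanishing RA f)"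
    then interpret zr_nonvanishing F D A Z by unfold_locales blast
    show "pruefer_domain_with_quotient_field A F \<and> torsion_group (picard_group F A)"
      using pruefer torsion_picard by blast
  qed
qed

end
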